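(* Let $1/2\le p\le 1$. Then, for $h\in C[p,1]$, the measure $\mathbb{P}^{(\frac{1}{\sqrt p}\nabla_pB+h)_{[p,1]}}$ is absolutely continuous with respect to $\mathbb{P}^{(\frac{1}{\sqrt p}\nabla_pB)_{[p,1]}}$ if and only if $h\in\mathcal{H}_{p\text{-Sl}}$. For $h=\frac{1}{\sqrt p}s_f(p)+s_{\frac{1}{\sqrt p}\nabla_p f}(\cdot)\in\mathcal{H}_{p\text{-Sl}}$, where $f\in L^2[0,1]$, it holds for $\mathbb{P}^{(\frac{1}{\sqrt p}\nabla_pB)_{[p,1]}}$-almost all $\frac{1}{\sqrt p}\nabla_pb\in C[p,1]$ that $$\frac{d\mathbb{P}^{(\frac{1}{\sqrt p}\nabla_pB+h)_{[p,1]}}}{d\mathbb{P}^{(\frac{1}{\sqrt p}\nabla_pB)_{[p,1]}}}\left(\tfrac{1}{\sqrt p}\nabla_pb\right)=\exp\Bigg(-\frac{1}{4p}\left(\frac{(2s_f(p)+\delta(1-p))^2}{3p-1}+\|f(\cdot)-f(\cdot-p)\|^2_{L^2[p,1]}\right)$$ $$\qquad+\frac{3s_f(p)+s_{\nabla_p f}(1)}{2(3p-1)}\left(\nabla_pb(p)+\nabla_pb(1)\right)+\frac12\int_p^1\nabla_p f(s)\,d(\nabla_pb(s))\Bigg),$$ where $\delta=\frac{1}{1-p}\left(s_f(1)-s_f(p)-s_f(1-p)\right)$.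
   Context: $B=(B_t)_{t\in[0,1]}$ is standard Brownian motion with continuous paths. $C[a,b]$ is the space of real-valued continuous functions on $[a,b]$ with its Borel $\sigma$-algebra, and $L^2[a,b]$ is the space of functions on $[a,b]$ square-integrable with respect to Lebesgue measure. The backward difference operator is $\nabla_pF(t)=F(t)-F(t-p)$, considered for $t\in[p,1]$ when $F$ is defined on $[0,1]$. The $p$-Slepian process is $\frac{1}{\sqrt p}(\nabla_pB)_{[p,1]}=\left(\frac{1}{\sqrt p}(B_t-B_{t-p})\right)_{t\in[p,1]}$. $\mathbb{P}^{(\frac{1}{\sqrt p}\nabla_pB)_{[p,1]}}$ and $\mathbb{P}^{(\frac{1}{\sqrt p}\nabla_pB+h)_{[p,1]}}$ are the distributions on $C[p,1]$ of this process and of this process shifted by the deterministic function $h$. Paths of the process are written as $\frac{1}{\sqrt p}\nabla_pb$. For $f\in L^2[0,1]$, $s_f(t)=\int_0^t f(u)\,du$, $t\in[0,1]$. For a function $g$ defined on $[p,1]$, such as $\nabla_p f$ or $\frac{1}{\sqrt p}\nabla_p f$, $s_g(t)=\int_p^t g(u)\,du$, $t\in[p,1]$. Thus $\frac{1}{\sqrt p}\nabla_p s_f(t)=\frac{1}{\sqrt p}s_f(p)+s_{\frac{1}{\sqrt p}\nabla_p f}(t)$ for $t\in[p,1]$. $\mathcal{H}_{p\text{-Sl}}$ is the kernel (reproducing kernel Hilbert space, or Cameron-Martin space) of the distribution of the $p$-Slepian process. As a set, $\mathcal{H}_{p\text{-Sl}}=\{\frac{1}{\sqrt p}\nabla_p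 s_f:[p,1]\to\mathbb{R}\;:\;f\in L^2[0,1]\}=\{c+s_g:[p,1]\to\mathbb{R}\;:\;c\in\mathbb{R},\ g\in L^2[p,1]\}$. The integral with respect to $\nabla_pb$ is understood as a Wiener integral: evaluated at the random path, $\int_p^1\nabla_p f(s)\,d(\nabla_pB(s))=\int_p^1\nabla_p f(s)\,dB(s)-\int_p^1\nabla_p f(s)\,dB(s-p)$.
   Formalization: The printed density is false: the prefactor -1/(4p) is corrected to -1/4, and 3s_f(p) in the coefficient of ∇_p b(p)+∇_p b(1) is corrected to 2s_f(p); at p=1, where δ is undefined, δ(1-p) is read as 0. *)

theory Defs
  imports "HOL-Probability.Probability"
begin

definition brownian_motion_01 :: "'a measure \<Rightarrow> (real \<Rightarrow> 'a \<Rightarrow> real) \<Rightarrow> bool" where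
  "brownian_motion_01 M B \<longleftrightarrow>
     prob_space M \<and>
     (\<forall>t\<in>{0..1}. B t \<in> borel_measurable M) \<and>
     (AE \<omega> in M. B 0 \<omega> = 0) \<and>
     (\<forall>s t. 0 \<le> s \<longrightarrow> s < t \<longrightarrow> t \<le> 1 \<longrightarrow>
        distributed M lborel (\<lambda>\<omega>. B t \<omega> - B s \<omega>) (normal_density 0 (sqrt (t - s)))) \<and>
     (\<forall>(n::nat) t. (\<forall>i\<le>n. t i \<in> {0..1}) \<longrightarrow> (\<forall>i<n. t i < t (Suc i)) \<longrightarrow>
        prob_space.indep_vars M (\<lambda>_. borel) (\<lambda>i \<omega>. B (t (Suc i)) \<omega> - B (t i) \<omega>) {..<n}) \<and>
     (\<forall>\<omega>\<in>space M. continuous_on {0..1} (\<lambda>t. B t \<omega>))"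


text \<open>The metric space C[a,b] with the supremum distance. Its points are the functions that
  are continuous on \<open>{a..b}\<close> and equal to \<open>undefined\<close> outside of it. For \<open>a = b\<close> it is a copy
  of the real line.\<close>

definition C_space :: "real \<Rightarrow> real \<Rightarrow> (real \<Rightarrow> real) metric" where
  "C_space a b = cfunspace (top_of_set {a..b}) euclidean_metric"

definition C_borel :: "real \<Rightarrow> real \<Rightarrow> (real \<Rightarrow> real) measure" where
  "C_borel a b = sigma (mspace (C_space a b)) {U. openin (mtopology_of (C_space a b)) U}"


text \<open>Elements of L2[a,b] are represented by Lebesgue (not necessarily Borel) measurable
  functions, hence \<open>lebesgue_on\<close> rather than \<open>lborel\<close> in all integrals over the time axis.\<close>

definition L2_on :: "real \<Rightarrow> real \<Rightarrow> (real \<Rightarrow> real) \<Rightarrow> bool" where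
  "L2_on a b f \<longleftrightarrow> f \<in> borel_measurable (lebesgue_on {a..b}) \<and>
     integrable (lebesgue_on {a..b}) (\<lambda>u. (f u)\<^sup>2)"

definition L2_norm_on :: "real \<Rightarrow> real \<Rightarrow> (real \<Rightarrow> real) \<Rightarrow> real" where
  "L2_norm_on a b f = sqrt (LINT u|lebesgue_on {a..b}. (f u)\<^sup>2)"

definition s_int :: "real \<Rightarrow> (real \<Rightarrow> real) \<Rightarrow> real \<Rightarrow> real" where
  "s_int a f t = (LINT u|lebesgue_on {a..t}. f u)"

definition nabla :: "real \<Rightarrow> (real \<Rightarrow> real) \<Rightarrow> real \<Rightarrow> real" where
  "nabla p F t = F t - F (t - p)"


definition slepian_path ::
  "(real \<Rightarrow> 'a \<Rightarrow> real) \<Rightarrow> real \<Rightarrow> (real \<Rightarrow> real) \<Rightarrow> 'a \<Rightarrow> (real \<Rightarrow> real)" where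
  "slepian_path B p h \<omega> = (\<lambda>t\<in>{p..1}. 1 / sqrt p * nabla p (\<lambda>u. B u \<omega>) t + h t)"

definition slepian_law ::
  "'a measure \<Rightarrow> (real \<Rightarrow> 'a \<Rightarrow> real) \<Rightarrow> real \<Rightarrow> (real \<Rightarrow> real) \<Rightarrow> (real \<Rightarrow> real) measure" where
  "slepian_law M B p h = distr M (C_borel p 1) (slepian_path B p h)"


text \<open>The kernel (reproducing kernel Hilbert space, Cameron-Martin space) of a centred Gaussian
  measure \<open>\<mu>\<close> on C[a,b], as a set of functions on \<open>{a..b}\<close>: the image of the
  \<open>L\<^sup>2(\<mu>)\<close>-closure of the linear span of the evaluations \<open>x \<mapsto> x t\<close> under the map that sends
  \<open>Z\<close> to \<open>t \<mapsto> E[Z x(t)]\<close>. It is the Hilbert space with reproducing kernel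
  \<open>(s, t) \<mapsto> E[x(s) x(t)]\<close>. The squared distance is taken in \<open>ennreal\<close>, so that its being
  finite is part of the condition.\<close>

definition L2_evaluation_closure ::
  "real \<Rightarrow> real \<Rightarrow> (real \<Rightarrow> real) measure \<Rightarrow> ((real \<Rightarrow> real) \<Rightarrow> real) set" where
  "L2_evaluation_closure a b \<mu> =
     {Z \<in> borel_measurable \<mu>. \<forall>\<epsilon>>0. \<exists>(n::nat) c t. (\<forall>i<n. t i \<in> {a..b}) \<and>
        (\<integral>\<^sup>+x. ennreal ((Z x - (\<Sum>i<n. c i * x (t i)))\<^sup>2) \<partial>\<mu>) < ennreal \<epsilon>}"

definition gaussian_kernel ::
  "real \<Rightarrow> real \<Rightarrow> (real \<Rightarrow> real) measure \<Rightarrow> (real \<Rightarrow> real) set" where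
  "gaussian_kernel a b \<mu> =
     {(\<lambda>t\<in>{a..b}. LINT x|\<mu>. Z x * x t) |Z. Z \<in> L2_evaluation_closure a b \<mu>}"

definition H_Slepian ::
  "'a measure \<Rightarrow> (real \<Rightarrow> 'a \<Rightarrow> real) \<Rightarrow> real \<Rightarrow> (real \<Rightarrow> real) set" where
  "H_Slepian M B p = gaussian_kernel p 1 (slepian_law M B p (\<lambda>_. 0))"


text \<open>The Wiener integral over \<open>[a,b]\<close> of a deterministic integrand \<open>g\<close> with respect to a
  process \<open>Y\<close>, as the extension by \<open>L\<^sup>2\<close>-continuity of the elementary integral: \<open>I\<close> is a version
  of the integral of \<open>g\<close> if \<open>(g, I)\<close> lies in the closure, in the product of L2[a,b] and
  \<open>L\<^sup>2(M)\<close>, of the set of pairs consisting of a step function and its elementary integral.\<close>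

definition step_fun :: "nat \<Rightarrow> (nat \<Rightarrow> real) \<Rightarrow> (nat \<Rightarrow> real) \<Rightarrow> (nat \<Rightarrow> real) \<Rightarrow> real \<Rightarrow> real" where
  "step_fun n c u v s = (\<Sum>i<n. c i * indicator {u i<..v i} s)"

definition step_integral ::
  "(real \<Rightarrow> 'a \<Rightarrow> real) \<Rightarrow> nat \<Rightarrow> (nat \<Rightarrow> real) \<Rightarrow> (nat \<Rightarrow> real) \<Rightarrow> (nat \<Rightarrow> real) \<Rightarrow> 'a \<Rightarrow> real" where
  "step_integral Y n c u v \<omega> = (\<Sum>i<n. c i * (Y (v i) \<omega> - Y (u i) \<omega>))"

definition is_wiener_integral ::
  "'a measure \<Rightarrow> (real \<Rightarrow> 'a \<Rightarrow> real) \<Rightarrow> real \<Rightarrow> real \<Rightarrow> (real \<Rightarrow> real) \<Rightarrow> ('a \<Rightarrow> real) \<Rightarrow> bool" where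
  "is_wiener_integral M Y a b g I \<longleftrightarrow> I \<in> borel_measurable M \<and>
     (\<forall>\<epsilon>>0. \<exists>n c u v. (\<forall>i<n. a \<le> u i \<and> u i \<le> v i \<and> v i \<le> b) \<and>
        (\<integral>\<^sup>+s. ennreal ((g s - step_fun n c u v s)\<^sup>2) \<partial>lebesgue_on {a..b}) < ennreal \<epsilon> \<and>
        (\<integral>\<^sup>+\<omega>. ennreal ((I \<omega> - step_integral Y n c u v \<omega>)\<^sup>2) \<partial>M) < ennreal \<epsilon>)"

text \<open>\<open>J\<close> is a version of the integral of \<open>g\<close> over \<open>[p,1]\<close> with respect to \<open>\<nabla>\<^sub>p b\<close>, a functional
  of the path \<open>x = \<nabla>\<^sub>p b / \<surd>p\<close> in C[p,1]: evaluated at the random path it is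
  the Wiener integral of \<open>g\<close> against \<open>dB(s)\<close> minus the one against \<open>dB(s - p)\<close>. This determines
  \<open>J\<close> almost everywhere with respect to the law of the Slepian process.\<close>

definition is_nabla_wiener_integral ::
  "'a measure \<Rightarrow> (real \<Rightarrow> 'a \<Rightarrow> real) \<Rightarrow> real \<Rightarrow> (real \<Rightarrow> real) \<Rightarrow> ((real \<Rightarrow> real) \<Rightarrow> real) \<Rightarrow> bool" where
  "is_nabla_wiener_integral M B p g J \<longleftrightarrow>
     J \<in> borel_measurable (slepian_law M B p (\<lambda>_. 0)) \<and>
     (\<exists>I\<^sub>1 I\<^sub>2. is_wiener_integral M B p 1 g I\<^sub>1 \<and>
        is_wiener_integral M (\<lambda>s. B (s - p)) p 1 g I\<^sub>2 \<and>
        (AE \<omega> in M. J (slepian_path B p (\<lambda>_. 0) \<omega>) = I\<^sub>1 \<omega> - I\<^sub>2 \<omega>))"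


text \<open>The exponent of the density, as a function of \<open>f\<close>, of a path \<open>x\<close>, and of the value \<open>J\<close> of
  the Wiener integral of \<open>\<nabla>\<^sub>p f\<close> with respect to \<open>\<nabla>\<^sub>p b = \<surd>p x\<close>. The Slepian covariance
  \<open>1 - \<bar>s - t\<bar> / p\<close> gives the kernel norm
  \<open>p/2 \<parallel>h'\<parallel>\<^sup>2 + p (h(p) + h(1))\<^sup>2 / (2 (3p - 1))\<close>, and minus one half of it, for
  \<open>h = \<nabla>\<^sub>p s\<^sub>f / \<surd>p\<close>, is the first summand. The published formula has the prefactor
  \<open>1/(4p)\<close> instead of \<open>1/4\<close> and \<open>3 s\<^sub>f(p)\<close> instead of \<open>2 s\<^sub>f(p)\<close> in the second summand. With those
  constants the claim is false: for \<open>p = 1\<close> and \<open>f = 1\<close> it would make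
  \<open>exp (3x/2 - 1/2)\<close>, and not \<open>exp (x - 1/2)\<close>, the density of N(1,1) with respect to N(0,1).\<close>

definition slepian_exponent ::
  "real \<Rightarrow> (real \<Rightarrow> real) \<Rightarrow> (real \<Rightarrow> real) \<Rightarrow> real \<Rightarrow> real" where
  "slepian_exponent p f x J =
     (let s = s_int 0 f;
          \<delta> = 1 / (1 - p) * (s 1 - s p - s (1 - p));
          nb = (\<lambda>t. sqrt p * x t)
      in - (1 / 4) * ((2 * s p + \<delta> * (1 - p))\<^sup>2 / (3 * p - 1)
                      + (L2_norm_on p 1 (\<lambda>t. f t - f (t - p)))\<^sup>2)
         + (2 * s p + s_int p (nabla p f) 1) / (2 * (3 * p - 1)) * (nb p + nb 1)
         + 1 / 2 * J)"

end

theory Submission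
  imports Defs
begin

text \<open>
  The Slepian process is a centred Gaussian process with continuous paths, so both parts of the
  result are instances of the Cameron-Martin theorem, once the functional that represents a shift
  is known.

  Let \<open>\<mu>\<close> be a centred Gaussian measure on \<open>C[a,b]\<close>. If \<open>h(t) = E[Z x(t)]\<close> for some \<open>Z\<close> in the
  \<open>L\<^sup>2\<close>-closure of the combinations of evaluations, then the law shifted by \<open>h\<close> has the density
  \<open>exp (Z - E[Z\<^sup>2] / 2)\<close>: both measures give the same characteristic function to every combination
  of evaluations (lemma \<open>Cameron_Martin_density\<close>), and these determine a measure on \<open>C[a,b]\<close>
  (lemma \<open>C_borel_measure_eqI\<close>). Conversely, if the shifted law is absolutely continuous, then
  \<open>A \<mapsto> A h\<close> is bounded in \<open>L\<^sup>2\<close> on the combinations \<open>A\<close> of evaluations, and the Riesz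
  representation gives \<open>Z\<close> (lemmas \<open>absolutely_continuous_imp_representer\<close> and \<open>L2_Riesz\<close>). This
  proves the equivalence for the kernel of any such measure.

  For \<open>p \<ge> 1/2\<close> the increments of \<open>B\<close> over \<open>[s, t]\<close> and \<open>[s - p, t - p]\<close> are uncorrelated whenever
  \<open>p \<le> s \<le> t \<le> 1\<close>. Hence the Slepian process \<open>x\<close> satisfies \<open>E[(x(t) - x(s))\<^sup>2] = 2 \<bar>t - s\<bar> / p\<close> and
  \<open>E[x(s) x(t)] = 1 - \<bar>t - s\<bar> / p\<close>. The first identity gives the Wiener integral \<open>J\<close> of \<open>g\<close> with
  respect to \<open>\<surd>p x\<close>, with \<open>E[J\<^sup>2] = 2 \<parallel>g\<parallel>\<^sup>2\<close>. The second one shows that \<open>x(p) + x(1)\<close>, of variance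
  \<open>2 (3p - 1) / p\<close>, is uncorrelated with all increments and hence with \<open>J\<close>. For
  \<open>g = \<nabla>\<^sub>p f\<close> and the shift \<open>h = (s\<^sub>f(p) + s\<^sub>g) / \<surd>p\<close>, it follows that
  \<open>Z = (2 s\<^sub>f(p) + s\<^sub>g(1)) / (2 (3p - 1)) \<surd>p (x(p) + x(1)) + J / 2\<close> represents \<open>h\<close> and that
  \<open>E[Z\<^sup>2] = 1/2 ((2 s\<^sub>f(p) + s\<^sub>g(1))\<^sup>2 / (3p - 1) + \<parallel>g\<parallel>\<^sup>2)\<close>
  (lemma \<open>slepian_representer\<close>). Since \<open>s\<^sub>g(1) = \<delta> (1 - p)\<close>, the exponent \<open>Z - E[Z\<^sup>2] / 2\<close> is the one
  of the theorem.
\<close>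

section \<open>Square integrable functions\<close>

definition square_integrable :: "'a measure \<Rightarrow> ('a \<Rightarrow> real) \<Rightarrow> bool" where
  "square_integrable M f \<longleftrightarrow> f \<in> borel_measurable M \<and> integrable M (\<lambda>x. (f x)\<^sup>2)"

lemma square_integrable_measurable [measurable_dest]:
  "square_integrable M f \<Longrightarrow> f \<in> borel_measurable M"
  by (simp add: square_integrable_def)

lemma square_integrable_mult:
  assumes "square_integrable M f" "square_integrable M g"
  shows "integrable M (\<lambda>x. f x * g x)"
proof (rule Bochner_Integration.integrable_bound)
  show "integrable M (\<lambda>x. (f x)\<^sup>2 + (g x)\<^sup>2)"
    using assms by (auto simp: square_integrable_def)
  show "(\<lambda>x. f x * g x) \<in> borel_measurable M"
    using assms by (auto simp: square_integrable_def)
  have "\<bar>a * b\<bar> \<le> a\<^sup>2 + b\<^sup>2" for a b :: real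
  proof -
    have "0 \<le> \<bar>a\<bar> * \<bar>b\<bar>" by simp
    moreover have "2 * (\<bar>a\<bar> * \<bar>b\<bar>) \<le> a\<^sup>2 + b\<^sup>2"
      using sum_squares_bound[of "\<bar>a\<bar>" "\<bar>b\<bar>"] by (simp add: mult.assoc)
    ultimately show ?thesis unfolding abs_mult by linarith
  qed
  then show "AE x in M. norm (f x * g x) \<le> norm ((f x)\<^sup>2 + (g x)\<^sup>2)"
    by auto
qed

lemma square_integrable_add [intro]:
  assumes "square_integrable M f" "square_integrable M g"
  shows "square_integrable M (\<lambda>x. f x + g x)"
  using assms square_integrable_mult[OF assms]
  by (auto simp: square_integrable_def power2_sum mult.assoc)

lemma square_integrable_cmult [intro]:
  "square_integrable M f \<Longrightarrow> square_integrable M (\<lambda>x. c * f x)"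
  by (auto simp: square_integrable_def power_mult_distrib)

lemma square_integrable_diff [intro]:
  assumes "square_integrable M f" "square_integrable M g"
  shows "square_integrable M (\<lambda>x. f x - g x)"
  using square_integrable_add[OF assms(1) square_integrable_cmult[OF assms(2), of "-1"]] by simp

lemma square_integrable_zero [simp]: "square_integrable M (\<lambda>x. 0)"
  by (simp add: square_integrable_def)

lemma square_integrable_sum [intro]:
  "(\<And>i. i \<in> I \<Longrightarrow> square_integrable M (f i)) \<Longrightarrow> square_integrable M (\<lambda>x. \<Sum>i\<in>I. f i x)"
  by (induction I rule: infinite_finite_induct) auto

lemma square_integrable_integrable:
  "finite_measure M \<Longrightarrow> square_integrable M f \<Longrightarrow> integrable M f"
  using square_integrable_mult[of M f "\<lambda>_. 1"]
  by (simp add: square_integrable_def finite_measure.integrable_const)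

lemma integral_square_add:
  assumes "square_integrable M f" "square_integrable M g"
  shows "(LINT x|M. (f x + g x)\<^sup>2) = (LINT x|M. (f x)\<^sup>2) + 2 * (LINT x|M. f x * g x) + (LINT x|M. (g x)\<^sup>2)"
  using assms square_integrable_mult[OF assms]
  by (simp add: square_integrable_def power2_sum mult.assoc)

lemma integral_square_cmult:
  fixes f :: "'a \<Rightarrow> real"
  shows "(LINT x|M. (c * f x)\<^sup>2) = c\<^sup>2 * (LINT x|M. (f x)\<^sup>2)"
  by (simp add: power_mult_distrib)

lemma integral_square_diff:
  assumes "square_integrable M f" "square_integrable M g"
  shows "(LINT x|M. (f x - g x)\<^sup>2) = (LINT x|M. (f x)\<^sup>2) - 2 * (LINT x|M. f x * g x) + (LINT x|M. (g x)\<^sup>2)"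
  using integral_square_add[OF assms(1) square_integrable_cmult[OF assms(2), of "-1"]] by simp

lemma integral_square_add_le:
  assumes "square_integrable M f" "square_integrable M g"
  shows "(LINT x|M. (f x + g x)\<^sup>2) \<le> 2 * (LINT x|M. (f x)\<^sup>2) + 2 * (LINT x|M. (g x)\<^sup>2)"
proof -
  have "0 \<le> (LINT x|M. (f x - g x)\<^sup>2)" by simp
  then show ?thesis
    using integral_square_add[OF assms] integral_square_diff[OF assms] by simp
qed

lemma integral_square_diff_le:
  assumes "square_integrable M f" "square_integrable M g" "square_integrable M h"
  shows "(LINT x|M. (f x - h x)\<^sup>2) \<le> 2 * (LINT x|M. (f x - g x)\<^sup>2) + 2 * (LINT x|M. (g x - h x)\<^sup>2)"
  using integral_square_add_le[of M "\<lambda>x. f x - g x" "\<lambda>x. g x - h x"] assms by auto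

text \<open>The quadratic \<open>t \<mapsto> \<integral>(f + t g)\<^sup>2\<close> is nonnegative, so its discriminant is not positive.\<close>

lemma integral_Cauchy_Schwarz:
  assumes "square_integrable M f" "square_integrable M g"
  shows "(LINT x|M. f x * g x)\<^sup>2 \<le> (LINT x|M. (f x)\<^sup>2) * (LINT x|M. (g x)\<^sup>2)"
proof -
  define a b c where "a = (LINT x|M. (g x)\<^sup>2)" and "b = (LINT x|M. f x * g x)"
    and "c = (LINT x|M. (f x)\<^sup>2)"
  have q: "0 \<le> c + 2 * t * b + t\<^sup>2 * a" for t
  proof -
    have "0 \<le> (LINT x|M. (f x + t * g x)\<^sup>2)" by simp
    also have "\<dots> = c + 2 * (LINT x|M. f x * (t * g x)) + t\<^sup>2 * a"
      using integral_square_add[OF assms(1) square_integrable_cmult[OF assms(2)], of t]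
      by (simp add: a_def c_def integral_square_cmult)
    also have "(LINT x|M. f x * (t * g x)) = t * b"
      by (simp add: b_def mult.left_commute)
    finally show ?thesis by simp
  qed
  have a0: "0 \<le> a" by (simp add: a_def)
  show ?thesis
  proof (cases "a = 0")
    case True
    have "b = 0"
    proof (rule ccontr)
      assume "b \<noteq> 0"
      with q[of "- (c + 1) / (2 * b)"] True show False by (simp add: field_simps)
    qed
    then show ?thesis using True by (simp add: a_def b_def c_def)
  next
    case False
    then show ?thesis
      using q[of "- b / a"] a0 unfolding a_def[symmetric] b_def[symmetric] c_def[symmetric]
      by (simp add: field_simps power2_eq_square)
  qed
qed

text \<open>Square integrability of all terms and of the limit is part of the notion, so that
  sums, multiples and inner products of convergent sequences need no side conditions.\<close>

definition L2_tendsto :: "'a measure \<Rightarrow> (nat \<Rightarrow> 'a \<Rightarrow> real) \<Rightarrow> ('a \<Rightarrow> real) \<Rightarrow> bool" where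
  "L2_tendsto M f g \<longleftrightarrow> (\<forall>n. square_integrable M (f n)) \<and> square_integrable M g \<and>
     (\<lambda>n. LINT x|M. (f n x - g x)\<^sup>2) \<longlonglongrightarrow> 0"

lemma L2_tendstoD:
  assumes "L2_tendsto M f g"
  shows "square_integrable M (f n)" "square_integrable M g"
    "(\<lambda>n. LINT x|M. (f n x - g x)\<^sup>2) \<longlonglongrightarrow> 0"
  using assms by (auto simp: L2_tendsto_def)

lemma L2_tendsto_const: "square_integrable M f \<Longrightarrow> L2_tendsto M (\<lambda>_. f) f"
  by (simp add: L2_tendsto_def)

lemma L2_tendsto_add:
  assumes "L2_tendsto M f g" "L2_tendsto M f' g'"
  shows "L2_tendsto M (\<lambda>n x. f n x + f' n x) (\<lambda>x. g x + g' x)"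
proof -
  note a = L2_tendstoD[OF assms(1)] L2_tendstoD[OF assms(2)]
  have "(\<lambda>n. LINT x|M. ((f n x + f' n x) - (g x + g' x))\<^sup>2) \<longlonglongrightarrow> 0"
  proof (rule tendsto_sandwich[OF always_eventually always_eventually tendsto_const])
    show "\<forall>n. 0 \<le> (LINT x|M. ((f n x + f' n x) - (g x + g' x))\<^sup>2)" by simp
    show "\<forall>n. (LINT x|M. ((f n x + f' n x) - (g x + g' x))\<^sup>2) \<le>
       2 * (LINT x|M. (f n x - g x)\<^sup>2) + 2 * (LINT x|M. (f' n x - g' x)\<^sup>2)"
    proof
      fix n
      show "(LINT x|M. ((f n x + f' n x) - (g x + g' x))\<^sup>2) \<le>
       2 * (LINT x|M. (f n x - g x)\<^sup>2) + 2 * (LINT x|M. (f' n x - g' x)\<^sup>2)"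
        using integral_square_add_le[of M "\<lambda>x. f n x - g x" "\<lambda>x. f' n x - g' x"] a
        by (auto simp: algebra_simps)
    qed
    show "(\<lambda>n. 2 * (LINT x|M. (f n x - g x)\<^sup>2) + 2 * (LINT x|M. (f' n x - g' x)\<^sup>2)) \<longlonglongrightarrow> 0"
      using a by (auto intro!: tendsto_eq_intros)
  qed
  then show ?thesis using a by (auto simp: L2_tendsto_def)
qed

lemma L2_tendsto_cmult:
  assumes "L2_tendsto M f g"
  shows "L2_tendsto M (\<lambda>n x. c * f n x) (\<lambda>x. c * g x)"
proof -
  note a = L2_tendstoD[OF assms]
  have "(LINT x|M. (c * f n x - c * g x)\<^sup>2) = c\<^sup>2 * (LINT x|M. (f n x - g x)\<^sup>2)" for n
    by (simp flip: right_diff_distrib add: power_mult_distrib)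
  then show ?thesis using a by (auto simp: L2_tendsto_def intro!: tendsto_eq_intros)
qed

lemma L2_tendsto_diff:
  assumes "L2_tendsto M f g" "L2_tendsto M f' g'"
  shows "L2_tendsto M (\<lambda>n x. f n x - f' n x) (\<lambda>x. g x - g' x)"
  using L2_tendsto_add[OF assms(1) L2_tendsto_cmult[OF assms(2), of "-1"]] by simp

lemma L2_tendsto_transfer:
  assumes "L2_tendsto M f h" "\<And>n. square_integrable M (f' n)"
    "(\<lambda>n. LINT x|M. (f' n x - f n x)\<^sup>2) \<longlonglongrightarrow> 0"
  shows "L2_tendsto M f' h"
proof -
  have "L2_tendsto M (\<lambda>n x. f' n x - f n x) (\<lambda>_. 0)"
    using assms by (auto simp: L2_tendsto_def)
  from L2_tendsto_add[OF this assms(1)] show ?thesis by simp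
qed

lemma L2_tendsto_inner:
  assumes "L2_tendsto M f g" "square_integrable M h"
  shows "(\<lambda>n. LINT x|M. f n x * h x) \<longlonglongrightarrow> (LINT x|M. g x * h x)"
proof -
  note a = L2_tendstoD[OF assms(1)] assms(2)
  have i: "integrable M (\<lambda>x. f n x * h x)" "integrable M (\<lambda>x. g x * h x)" for n
    using a by (auto intro!: square_integrable_mult)
  have "(\<lambda>n. (LINT x|M. f n x * h x) - (LINT x|M. g x * h x)) \<longlonglongrightarrow> 0"
  proof (rule Lim_null_comparison)
    show "\<forall>\<^sub>F n in sequentially. norm ((LINT x|M. f n x * h x) - (LINT x|M. g x * h x))
       \<le> sqrt ((LINT x|M. (f n x - g x)\<^sup>2) * (LINT x|M. (h x)\<^sup>2))"
    proof (intro always_eventually allI)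
      fix n
      have "(LINT x|M. f n x * h x) - (LINT x|M. g x * h x) = (LINT x|M. (f n x - g x) * h x)"
        using i by (simp add: left_diff_distrib)
      then show "norm ((LINT x|M. f n x * h x) - (LINT x|M. g x * h x))
       \<le> sqrt ((LINT x|M. (f n x - g x)\<^sup>2) * (LINT x|M. (h x)\<^sup>2))"
        using integral_Cauchy_Schwarz[OF square_integrable_diff[OF a(1) a(2)] a(4)]
        by (auto intro!: real_le_rsqrt)
    qed
    show "(\<lambda>n. sqrt ((LINT x|M. (f n x - g x)\<^sup>2) * (LINT x|M. (h x)\<^sup>2))) \<longlonglongrightarrow> 0"
      using a(3) by (auto intro!: tendsto_eq_intros)
  qed
  then show ?thesis by (simp add: LIM_zero_iff)
qed

lemma L2_tendsto_square:
  assumes "L2_tendsto M f g"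
  shows "(\<lambda>n. LINT x|M. (f n x)\<^sup>2) \<longlonglongrightarrow> (LINT x|M. (g x)\<^sup>2)"
proof -
  note a = L2_tendstoD[OF assms]
  have "(LINT x|M. (f n x)\<^sup>2) = (LINT x|M. (f n x - g x)\<^sup>2) + 2 * (LINT x|M. f n x * g x) - (LINT x|M. (g x)\<^sup>2)" for n
    using integral_square_diff[of M "f n" g] a by simp
  moreover have "(\<lambda>n. (LINT x|M. (f n x - g x)\<^sup>2) + 2 * (LINT x|M. f n x * g x) - (LINT x|M. (g x)\<^sup>2))
    \<longlonglongrightarrow> 0 + 2 * (LINT x|M. g x * g x) - (LINT x|M. (g x)\<^sup>2)"
    by (intro tendsto_intros a L2_tendsto_inner[OF assms a(2)])
  ultimately show ?thesis by (simp add: power2_eq_square)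
qed

lemma inverse_Suc_tendsto_zero: "(\<lambda>n. 1 / (real n + 1)) \<longlonglongrightarrow> 0"
  using LIMSEQ_inverse_real_of_nat by (simp add: inverse_eq_divide add.commute)

text \<open>Completeness of \<open>L\<^sup>2\<close>: on a finite measure space an \<open>L\<^sup>2\<close>-Cauchy sequence is
  \<open>L\<^sup>1\<close>-Cauchy, so a subsequence converges almost everywhere, and Fatou's lemma turns this
  into convergence in \<open>L\<^sup>2\<close>.\<close>

lemma L2_complete:
  assumes fin: "finite_measure M" and si: "\<And>n. square_integrable M (f n)"
    and cauchy: "\<And>e. e > 0 \<Longrightarrow> \<exists>N. \<forall>i\<ge>N. \<forall>j\<ge>N. (LINT x|M. (f i x - f j x)\<^sup>2) \<le> e"
  obtains g where "L2_tendsto M f g"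
proof -
  interpret finite_measure M by (rule fin)
  have [measurable]: "f n \<in> borel_measurable M" for n using si by (auto simp: square_integrable_def)
  define c where "c = measure M (space M) + 1"
  have c0: "c > 0" by (simp add: c_def add_nonneg_pos)
  have l1: "\<exists>N. \<forall>i\<ge>N. \<forall>j\<ge>N. (LINT x|M. norm (f i x - f j x)) < e" if "e > 0" for e
  proof -
    obtain N where N: "\<And>i j. i \<ge> N \<Longrightarrow> j \<ge> N \<Longrightarrow> (LINT x|M. (f i x - f j x)\<^sup>2) \<le> e\<^sup>2 / (2 * c)"
      using cauchy[of "e\<^sup>2 / (2 * c)"] \<open>e > 0\<close> c0 by auto
    have "(LINT x|M. norm (f i x - f j x)) < e" if "i \<ge> N" "j \<ge> N" for i j
    proof -
      have s: "square_integrable M (\<lambda>x. \<bar>f i x - f j x\<bar>)"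
        using square_integrable_diff[OF si[of i] si[of j]] by (auto simp: square_integrable_def)
      have "(LINT x|M. \<bar>f i x - f j x\<bar> * 1)\<^sup>2 \<le> (LINT x|M. (f i x - f j x)\<^sup>2) * measure M (space M)"
        using integral_Cauchy_Schwarz[OF s, of "\<lambda>_. 1"] by (simp add: square_integrable_def)
      also have "\<dots> \<le> e\<^sup>2 / (2 * c) * c"
        using N[OF that] c0 by (intro mult_mono) (auto simp: c_def)
      also have "\<dots> < e\<^sup>2" using c0 \<open>e > 0\<close> by simp
      finally show ?thesis using \<open>e > 0\<close> by (simp add: power_less_imp_less_base)
    qed
    then show ?thesis by blast
  qed
  obtain r where r: "strict_mono r" "AE x in M. Cauchy (\<lambda>i. f (r i) x)"
    using cauchy_L1_AE_cauchy_subseq[of M f] l1 square_integrable_integrable[OF fin si] by blast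
  \<comment> \<open>The value of \<open>lim\<close> is arbitrary where the subsequence diverges, which is a null set.\<close>
  define g where "g x = lim (\<lambda>i. f (r i) x)" for x
  have [measurable]: "g \<in> borel_measurable M" unfolding g_def by measurable
  have lim: "AE x in M. (\<lambda>i. f (r i) x) \<longlonglongrightarrow> g x"
    using r(2) by eventually_elim (simp add: g_def Cauchy_convergent_iff convergent_LIMSEQ_iff)
  have bound: "(\<integral>\<^sup>+x. ennreal ((f n x - g x)\<^sup>2) \<partial>M) \<le> ennreal e"
    if N: "\<forall>i\<ge>N. \<forall>j\<ge>N. (LINT x|M. (f i x - f j x)\<^sup>2) \<le> e" and "n \<ge> N" for n N e
  proof -
    have "(\<integral>\<^sup>+x. ennreal ((f n x - g x)\<^sup>2) \<partial>M) =
        (\<integral>\<^sup>+x. liminf (\<lambda>i. ennreal ((f n x - f (r i) x)\<^sup>2)) \<partial>M)"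
      using lim
    proof (intro nn_integral_cong_AE, eventually_elim)
      fix x assume "(\<lambda>i. f (r i) x) \<longlonglongrightarrow> g x"
      then have "(\<lambda>i. ennreal ((f n x - f (r i) x)\<^sup>2)) \<longlonglongrightarrow> ennreal ((f n x - g x)\<^sup>2)"
        by (intro tendsto_ennrealI tendsto_intros)
      from lim_imp_Liminf[OF _ this]
      show "ennreal ((f n x - g x)\<^sup>2) = liminf (\<lambda>i. ennreal ((f n x - f (r i) x)\<^sup>2))" by simp
    qed
    also have "\<dots> \<le> liminf (\<lambda>i. (\<integral>\<^sup>+x. ennreal ((f n x - f (r i) x)\<^sup>2) \<partial>M))"
      by (rule nn_integral_liminf) simp
    also have "\<dots> \<le> ennreal e"
    proof (rule Liminf_le)
      have "(\<integral>\<^sup>+x. ennreal ((f n x - f (r i) x)\<^sup>2) \<partial>M) \<le> ennreal e" if "i \<ge> N" for i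
      proof -
        have "(\<integral>\<^sup>+x. ennreal ((f n x - f (r i) x)\<^sup>2) \<partial>M) = ennreal (LINT x|M. (f n x - f (r i) x)\<^sup>2)"
          using square_integrable_diff[OF si si] by (intro nn_integral_eq_integral) (auto simp: square_integrable_def)
        also have "\<dots> \<le> ennreal e"
          using N \<open>n \<ge> N\<close> \<open>i \<ge> N\<close> seq_suble[OF r(1), of i] by (intro ennreal_leI) auto
        finally show ?thesis .
      qed
      then show "\<forall>\<^sub>F i in sequentially. (\<integral>\<^sup>+x. ennreal ((f n x - f (r i) x)\<^sup>2) \<partial>M) \<le> ennreal e"
        using eventually_ge_at_top[of N] by (rule eventually_mono[rotated])
    qed simp
    finally show ?thesis .
  qed
  obtain N1 where N1: "\<forall>i\<ge>N1. \<forall>j\<ge>N1. (LINT x|M. (f i x - f j x)\<^sup>2) \<le> 1" using cauchy[of 1] by auto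
  have "square_integrable M (\<lambda>x. f N1 x - g x)"
    using bound[OF N1, of N1]
    by (auto simp: square_integrable_def intro!: integrableI_bounded simp: less_top[symmetric] top_unique)
  from square_integrable_diff[OF si[of N1] this] have sg: "square_integrable M g" by simp
  have "(\<lambda>n. LINT x|M. (f n x - g x)\<^sup>2) \<longlonglongrightarrow> 0"
  proof (rule LIMSEQ_I)
    fix e :: real assume "e > 0"
    then obtain N where N: "\<forall>i\<ge>N. \<forall>j\<ge>N. (LINT x|M. (f i x - f j x)\<^sup>2) \<le> e / 2"
      using cauchy[of "e / 2"] by auto
    have "(LINT x|M. (f n x - g x)\<^sup>2) \<le> e / 2" if "n \<ge> N" for n
    proof -
      have "(\<integral>\<^sup>+x. ennreal ((f n x - g x)\<^sup>2) \<partial>M) = ennreal (LINT x|M. (f n x - g x)\<^sup>2)"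
        using square_integrable_diff[OF si sg] by (intro nn_integral_eq_integral) (auto simp: square_integrable_def)
      then show ?thesis using bound[OF N that] \<open>e > 0\<close> by (simp add: ennreal_le_iff)
    qed
    then show "\<exists>N. \<forall>n\<ge>N. norm ((LINT x|M. (f n x - g x)\<^sup>2) - 0) < e"
      using \<open>e > 0\<close> by (intro exI[of _ N]) fastforce
  qed
  then have "L2_tendsto M f g" using si sg by (auto simp: L2_tendsto_def)
  then show ?thesis by (rule that)
qed

text \<open>A minimising sequence of \<open>A \<mapsto> \<integral>A\<^sup>2 - 2 l A\<close> over the linear space \<open>V\<close> is Cauchy by the
  parallelogram identity, and the vanishing of the first variation at its limit \<open>Z\<close> is the
  representing identity.\<close>

lemma L2_Riesz:
  assumes fin: "finite_measure M"
    and V: "\<And>A. A \<in> V \<Longrightarrow> square_integrable M A" "(\<lambda>_. 0) \<in> V"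
    and lin: "\<And>A B a b. A \<in> V \<Longrightarrow> B \<in> V \<Longrightarrow> (\<lambda>x. a * A x + b * B x) \<in> V"
      "\<And>A B a b. A \<in> V \<Longrightarrow> B \<in> V \<Longrightarrow> l (\<lambda>x. a * A x + b * B x) = a * l A + b * l B"
    and bdd: "C \<ge> 0" "\<And>A. A \<in> V \<Longrightarrow> (l A)\<^sup>2 \<le> C * (LINT x|M. (A x)\<^sup>2)"
  obtains Z W where "L2_tendsto M W Z" "\<And>n. W n \<in> V" "\<And>A. A \<in> V \<Longrightarrow> l A = (LINT x|M. Z x * A x)"
proof -
  define q where "q A = (LINT x|M. (A x)\<^sup>2) - 2 * l A" for A
  \<comment> \<open>\<open>n - 2 \<surd>(C n) = (\<surd>n - \<surd>C)\<^sup>2 - C\<close>\<close>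
  have qlow: "q A \<ge> - C" if "A \<in> V" for A
  proof -
    define n where "n = (LINT x|M. (A x)\<^sup>2)"
    have n0: "n \<ge> 0" by (simp add: n_def)
    have "(l A)\<^sup>2 \<le> C * n" using bdd(2)[OF that] by (simp add: n_def)
    then have "l A \<le> sqrt C * sqrt n" by (metis real_le_rsqrt real_sqrt_mult)
    moreover have "0 \<le> (sqrt n - sqrt C)\<^sup>2" by simp
    then have "2 * (sqrt C * sqrt n) \<le> n + C"
      using n0 bdd(1) by (simp add: power2_diff mult.commute)
    ultimately show ?thesis by (simp add: q_def n_def)
  qed
  define I where "I = (INF A\<in>V. q A)"
  have bb: "bdd_below (q ` V)" using qlow by (auto simp: bdd_below_def)
  have Ile: "I \<le> q A" if "A \<in> V" for A
    unfolding I_def using bb that by (rule cINF_lower)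
  have "\<exists>A\<in>V. q A < I + 1 / (real n + 1)" for n
  proof (rule ccontr)
    assume "\<not> ?thesis"
    then have "I + 1 / (real n + 1) \<le> q A" if "A \<in> V" for A using that by force
    then have "I + 1 / (real n + 1) \<le> I"
      unfolding I_def[symmetric] using V(2) by (subst (2) I_def, intro cINF_greatest) auto
    then show False by simp
  qed
  then obtain W where W: "\<And>n. W n \<in> V" "\<And>n. q (W n) < I + 1 / (real n + 1)" by metis
  have siW: "square_integrable M (W n)" for n using V W by blast
  have para: "(LINT x|M. (W i x - W j x)\<^sup>2) \<le> 2 / (real i + 1) + 2 / (real j + 1)" for i j
  proof -
    have m: "(\<lambda>x. (1/2) * W i x + (1/2) * W j x) \<in> V" using lin W by blast
    have "q (\<lambda>x. (1/2) * W i x + (1/2) * W j x) =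
       (LINT x|M. ((1/2) * W i x + (1/2) * W j x)\<^sup>2) - l (W i) - l (W j)"
      unfolding q_def using lin(2)[OF W(1) W(1), of "1/2" i "1/2" j] by simp
    also have "(LINT x|M. ((1/2) * W i x + (1/2) * W j x)\<^sup>2) = (LINT x|M. (W i x + W j x)\<^sup>2) / 4"
    proof -
      have "(\<lambda>x. ((1/2) * W i x + (1/2) * W j x)\<^sup>2) = (\<lambda>x. (W i x + W j x)\<^sup>2 / 4)"
        by (auto simp add: power2_eq_square field_simps)
      then show ?thesis by simp
    qed
    finally have "4 * I \<le> (LINT x|M. (W i x + W j x)\<^sup>2) - 4 * l (W i) - 4 * l (W j)"
      using Ile[OF m] by simp
    moreover have "(LINT x|M. (W i x + W j x)\<^sup>2) + (LINT x|M. (W i x - W j x)\<^sup>2)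
        = 2 * (LINT x|M. (W i x)\<^sup>2) + 2 * (LINT x|M. (W j x)\<^sup>2)"
      using integral_square_add[OF siW siW, of i j] integral_square_diff[OF siW siW, of i j] by simp
    ultimately have "(LINT x|M. (W i x - W j x)\<^sup>2) \<le> 2 * q (W i) + 2 * q (W j) - 4 * I"
      by (simp add: q_def)
    then show ?thesis using W(2)[of i] W(2)[of j] by simp
  qed
  obtain Z where Z: "L2_tendsto M W Z"
  proof (rule L2_complete[OF fin siW])
    fix e :: real assume "e > 0"
    obtain N where N: "4 / e < real N" using reals_Archimedean2 by blast
    have "(LINT x|M. (W i x - W j x)\<^sup>2) \<le> e" if "i \<ge> N" "j \<ge> N" for i j
    proof -
      have "2 / (real k + 1) \<le> e / 2" if "k \<ge> N" for k
      proof -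
        have "4 / e < real k + 1" using N that by linarith
        then show ?thesis using \<open>e > 0\<close> by (simp add: field_simps)
      qed
      then show ?thesis using para[of i j] that by (smt (verit) field_sum_of_halves)
    qed
    then show "\<exists>N. \<forall>i\<ge>N. \<forall>j\<ge>N. (LINT x|M. (W i x - W j x)\<^sup>2) \<le> e" by blast
  qed
  have "l A = (LINT x|M. Z x * A x)" if A: "A \<in> V" for A
  proof -
    define a b where "a = (LINT x|M. (A x)\<^sup>2)" and "b = (LINT x|M. Z x * A x) - l A"
    have ge: "t\<^sup>2 * a + 2 * t * b \<ge> 0" for t
    proof -
      have "t\<^sup>2 * a + 2 * t * ((LINT x|M. W n x * A x) - l A) \<ge> - 1 / (real n + 1)" for n
      proof -
        have v: "(\<lambda>x. 1 * W n x + t * A x) \<in> V" using lin W A by blast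
        have "q (\<lambda>x. 1 * W n x + t * A x) = q (W n) + t\<^sup>2 * a + 2 * t * ((LINT x|M. W n x * A x) - l A)"
          using lin(2)[OF W(1) A, of 1 n t] integral_square_add[OF siW square_integrable_cmult[OF V(1)[OF A]], of n t]
          by (simp add: q_def a_def integral_square_cmult mult.left_commute algebra_simps)
        then show ?thesis using Ile[OF v] W(2)[of n] by simp
      qed
      moreover have "(\<lambda>n. t\<^sup>2 * a + 2 * t * ((LINT x|M. W n x * A x) - l A)) \<longlonglongrightarrow> t\<^sup>2 * a + 2 * t * b"
        unfolding b_def by (intro tendsto_intros L2_tendsto_inner[OF Z] V A)
      moreover have "(\<lambda>n. - 1 / (real n + 1)) \<longlonglongrightarrow> 0"
        using tendsto_minus[OF inverse_Suc_tendsto_zero] by simp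
      ultimately show ?thesis
        by (intro LIMSEQ_le[of "\<lambda>n. - 1 / (real n + 1)" 0]) auto
    qed
    have "b = 0"
    proof (rule ccontr)
      assume b: "b \<noteq> 0"
      have a0: "a \<ge> 0" by (simp add: a_def)
      \<comment> \<open>\<open>t = - b / (a + 1)\<close> avoids a case distinction on \<open>a = 0\<close>.\<close>
      define d where "d = a + 1"
      have d: "d > 0" "a / d < 1" using a0 by (auto simp: d_def field_simps)
      have "0 \<le> (- b / d)\<^sup>2 * a + 2 * (- b / d) * b" by (rule ge)
      also have "\<dots> = (a / d - 2) * (b\<^sup>2 / d)"
        using d(1) by (simp add: field_simps power2_eq_square)
      also have "\<dots> < 0"
      proof (rule mult_neg_pos)
        show "a / d - 2 < 0" using d(2) by linarith
      qed (use b d(1) in auto)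
      finally show False by simp
    qed
    then show ?thesis by (simp add: b_def)
  qed
  then show ?thesis using that Z W(1) by blast
qed

section \<open>Characteristic functions and Gaussian pairs\<close>

text \<open>The total mass is the characteristic function at \<open>0\<close>; after normalisation this is Levy's
  uniqueness theorem.\<close>

lemma finite_borel_measure_eqI_char:
  fixes M N :: "real measure"
  assumes M: "finite_measure M" "sets M = sets borel" and N: "finite_measure N" "sets N = sets borel"
    and char: "char M = char N"
  shows "M = N"
proof -
  interpret M: finite_measure M by fact
  interpret N: finite_measure N by fact
  note [measurable_cong] = M(2) N(2)
  have sp: "space M = UNIV" "space N = UNIV"
    using sets_eq_imp_space_eq[OF M(2)] sets_eq_imp_space_eq[OF N(2)] by auto
  define m where "m = measure M UNIV"
  have "char M 0 = m" "char N 0 = measure N UNIV" by (simp_all add: char_def sp m_def scaleR_conv_of_real)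
  then have m: "measure N UNIV = m" using char by simp
  show ?thesis
  proof (cases "m = 0")
    case True
    have "emeasure M A = 0" "emeasure N A = 0" for A
    proof -
      have "emeasure M A \<le> emeasure M (space M)" by (rule emeasure_space)
      then show "emeasure M A = 0" using True unfolding sp M.emeasure_eq_measure m_def[symmetric] by simp
      have "emeasure N A \<le> emeasure N (space N)" by (rule emeasure_space)
      then show "emeasure N A = 0" using True unfolding sp N.emeasure_eq_measure m by simp
    qed
    then show ?thesis using M N by (intro measure_eqI) auto
  next
    case False
    then have m0: "m > 0" by (simp add: m_def order_less_le)
    have scaled: "real_distribution (density P (\<lambda>_. ennreal (1 / m)))"
        "char (density P (\<lambda>_. ennreal (1 / m))) = (\<lambda>t. char P t / m)"
        "A \<in> sets borel \<Longrightarrow> measure (density P (\<lambda>_. ennreal (1 / m))) A = measure P A / m"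
      if P: "finite_measure P" "sets P = sets borel" "measure P UNIV = m" for P A
    proof -
      interpret P: finite_measure P by fact
      note [measurable_cong] = P(2)
      have spP: "space P = UNIV" using sets_eq_imp_space_eq[OF P(2)] by simp
      show ms: "A \<in> sets borel \<Longrightarrow> measure (density P (\<lambda>_. ennreal (1 / m))) A = measure P A / m" for A
        using m0 P(2) by (simp add: measure_density_const)
      have "prob_space (density P (\<lambda>_. ennreal (1 / m)))"
      proof
        show "emeasure (density P (\<lambda>_. ennreal (1 / m))) (space (density P (\<lambda>_. ennreal (1 / m)))) = 1"
          using P(3) m0 by (simp add: emeasure_density_const P.emeasure_eq_measure spP
              ennreal_mult'[symmetric])
      qed
      then show "real_distribution (density P (\<lambda>_. ennreal (1 / m)))"
        by (auto simp: real_distribution_def real_distribution_axioms_def P(2))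
      show "char (density P (\<lambda>_. ennreal (1 / m))) = (\<lambda>t. char P t / m)"
      proof
        fix t
        show "char (density P (\<lambda>_. ennreal (1 / m))) t = char P t / m"
          unfolding char_def using m0
          by (subst integral_density) (auto simp: scaleR_conv_of_real)
      qed
    qed
    have "density M (\<lambda>_. ennreal (1 / m)) = density N (\<lambda>_. ennreal (1 / m))"
      using scaled(1,2) M N m char by (intro Levy_uniqueness) (auto simp: m_def)
    then have "measure M A / m = measure N A / m" if "A \<in> sets borel" for A
      using scaled(3)[OF M m_def[symmetric] that] scaled(3)[OF N m that] by auto
    then show ?thesis
      using M N m0 by (intro measure_eqI) (auto simp: M.emeasure_eq_measure N.emeasure_eq_measure)
  qed
qed

lemma finite_measure_distr_density:
  assumes "finite_measure M" and [measurable]: "k \<in> borel_measurable M" "Z \<in> borel_measurable M"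
    and "\<And>x. k x \<le> 2"
  shows "finite_measure (distr (density M (\<lambda>x. ennreal (k x))) borel Z)"
proof (rule finite_measure.finite_measure_distr)
  interpret finite_measure M by fact
  show "finite_measure (density M (\<lambda>x. ennreal (k x)))"
  proof
    have "(\<integral>\<^sup>+x. ennreal (k x) \<partial>M) \<le> (\<integral>\<^sup>+x. 2 \<partial>M)"
      using assms(4) by (intro nn_integral_mono) (metis ennreal_leI ennreal_numeral zero_le_numeral)
    also have "\<dots> < \<infinity>" by (simp add: ennreal_mult_less_top emeasure_eq_measure)
    finally show "emeasure (density M (\<lambda>x. ennreal (k x))) (space (density M (\<lambda>x. ennreal (k x)))) \<noteq> \<infinity>"
      by (auto simp: emeasure_density cong: nn_integral_cong)
  qed
qed simp

lemma integral_affine_weight: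
  fixes V h :: "'a \<Rightarrow> complex"
  assumes h: "integrable M h" and V: "V \<in> borel_measurable M" and bdd: "\<And>x. cmod (V x) \<le> 1"
  shows "(CLINT x|M. (1 + a * V x + b * cnj (V x)) * h x)
    = (CLINT x|M. h x) + a * (CLINT x|M. V x * h x) + b * (CLINT x|M. cnj (V x) * h x)"
proof -
  have cV: "(\<lambda>x. cnj (V x)) \<in> borel_measurable M"
    by (rule measurable_compose[OF V borel_measurable_continuous_onI]) (intro continuous_intros)
  have "integrable M (\<lambda>x. K x * h x)" if "K \<in> borel_measurable M" "\<And>x. cmod (K x) \<le> 1" for K
    using that h by (intro Bochner_Integration.integrable_bound[OF h])
      (auto simp: norm_mult intro!: mult_left_le_one_le)
  from this[OF V bdd] this[OF cV] bdd h show ?thesis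
    by (simp add: distrib_right mult.assoc)
qed

lemma integral_cnj_mult_iexp:
  "(CLINT x|M. cnj (V x) * iexp (u * X x)) = cnj (CLINT x|M. V x * iexp (- u * X x))"
proof -
  have "(CLINT x|M. cnj (V x) * iexp (u * X x)) = (CLINT x|M. cnj (V x * iexp (- u * X x)))"
    by (simp add: exp_cnj)
  then show ?thesis by (simp only: Bochner_Integration.integral_cnj)
qed

text \<open>Uniqueness of characteristic functions for complex measures of the form \<open>V dM\<close>, transported
  by a real random variable. A complex weight \<open>V\<close> of modulus at most one is a combination of the
  nonnegative weights \<open>1\<close>, \<open>1 + Re V\<close> and \<open>1 + Im V\<close>, to which uniqueness for positive measures
  applies. Taking \<open>V = iexp (\<Sum>i<n. c i * X i)\<close> adds one more coordinate to a joint
  characteristic function, and taking \<open>W\<close> constant expresses independence.\<close>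

lemma weighted_char_unique:
  fixes X :: "'a \<Rightarrow> real" and Y :: "'b \<Rightarrow> real" and V :: "'a \<Rightarrow> complex" and W :: "'b \<Rightarrow> complex"
  assumes fin: "finite_measure M" "finite_measure N"
    and X [measurable]: "X \<in> borel_measurable M" and Y [measurable]: "Y \<in> borel_measurable N"
    and V [measurable]: "V \<in> borel_measurable M" and W [measurable]: "W \<in> borel_measurable N"
    and bdd: "\<And>x. cmod (V x) \<le> 1" "\<And>y. cmod (W y) \<le> 1"
    and eq1: "\<And>u. (CLINT x|M. iexp (u * X x)) = (CLINT y|N. iexp (u * Y y))"
    and eqW: "\<And>u. (CLINT x|M. V x * iexp (u * X x)) = (CLINT y|N. W y * iexp (u * Y y))"
    and g [measurable]: "g \<in> borel_measurable borel"
    and ig: "integrable M (\<lambda>x. g (X x) :: complex)" "integrable N (\<lambda>y. g (Y y))"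
  shows "(CLINT x|M. V x * g (X x)) = (CLINT y|N. W y * g (Y y))"
proof -
  have key: "(CLINT x|M. complex_of_real (v x) * h (X x)) = (CLINT y|N. complex_of_real (w y) * h (Y y))"
    if [measurable]: "v \<in> borel_measurable M" "w \<in> borel_measurable N" "h \<in> borel_measurable borel"
      and b: "\<And>x. 0 \<le> v x \<and> v x \<le> 2" "\<And>y. 0 \<le> w y \<and> w y \<le> 2"
      and e: "\<And>u. (CLINT x|M. complex_of_real (v x) * iexp (u * X x)) = (CLINT y|N. complex_of_real (w y) * iexp (u * Y y))"
    for v w and h :: "real \<Rightarrow> complex"
  proof -
    have "distr (density M (\<lambda>x. ennreal (v x))) borel X = distr (density N (\<lambda>y. ennreal (w y))) borel Y"
    proof (rule finite_borel_measure_eqI_char)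
      show "char (distr (density M (\<lambda>x. ennreal (v x))) borel X)
          = char (distr (density N (\<lambda>y. ennreal (w y))) borel Y)"
        using e b by (intro ext)
          (simp add: char_def integral_distr integral_density scaleR_conv_of_real)
    qed (use fin b in \<open>auto intro!: finite_measure_distr_density\<close>)
    then have "(CLINT t|distr (density M (\<lambda>x. ennreal (v x))) borel X. h t)
        = (CLINT t|distr (density N (\<lambda>y. ennreal (w y))) borel Y. h t)" by simp
    then show ?thesis
      using b by (simp add: integral_distr integral_density scaleR_conv_of_real)
  qed
  interpret M: finite_measure M by fact
  interpret N: finite_measure N by fact
  have ieM: "integrable M (\<lambda>x. iexp (u * X x))" for u
    by (intro M.integrable_const_bound[of _ 1]) auto
  have ieN: "integrable N (\<lambda>x. iexp (u * Y x))" for u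
    by (intro N.integrable_const_bound[of _ 1]) auto
  have eqC: "(CLINT x|M. cnj (V x) * iexp (u * X x)) = (CLINT y|N. cnj (W y) * iexp (u * Y y))" for u
    by (simp only: integral_cnj_mult_iexp eqW)
  have ReV: "complex_of_real (1 + Re z) = 1 + (1/2) * z + (1/2) * cnj z" for z
    by (simp add: complex_eq_iff)
  have ImV: "complex_of_real (1 + Im z) = 1 + (- \<i> / 2) * z + (\<i> / 2) * cnj z" for z
    by (simp add: complex_eq_iff)
  have ineq: "0 \<le> 1 + Re z \<and> 1 + Re z \<le> 2" "0 \<le> 1 + Im z \<and> 1 + Im z \<le> 2" if "cmod z \<le> 1" for z
    using abs_Re_le_cmod[of z] abs_Im_le_cmod[of z] that by linarith+
  have R: "(CLINT x|M. complex_of_real (1 + Re (V x)) * g (X x)) = (CLINT y|N. complex_of_real (1 + Re (W y)) * g (Y y))"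
  proof (rule key)
    fix u
    show "(CLINT x|M. complex_of_real (1 + Re (V x)) * iexp (u * X x)) = (CLINT y|N. complex_of_real (1 + Re (W y)) * iexp (u * Y y))"
      unfolding ReV integral_affine_weight[OF ieM V bdd(1)] integral_affine_weight[OF ieN W bdd(2)]
      by (simp only: eq1 eqW eqC)
  qed (use ineq bdd in auto)
  have I: "(CLINT x|M. complex_of_real (1 + Im (V x)) * g (X x)) = (CLINT y|N. complex_of_real (1 + Im (W y)) * g (Y y))"
  proof (rule key)
    fix u
    show "(CLINT x|M. complex_of_real (1 + Im (V x)) * iexp (u * X x)) = (CLINT y|N. complex_of_real (1 + Im (W y)) * iexp (u * Y y))"
      unfolding ImV integral_affine_weight[OF ieM V bdd(1)] integral_affine_weight[OF ieN W bdd(2)]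
      by (simp only: eq1 eqW eqC)
  qed (use ineq bdd in auto)
  have O: "(CLINT x|M. g (X x)) = (CLINT y|N. g (Y y))"
  proof -
    have "(CLINT x|M. complex_of_real 1 * g (X x)) = (CLINT y|N. complex_of_real 1 * g (Y y))"
      by (rule key) (auto simp only: eq1 of_real_1 mult_1 borel_measurable_const g)
    then show ?thesis by simp
  qed
  let ?a = "(CLINT x|M. V x * g (X x))" let ?a' = "(CLINT x|M. cnj (V x) * g (X x))"
  let ?b = "(CLINT x|N. W x * g (Y x))" let ?b' = "(CLINT x|N. cnj (W x) * g (Y x))"
  have half: "a + a' = b + b'" if "x + 1 / 2 * a + 1 / 2 * a' = x + 1 / 2 * b + 1 / 2 * b'"
    for x a a' b b' :: complex
    using arg_cong[OF that, of "\<lambda>z. 2 * z - 2 * x"] by (simp add: algebra_simps)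
  have 1: "?a + ?a' = ?b + ?b'"
    using R unfolding ReV integral_affine_weight[OF ig(1) V bdd(1)] integral_affine_weight[OF ig(2) W bdd(2)] O
    by (rule half)
  have half': "a - a' = b - b'" if "x + - \<i> / 2 * a + \<i> / 2 * a' = x + - \<i> / 2 * b + \<i> / 2 * b'"
    for x a a' b b' :: complex
    using arg_cong[OF that, of "\<lambda>z. 2 * (\<i> * z) - 2 * (\<i> * x)"]
    by (simp add: distrib_left right_diff_distrib mult.assoc[symmetric])
  have 2: "?a - ?a' = ?b - ?b'"
    using I unfolding ImV integral_affine_weight[OF ig(1) V bdd(1)] integral_affine_weight[OF ig(2) W bdd(2)] O
    by (rule half')
  have "?a = ((?a + ?a') + (?a - ?a')) / 2" by simp
  also have "\<dots> = ?b" unfolding 1 2 by simp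
  finally show ?thesis .
qed


text \<open>Uniqueness of multivariate characteristic functions, on boxes. The induction restricts both
  measures to an event that concerns the last coordinate; the restricted measures still have the
  same characteristic functions in the remaining coordinates.\<close>

lemma char_unique_boxes:
  fixes X :: "nat \<Rightarrow> 'a \<Rightarrow> real" and Y :: "nat \<Rightarrow> 'b \<Rightarrow> real"
  assumes "finite_measure M" "finite_measure N"
    and "\<And>i. i < n \<Longrightarrow> X i \<in> borel_measurable M" "\<And>i. i < n \<Longrightarrow> Y i \<in> borel_measurable N"
    and "\<And>c. (CLINT x|M. iexp (\<Sum>i<n. c i * X i x)) = (CLINT y|N. iexp (\<Sum>i<n. c i * Y i y))"
    and "\<And>i. i < n \<Longrightarrow> A i \<in> sets borel"
  shows "measure M {x \<in> space M. \<forall>i<n. X i x \<in> A i} = measure N {y \<in> space N. \<forall>i<n. Y i y \<in> A i}"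
  using assms
proof (induction n arbitrary: M N)
  case 0
  have "(CLINT x|M. 1) = (CLINT y|N. 1)" using "0.prems"(5)[of "\<lambda>_. 0"] by simp
  then show ?case by (simp add: scaleR_conv_of_real)
next
  case (Suc n)
  have Xm [measurable]: "X i \<in> borel_measurable M" if "i \<le> n" for i using Suc.prems(3)[of i] that by simp
  have Ym [measurable]: "Y i \<in> borel_measurable N" if "i \<le> n" for i using Suc.prems(4)[of i] that by simp
  have Am [measurable]: "A i \<in> sets borel" if "i \<le> n" for i using Suc.prems(6)[of i] that by simp
  interpret M: finite_measure M by fact
  interpret N: finite_measure N by fact
  define E where "E = {x \<in> space M. X n x \<in> A n}"
  define F where "F = {y \<in> space N. Y n y \<in> A n}"
  have [measurable]: "E \<in> sets M" "F \<in> sets N" using Am[of n] Xm[of n] Ym[of n] by (auto simp: E_def F_def)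
  let ?M = "restrict_space M E" let ?N = "restrict_space N F"
  have "measure ?M {x \<in> space ?M. \<forall>i<n. X i x \<in> A i} = measure ?N {y \<in> space ?N. \<forall>i<n. Y i y \<in> A i}"
  proof (rule Suc.IH)
    show "finite_measure ?M" "finite_measure ?N"
      using \<open>E \<in> sets M\<close> \<open>F \<in> sets N\<close>
      by (auto intro!: finite_measure_restrict_space Suc.prems)
    fix c :: "nat \<Rightarrow> real"
    have "(CLINT x|M. iexp (\<Sum>i<n. c i * X i x) * complex_of_real (indicator (A n) (X n x)))
        = (CLINT y|N. iexp (\<Sum>i<n. c i * Y i y) * complex_of_real (indicator (A n) (Y n y)))"
    proof (rule weighted_char_unique[where X = "X n" and Y = "Y n"
          and V = "\<lambda>x. iexp (\<Sum>i<n. c i * X i x)" and W = "\<lambda>x. iexp (\<Sum>i<n. c i * Y i x)"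
          and g = "\<lambda>z. complex_of_real (indicator (A n) z)"])
      fix u :: real
      show "(CLINT x|M. iexp (u * X n x)) = (CLINT y|N. iexp (u * Y n y))"
        using Suc.prems(5)[of "\<lambda>i. if i < n then 0 else u"] by (simp cong: if_cong)
      show "(CLINT x|M. iexp (\<Sum>i<n. c i * X i x) * iexp (u * X n x)) =
            (CLINT y|N. iexp (\<Sum>i<n. c i * Y i y) * iexp (u * Y n y))"
        using Suc.prems(5)[of "\<lambda>i. if i < n then c i else u"]
        by (simp cong: if_cong add: exp_add[symmetric] distrib_left)
    next
      show "(\<lambda>x. iexp (\<Sum>i<n. c i * X i x)) \<in> borel_measurable M"
        "(\<lambda>x. iexp (\<Sum>i<n. c i * Y i x)) \<in> borel_measurable N"
        by (auto intro!: borel_measurable_sum borel_measurable_times measurable_compose[OF _ borel_measurable_exp]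
            borel_measurable_of_real simp del: of_real_sum)
      show "integrable M (\<lambda>x. complex_of_real (indicator (A n) (X n x)))"
        by (intro M.integrable_const_bound[of _ 1]) (auto simp: indicator_def)
      show "integrable N (\<lambda>x. complex_of_real (indicator (A n) (Y n x)))"
        by (intro N.integrable_const_bound[of _ 1]) (auto simp: indicator_def)
    qed (use Suc.prems Am in \<open>auto simp del: of_real_sum\<close>)
    moreover have "(CLINT x|?M. iexp (\<Sum>i<n. c i * X i x)) =
       (CLINT x|M. iexp (\<Sum>i<n. c i * X i x) * complex_of_real (indicator (A n) (X n x)))"
      using \<open>E \<in> sets M\<close>
      by (subst integral_restrict_space)
        (auto intro!: Bochner_Integration.integral_cong simp: E_def indicator_def)
    moreover have "(CLINT x|?N. iexp (\<Sum>i<n. c i * Y i x)) =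
       (CLINT x|N. iexp (\<Sum>i<n. c i * Y i x) * complex_of_real (indicator (A n) (Y n x)))"
      using \<open>F \<in> sets N\<close>
      by (subst integral_restrict_space)
        (auto intro!: Bochner_Integration.integral_cong simp: F_def indicator_def)
    ultimately show "(CLINT x|?M. iexp (\<Sum>i<n. c i * X i x)) = (CLINT y|?N. iexp (\<Sum>i<n. c i * Y i y))"
      by simp
  qed (auto intro!: measurable_restrict_space1)
  moreover have "measure ?M {x \<in> space ?M. \<forall>i<n. X i x \<in> A i} = measure M {x \<in> space M. \<forall>i<Suc n. X i x \<in> A i}"
    using \<open>E \<in> sets M\<close> by (subst measure_restrict_space)
      (auto simp: space_restrict_space E_def less_Suc_eq intro!: arg_cong[of _ _ "measure M"])
  moreover have "measure ?N {x \<in> space ?N. \<forall>i<n. Y i x \<in> A i} = measure N {x \<in> space N. \<forall>i<Suc n. Y i x \<in> A i}"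
    using \<open>F \<in> sets N\<close> by (subst measure_restrict_space)
      (auto simp: space_restrict_space F_def less_Suc_eq intro!: arg_cong[of _ _ "measure N"])
  ultimately show ?case by simp
qed

text \<open>Completing the square turns the factor \<open>exp (s x)\<close> into a translation of the density by \<open>s\<close>.\<close>

lemma std_normal_exp_iexp:
  shows "integrable std_normal_distribution (\<lambda>x. exp (s * x))"
    and "(CLINT x|std_normal_distribution. exp (of_real (s * x)) * iexp (a * x))
       = exp (of_real (s\<^sup>2 / 2 - a\<^sup>2 / 2) + \<i> * of_real (s * a))"
proof -
  have shift: "std_normal_density (s + x) * exp (s * (s + x)) = exp (s\<^sup>2 / 2) * std_normal_density x" for x
    by (simp add: std_normal_density_def exp_add[symmetric] mult_exp_exp power2_eq_square field_simps)
  have sh2: "std_normal_density x * exp (s * x) = exp (s\<^sup>2 / 2) * std_normal_density (- s + x)" for x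
    using shift[of "- s + x"] by simp
  have i1: "integrable lborel std_normal_density"
    using integrable_normal_density[of 1 0] by simp
  have "integrable lborel (\<lambda>x. std_normal_density (- s + 1 * x))"
    by (rule lborel_integrable_real_affine[OF i1]) simp
  then have "integrable lborel (\<lambda>x. std_normal_density x * exp (s * x))"
    unfolding sh2 by simp
  then show "integrable std_normal_distribution (\<lambda>x. exp (s * x))"
    by (simp add: integrable_density)
  have "(CLINT x|std_normal_distribution. exp (of_real (s * x)) * iexp (a * x))
     = (CLINT x|lborel. of_real (std_normal_density x) * (exp (of_real (s * x)) * iexp (a * x)))"
    by (subst integral_density) (auto simp: scaleR_conv_of_real)
  also have "\<dots> = (CLINT x|lborel. of_real (std_normal_density x * exp (s * x)) * iexp (a * x))"
    by (simp add: exp_of_real[symmetric] mult.assoc)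
  also have "\<dots> = (CLINT x|lborel. of_real (std_normal_density (s + 1 * x) * exp (s * (s + 1 * x))) * iexp (a * (s + 1 * x)))"
    by (subst lborel_integral_real_affine[where c = 1 and t = s]) auto
  also have "\<dots> = (CLINT x|lborel. (exp (of_real (s\<^sup>2 / 2)) * iexp (a * s)) * (of_real (std_normal_density x) * iexp (a * x)))"
    unfolding mult_1 shift
    by (intro Bochner_Integration.integral_cong)
      (simp_all add: exp_of_real[symmetric] exp_add distrib_left mult_ac)
  also have "\<dots> = exp (of_real (s\<^sup>2 / 2)) * iexp (a * s) * char std_normal_distribution a"
    unfolding char_def by (subst integral_density) (auto simp: scaleR_conv_of_real)
  also have "\<dots> = exp (of_real (s\<^sup>2 / 2 - a\<^sup>2 / 2) + \<i> * of_real (s * a))"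
    by (simp add: char_std_normal_distribution exp_of_real[symmetric] exp_add[symmetric] mult_exp_exp algebra_simps)
  finally show "(CLINT x|std_normal_distribution. exp (of_real (s * x)) * iexp (a * x))
       = exp (of_real (s\<^sup>2 / 2 - a\<^sup>2 / 2) + \<i> * of_real (s * a))" .
qed


text \<open>The formula is the joint characteristic function of \<open>(A, Z)\<close> at the complex point \<open>(1, -\<i>)\<close>.
  Instead of continuing it analytically, \<open>A\<close> is split into \<open>k Z\<close> and an uncorrelated part
  \<open>A - k Z\<close>. This part is independent of \<open>Z\<close>, and the expectation becomes the product of a
  characteristic function and a one-dimensional exponential moment.\<close>

lemma jointly_Gaussian_exp:
  assumes "prob_space M" and A: "square_integrable M A" and Z: "square_integrable M Z"
    and cf: "\<And>a b. (CLINT x|M. iexp (a * A x + b * Z x)) = exp (of_real (- (LINT x|M. (a * A x + b * Z x)\<^sup>2) / 2))"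
  shows "integrable M (\<lambda>x. exp (Z x))"
    and "(CLINT x|M. iexp (A x) * exp (of_real (Z x)))
      = exp (of_real (((LINT x|M. (Z x)\<^sup>2) - (LINT x|M. (A x)\<^sup>2)) / 2) + \<i> * of_real (LINT x|M. A x * Z x))"
proof -
  interpret prob_space M by fact
  note [measurable] = square_integrable_measurable[OF A] square_integrable_measurable[OF Z]
  define v where "v = (LINT x|M. (Z x)\<^sup>2)"
  define r where "r = (LINT x|M. A x * Z x)"
  define w where "w = (LINT x|M. (A x)\<^sup>2)"
  have quad: "(LINT x|M. (a * A x + b * Z x)\<^sup>2) = a\<^sup>2 * w + 2 * (a * b) * r + b\<^sup>2 * v" for a b
    using integral_square_add[OF square_integrable_cmult[OF A] square_integrable_cmult[OF Z], of a b]
    unfolding integral_square_cmult by (simp add: v_def w_def r_def mult_ac)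
  have cf': "(CLINT x|M. iexp (a * A x + b * Z x)) = exp (of_real (- (a\<^sup>2 * w + 2 * (a * b) * r + b\<^sup>2 * v) / 2))" for a b
    using cf[of a b] unfolding quad by simp
  have v0: "v \<ge> 0" by (simp add: v_def)
  have "integrable M (\<lambda>x. exp (Z x)) \<and> (CLINT x|M. iexp (A x) * exp (of_real (Z x)))
      = exp (of_real ((v - w) / 2) + \<i> * of_real r)"
  proof (cases "v = 0")
    case True
    have "AE x in M. (Z x)\<^sup>2 = 0"
      using True integral_nonneg_eq_0_iff_AE[of M "\<lambda>x. (Z x)\<^sup>2"] Z by (simp add: v_def square_integrable_def)
    then have Z0: "AE x in M. Z x = 0" by simp
    have "r\<^sup>2 \<le> w * v" unfolding r_def w_def v_def by (rule integral_Cauchy_Schwarz[OF A Z])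
    then have "r = 0" using True by simp
    have "integrable M (\<lambda>x. exp (Z x)) \<longleftrightarrow> integrable M (\<lambda>x. 1 :: real)"
      using Z0 by (intro integrable_cong_AE) auto
    moreover have "(CLINT x|M. iexp (A x) * exp (of_real (Z x))) = (CLINT x|M. iexp (1 * A x + 0 * Z x))"
      using Z0 by (intro integral_cong_AE) auto
    ultimately show ?thesis using True \<open>r = 0\<close> cf'[of 1 0] by simp
  next
    case False
    define s where "s = sqrt v"
    have s: "s > 0" "s\<^sup>2 = v" using False v0 by (auto simp: s_def)
    define k where "k = r / v"
    have distr: "distr M borel (\<lambda>x. Z x / s) = std_normal_distribution"
    proof (rule Levy_uniqueness)
      show "real_distribution (distr M borel (\<lambda>x. Z x / s))" by simp
      show "char (distr M borel (\<lambda>x. Z x / s)) = char std_normal_distribution"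
      proof
        fix t
        have "char (distr M borel (\<lambda>x. Z x / s)) t = (CLINT x|M. iexp (0 * A x + (t / s) * Z x))"
          by (simp add: char_def integral_distr)
        also have "\<dots> = exp (of_real (- (t / s)\<^sup>2 * v / 2))" by (subst cf') simp
        also have "(t / s)\<^sup>2 * v = t\<^sup>2" using s False by (simp add: power_divide)
        then have "- (t / s)\<^sup>2 * v / 2 = - t\<^sup>2 / 2" by simp
        finally show "char (distr M borel (\<lambda>x. Z x / s)) t = char std_normal_distribution t"
          by (simp add: char_std_normal_distribution exp_of_real[symmetric])
      qed
    qed (rule real_dist_normal_dist)
    have int: "integrable M (\<lambda>x. exp (Z x))"
      using std_normal_exp_iexp(1)[of s] s unfolding distr[symmetric] by (simp add: integrable_distr_eq)
    have val: "(CLINT x|M. exp (of_real (Z x)) * iexp (k * Z x)) = exp (of_real (v / 2 - k\<^sup>2 * v / 2) + \<i> * of_real r)"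
    proof -
      have "(CLINT x|M. exp (of_real (Z x)) * iexp (k * Z x)) =
         (CLINT x|std_normal_distribution. exp (of_real (s * x)) * iexp ((k * s) * x))"
        unfolding distr[symmetric] using s by (simp add: integral_distr)
      also have "\<dots> = exp (of_real (s\<^sup>2 / 2 - (k * s)\<^sup>2 / 2) + \<i> * of_real (s * (k * s)))"
        by (rule std_normal_exp_iexp(2))
      also have "s * (k * s) = r" using False s by (simp add: k_def power2_eq_square[symmetric] mult_ac)
      finally show ?thesis by (simp add: power_mult_distrib s)
    qed
    have cfA: "(CLINT x|M. iexp (A x - k * Z x)) = exp (of_real (- (w - k\<^sup>2 * v) / 2))"
    proof -
      have "(CLINT x|M. iexp (A x - k * Z x)) = (CLINT x|M. iexp (1 * A x + (- k) * Z x))" by simp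
      also have "\<dots> = exp (of_real (- (w - 2 * k * r + k\<^sup>2 * v) / 2))" by (subst cf') simp
      also have "w - 2 * k * r + k\<^sup>2 * v = w - k\<^sup>2 * v"
        using False by (simp add: k_def power2_eq_square)
      finally show ?thesis .
    qed
    have "(CLINT x|M. iexp (A x - k * Z x) * (exp (of_real (Z x)) * iexp (k * Z x))) =
      (CLINT x|M. (CLINT y|M. iexp (A y - k * Z y)) * (exp (of_real (Z x)) * iexp (k * Z x)))"
    proof (rule weighted_char_unique[where X = Z and Y = Z and V = "\<lambda>x. iexp (A x - k * Z x)"
          and W = "\<lambda>_. (CLINT y|M. iexp (A y - k * Z y))" and g = "\<lambda>z. exp (of_real z) * iexp (k * z)"])
      have "integrable M (\<lambda>x. exp (of_real (Z x)) * iexp (k * Z x))"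
        using int by (rule Bochner_Integration.integrable_bound) (auto simp: norm_mult)
      then show "integrable M (\<lambda>x. exp (of_real (Z x)) * iexp (k * Z x))"
        "integrable M (\<lambda>x. exp (of_real (Z x)) * iexp (k * Z x))" by auto
      show "cmod (CLINT y|M. iexp (A y - k * Z y)) \<le> 1"
        unfolding cfA norm_exp_eq_Re
      proof -
        have "r\<^sup>2 \<le> w * v" unfolding r_def w_def v_def by (rule integral_Cauchy_Schwarz[OF A Z])
        then have "k\<^sup>2 * v \<le> w" using False v0 by (simp add: k_def power2_eq_square field_simps)
        then show "exp (Re (complex_of_real (- (w - k\<^sup>2 * v) / 2))) \<le> 1" by simp
      qed
      fix u
      have "(CLINT x|M. iexp (A x - k * Z x) * iexp (u * Z x)) = (CLINT x|M. iexp (1 * A x + (u - k) * Z x))"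
        by (simp add: exp_add[symmetric] algebra_simps)
      also have "\<dots> = exp (of_real (- (w + 2 * (u - k) * r + (u - k)\<^sup>2 * v) / 2))" by (subst cf') simp
      also have "w + 2 * (u - k) * r + (u - k)\<^sup>2 * v = (w - k\<^sup>2 * v) + u\<^sup>2 * v"
        using False by (simp add: k_def power2_eq_square field_simps)
      finally have 1: "(CLINT x|M. iexp (A x - k * Z x) * iexp (u * Z x))
          = exp (of_real (- (w - k\<^sup>2 * v) / 2)) * exp (of_real (- (u\<^sup>2 * v) / 2))"
        by (simp add: exp_add[symmetric] diff_divide_distrib add_divide_distrib)
      have "(CLINT x|M. iexp (u * Z x)) = (CLINT x|M. iexp (0 * A x + u * Z x))" by simp
      also have "\<dots> = exp (of_real (- (u\<^sup>2 * v) / 2))" by (subst cf') simp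
      finally show "(CLINT x|M. iexp (A x - k * Z x) * iexp (u * Z x)) =
          (CLINT x|M. (CLINT y|M. iexp (A y - k * Z y)) * iexp (u * Z x))"
        unfolding 1 cfA by simp
    qed (auto intro: finite_measure_axioms)
    also have "\<dots> = exp (of_real (- (w - k\<^sup>2 * v) / 2)) * exp (of_real (v / 2 - k\<^sup>2 * v / 2) + \<i> * of_real r)"
      unfolding cfA using val by simp
    also have "\<dots> = exp (of_real ((v - w) / 2) + \<i> * of_real r)"
      by (simp add: exp_add[symmetric] diff_divide_distrib algebra_simps)
    finally have fin: "(CLINT x|M. iexp (A x - k * Z x) * (exp (of_real (Z x)) * iexp (k * Z x)))
      = exp (of_real ((v - w) / 2) + \<i> * of_real r)" .
    have "iexp (A x - k * Z x) * (exp (of_real (Z x)) * iexp (k * Z x)) = iexp (A x) * exp (of_real (Z x))" for x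
      by (simp add: exp_add[symmetric] algebra_simps)
    with fin have "(CLINT x|M. iexp (A x) * exp (of_real (Z x))) = exp (of_real ((v - w) / 2) + \<i> * of_real r)"
      by (simp only:)
    with int show ?thesis by (rule conjI)
  qed
  then show "integrable M (\<lambda>x. exp (Z x))" "(CLINT x|M. iexp (A x) * exp (of_real (Z x)))
      = exp (of_real (((LINT x|M. (Z x)\<^sup>2) - (LINT x|M. (A x)\<^sup>2)) / 2) + \<i> * of_real (LINT x|M. A x * Z x))"
    by (simp_all add: v_def w_def r_def)
qed

section \<open>The Borel sets of C[a,b]\<close>

lemma mspace_C_space:
  "mspace (C_space a b) = {x \<in> extensional {a..b}. continuous_on {a..b} x}"
proof -
  have "Metric_space.mbounded UNIV dist (x ` {a..b})" if "continuous_on {a..b} x" for x :: "real \<Rightarrow> real"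
    using compact_imp_bounded[OF compact_continuous_image[OF that compact_Icc]] by simp
  then show ?thesis by (auto simp: C_space_def)
qed

lemma C_spaceD:
  assumes "x \<in> mspace (C_space a b)"
  shows "continuous_on {a..b} x" "x \<in> extensional {a..b}"
  using assms by (auto simp: mspace_C_space)

lemma mdist_C_space_le:
  assumes "x \<in> mspace (C_space a b)" "y \<in> mspace (C_space a b)" "a \<le> b"
  shows "mdist (C_space a b) x y \<le> r \<longleftrightarrow> (\<forall>t\<in>{a..b}. \<bar>x t - y t\<bar> \<le> r)"
  using cfunspace_mdist_le[of x "top_of_set {a..b}" euclidean_metric y r] assms
  by (simp add: C_space_def dist_real_def)

lemma openin_C_space_subset:
  "{U. openin (mtopology_of (C_space a b)) U} \<subseteq> Pow (mspace (C_space a b))"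
  using openin_subset[of "mtopology_of (C_space a b)"] by auto

lemma space_C_borel [simp]: "space (C_borel a b) = mspace (C_space a b)"
  unfolding C_borel_def by (rule space_measure_of[OF openin_C_space_subset])

lemma sets_C_borel:
  "sets (C_borel a b) = sigma_sets (mspace (C_space a b)) {U. openin (mtopology_of (C_space a b)) U}"
  unfolding C_borel_def by (rule sets_measure_of[OF openin_C_space_subset])

lemma measurable_evaluation [measurable]:
  assumes "t \<in> {a..b}"
  shows "(\<lambda>x. x t) \<in> borel_measurable (C_borel a b)"
proof (rule borel_measurableI)
  fix U :: "real set" assume "open U"
  interpret Metric_space "mspace (C_space a b)" "mdist (C_space a b)" by (rule Metric_space_mspace_mdist)
  have "openin (mtopology_of (C_space a b)) ((\<lambda>x. x t) -` U \<inter> mspace (C_space a b))"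
    unfolding mtopology_of_def openin_mtopology
  proof (intro conjI allI impI)
    fix x assume x: "x \<in> (\<lambda>x. x t) -` U \<inter> mspace (C_space a b)"
    then obtain e where e: "e > 0" "ball (x t) e \<subseteq> U" using \<open>open U\<close> openE by (metis IntE vimageE)
    have "mball x e \<subseteq> (\<lambda>x. x t) -` U \<inter> mspace (C_space a b)"
    proof
      fix y assume "y \<in> mball x e"
      then have y: "y \<in> mspace (C_space a b)" "mdist (C_space a b) x y < e" by auto
      then have "\<bar>x t - y t\<bar> < e"
        using mdist_C_space_le[of x a b y "mdist (C_space a b) x y"] x assms by fastforce
      then show "y \<in> (\<lambda>x. x t) -` U \<inter> mspace (C_space a b)"
        using e y by (auto simp: dist_real_def)
    qed
    then show "\<exists>r>0. mball x r \<subseteq> (\<lambda>x. x t) -` U \<inter> mspace (C_space a b)" using e by blast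
  qed simp
  then show "(\<lambda>x. x t) -` U \<inter> space (C_borel a b) \<in> sets (C_borel a b)"
    by (auto simp: sets_C_borel intro: sigma_sets.Basic)
qed

text \<open>Bernstein polynomials with rational coefficients, rescaled to \<open>[a,b]\<close>. For \<open>a = b\<close> the
  rescaling divides by zero, and the value \<open>0\<close> of the quotient is the correct one.\<close>

lemma C_space_countable_dense:
  assumes "a \<le> b"
  obtains D where "countable D" "D \<subseteq> mspace (C_space a b)"
    "\<And>x e. x \<in> mspace (C_space a b) \<Longrightarrow> e > 0 \<Longrightarrow> \<exists>g\<in>D. mdist (C_space a b) x g \<le> e"
proof -
  define pol :: "rat list \<Rightarrow> real \<Rightarrow> real" where
    "pol qs = (\<lambda>t\<in>{a..b}. \<Sum>k\<le>length qs - 1. of_rat (qs ! k) * Bernstein (length qs - 1) k ((t - a) / (b - a)))" for qs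
  have mem: "pol qs \<in> mspace (C_space a b)" for qs
  proof -
    have "continuous_on {a..b} (pol qs) \<longleftrightarrow> continuous_on {a..b} (\<lambda>t. \<Sum>k\<le>length qs - 1.
        of_rat (qs ! k) * Bernstein (length qs - 1) k ((t - a) / (b - a)))"
      by (rule continuous_on_cong) (auto simp: pol_def)
    then show ?thesis
      unfolding mspace_C_space Bernstein_def divide_inverse
      by (auto intro!: continuous_intros simp: pol_def)
  qed
  have dense: "\<exists>g\<in>range pol. mdist (C_space a b) x g \<le> e" if x: "x \<in> mspace (C_space a b)" and e: "e > 0" for x e
  proof -
    define y where "y u = x (a + (b - a) * u)" for u
    have maps: "a + (b - a) * u \<in> {a..b}" if "u \<in> {0..1}" for u
    proof -
      have "0 \<le> (b - a) * u" "(b - a) * u \<le> (b - a) * 1"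
        using that assms by (intro mult_nonneg_nonneg mult_left_mono; simp)+
      then show ?thesis by simp
    qed
    have "continuous_on {0..1} y"
      unfolding y_def using maps
      by (intro continuous_on_compose2[OF C_spaceD(1)[OF x]] continuous_intros) auto
    from Bernstein_Weierstrass[OF this, of "e / 2"] e obtain n where
      n: "\<And>u. u \<in> {0..1} \<Longrightarrow> \<bar>y u - (\<Sum>k\<le>n. y (k / n) * Bernstein n k u)\<bar> < e / 2" by auto
    have "\<exists>q::rat. \<bar>y (k / n) - of_rat q\<bar> < e / 2" for k :: nat
    proof -
      obtain q where "q \<in> \<rat>" "y (k / n) - e / 2 < q" "q < y (k / n) + e / 2"
        using Rats_dense_in_real[of "y (k / n) - e / 2" "y (k / n) + e / 2"] e by auto
      moreover from \<open>q \<in> \<rat>\<close> obtain r where "q = of_rat r" by (rule Rats_cases)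
      ultimately show ?thesis by (intro exI[of _ r], unfold abs_less_iff) linarith
    qed
    then obtain q :: "nat \<Rightarrow> rat" where q: "\<And>k. \<bar>y (k / n) - of_rat (q k)\<bar> < e / 2" by metis
    define qs where "qs = map q [0..<Suc n]"
    have "\<bar>x t - pol qs t\<bar> \<le> e" if t: "t \<in> {a..b}" for t
    proof -
      define u where "u = (t - a) / (b - a)"
      have u: "u \<in> {0..1}" using t by (auto simp: u_def divide_le_eq)
      have xt: "x t = y u" using t by (auto simp: y_def u_def)
      have pt: "pol qs t = (\<Sum>k\<le>n. of_rat (q k) * Bernstein n k u)"
        using t by (auto simp: pol_def qs_def u_def simp del: upt_Suc intro!: sum.cong)
      have "\<bar>(\<Sum>k\<le>n. y (k / n) * Bernstein n k u) - pol qs t\<bar> =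
          \<bar>\<Sum>k\<le>n. (y (k / n) - of_rat (q k)) * Bernstein n k u\<bar>"
        unfolding pt by (simp add: sum_subtractf left_diff_distrib)
      also have "\<dots> \<le> (\<Sum>k\<le>n. \<bar>(y (k / n) - of_rat (q k)) * Bernstein n k u\<bar>)" by (rule sum_abs)
      also have "\<dots> \<le> (\<Sum>k\<le>n. e / 2 * Bernstein n k u)"
      proof (rule sum_mono)
        fix k
        have "\<bar>y (k / n) - of_rat (q k)\<bar> \<le> e / 2" using q[of k] by linarith
        then show "\<bar>(y (k / n) - of_rat (q k)) * Bernstein n k u\<bar> \<le> e / 2 * Bernstein n k u"
          unfolding abs_mult using u e by (intro mult_mono) (auto simp: Bernstein_nonneg)
      qed
      also have "\<dots> = e / 2" unfolding sum_distrib_left[symmetric] by simp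
      finally show ?thesis using n[OF u] unfolding xt by linarith
    qed
    then have "mdist (C_space a b) x (pol qs) \<le> e" using mdist_C_space_le[OF x mem assms] by simp
    then show ?thesis by blast
  qed
  show ?thesis using mem dense by (intro that[of "range pol"]) auto
qed

text \<open>Every open set of \<open>C[a,b]\<close> is a countable union of closed balls, and a closed ball
  is cut out by the evaluations at countably many times.\<close>

lemma measurable_C_borel:
  assumes "a \<le> b" and f: "\<And>\<omega>. \<omega> \<in> space M \<Longrightarrow> f \<omega> \<in> mspace (C_space a b)"
    and ev: "\<And>t. t \<in> {a..b} \<Longrightarrow> (\<lambda>\<omega>. f \<omega> t) \<in> borel_measurable M"
  shows "f \<in> measurable M (C_borel a b)"
  unfolding C_borel_def
proof (rule measurable_sigma_sets[OF sets_measure_of])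
  interpret Metric_space "mspace (C_space a b)" "mdist (C_space a b)" by (rule Metric_space_mspace_mdist)
  show "{U. openin (mtopology_of (C_space a b)) U} \<subseteq> Pow (mspace (C_space a b))"
    by (rule openin_C_space_subset)
  then show "{U. openin (mtopology_of (C_space a b)) U} \<subseteq> Pow (mspace (C_space a b))" .
  show "f \<in> space M \<rightarrow> mspace (C_space a b)" using f by auto
  fix U assume "U \<in> {U. openin (mtopology_of (C_space a b)) U}"
  then have U: "openin mtopology U" by (simp add: mtopology_of_def)
  obtain D where D: "countable D" "D \<subseteq> mspace (C_space a b)"
    "\<And>x e. x \<in> mspace (C_space a b) \<Longrightarrow> e > 0 \<Longrightarrow> \<exists>g\<in>D. mdist (C_space a b) x g \<le> e"
    using C_space_countable_dense[OF assms(1)] by blast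
  obtain T where T: "countable T" "T \<subseteq> {a..b}" "{a..b} \<subseteq> closure T" using separable by blast
  define G where "G = {(g, r). g \<in> D \<and> r \<in> \<rat> \<and> mcball g r \<subseteq> U}"
  have "G \<subseteq> D \<times> \<rat>" by (auto simp: G_def)
  then have G: "countable G" using D(1) countable_rat by (meson countable_SIGMA countable_subset)
  have Ueq: "U = (\<Union>(g, r)\<in>G. mcball g r)"
  proof (intro antisym subsetI)
    fix x assume x: "x \<in> U"
    then have xm: "x \<in> mspace (C_space a b)" using U by (auto simp: openin_mtopology)
    from x U obtain e where e: "e > 0" "mball x e \<subseteq> U" by (auto simp: openin_mtopology)
    obtain r where r: "r \<in> \<rat>" "0 < r" "r < e / 2" using Rats_dense_in_real[of 0 "e / 2"] e by auto
    obtain g where g: "g \<in> D" "mdist (C_space a b) x g \<le> r" using D(3)[OF xm r(2)] by auto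
    have gm: "g \<in> mspace (C_space a b)" using g D by auto
    have "mcball g r \<subseteq> U"
    proof
      fix y assume "y \<in> mcball g r"
      then have "y \<in> mspace (C_space a b)" "mdist (C_space a b) g y \<le> r" by auto
      then have "y \<in> mball x e" using triangle[OF xm gm, of y] g r xm by auto
      then show "y \<in> U" using e by auto
    qed
    then have "(g, r) \<in> G" using g r by (auto simp: G_def)
    moreover have "x \<in> mcball g r" using g gm xm by (simp add: commute)
    ultimately show "x \<in> (\<Union>(g, r)\<in>G. mcball g r)" by blast
  qed (auto simp: G_def)
  have ball: "f -` mcball g r \<inter> space M = space M \<inter> (\<Inter>t\<in>T. {\<omega> \<in> space M. \<bar>g t - f \<omega> t\<bar> \<le> r})"
    if "g \<in> D" for g r
  proof -
    have gm: "g \<in> mspace (C_space a b)" using that D by auto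
    have "mdist (C_space a b) g (f \<omega>) \<le> r \<longleftrightarrow> (\<forall>t\<in>T. \<bar>g t - f \<omega> t\<bar> \<le> r)" if "\<omega> \<in> space M" for \<omega>
    proof -
      note fm = f[OF that]
      have "\<forall>t\<in>{a..b}. \<bar>g t - f \<omega> t\<bar> \<le> r" if *: "\<forall>t\<in>T. \<bar>g t - f \<omega> t\<bar> \<le> r"
      proof
        fix t assume "t \<in> {a..b}"
        have cl: "closure T \<subseteq> {a..b}" using T(2) by (simp add: closure_minimal)
        have "continuous_on (closure T) (\<lambda>t. \<bar>g t - f \<omega> t\<bar>)"
          by (rule continuous_on_subset[OF _ cl])
            (intro continuous_intros C_spaceD(1)[OF gm] C_spaceD(1)[OF fm])
        then show "\<bar>g t - f \<omega> t\<bar> \<le> r"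
          by (rule continuous_le_on_closure) (use * T \<open>t \<in> {a..b}\<close> in auto)
      qed
      then show ?thesis using mdist_C_space_le[OF gm fm assms(1)] T(2) by blast
    qed
    then show ?thesis using f gm by auto
  qed
  have "f -` mcball g r \<inter> space M \<in> sets M" if "g \<in> D" for g r
  proof -
    have "{\<omega> \<in> space M. \<bar>g t - f \<omega> t\<bar> \<le> r} \<in> sets M" if "t \<in> T" for t
    proof -
      have [measurable]: "(\<lambda>\<omega>. f \<omega> t) \<in> borel_measurable M" using ev T that by blast
      show ?thesis by measurable
    qed
    then have "(\<Inter>t\<in>T. {\<omega> \<in> space M. \<bar>g t - f \<omega> t\<bar> \<le> r}) \<in> sets M \<or> T = {}"
      using T(1) by (cases "T = {}") (auto intro!: sets.countable_INT')
    then show ?thesis unfolding ball[OF that] by auto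
  qed
  then have "(\<Union>(g, r)\<in>G. f -` mcball g r \<inter> space M) \<in> sets M"
    using G by (intro sets.countable_UN') (auto simp: G_def)
  moreover have "f -` U \<inter> space M = (\<Union>(g, r)\<in>G. f -` mcball g r \<inter> space M)"
    unfolding Ueq by auto
  ultimately show "f -` U \<inter> space M \<in> sets M" by simp
qed

text \<open>The events that concern finitely many times form a generator that is stable under
  intersection, and characteristic functions determine a measure on them.\<close>

lemma C_borel_measure_eqI:
  assumes "a \<le> b" and "finite_measure \<mu>" "finite_measure \<nu>"
    and sets: "sets \<mu> = sets (C_borel a b)" "sets \<nu> = sets (C_borel a b)"
    and cf: "\<And>n c t. (\<And>i. i < n \<Longrightarrow> t i \<in> {a..b}) \<Longrightarrow>
      (CLINT x|\<mu>. iexp (\<Sum>i<(n::nat). c i * x (t i))) = (CLINT x|\<nu>. iexp (\<Sum>i<n. c i * x (t i)))"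
  shows "\<mu> = \<nu>"
proof -
  interpret mu: finite_measure \<mu> by fact
  interpret nu: finite_measure \<nu> by fact
  let ?C = "mspace (C_space a b)"
  have sp: "space \<mu> = ?C" "space \<nu> = ?C"
    using sets_eq_imp_space_eq[OF sets(1)] sets_eq_imp_space_eq[OF sets(2)] by simp_all
  define cyl where "cyl n t A = {x \<in> ?C. \<forall>i<n. x (t i) \<in> A i}" for n :: nat and t :: "nat \<Rightarrow> real" and A :: "nat \<Rightarrow> real set"
  define E where "E = {cyl n t A | n t A. (\<forall>i<n. t i \<in> {a..b} \<and> A i \<in> sets borel)}"
  have EP: "E \<subseteq> Pow ?C" by (auto simp: E_def cyl_def)
  have cyl_m: "cyl n t A \<in> sets (C_borel a b)" if "\<forall>i<n. t i \<in> {a..b} \<and> A i \<in> sets borel" for n t A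
  proof -
    have "{x \<in> ?C. x (t i) \<in> A i} \<in> sets (C_borel a b)" if "i < n" for i
    proof -
      have [measurable]: "t i \<in> {a..b}" "A i \<in> sets borel" using that \<open>\<forall>i<n. t i \<in> _ \<and> _\<close> by auto
      have "{x \<in> space (C_borel a b). x (t i) \<in> A i} \<in> sets (C_borel a b)" by measurable
      then show ?thesis by simp
    qed
    then have "{x \<in> space (C_borel a b). \<forall>i\<in>{..<n}. x (t i) \<in> A i} \<in> sets (C_borel a b)"
      by (intro sets.sets_Collect_finite_All) auto
    also have "{x \<in> space (C_borel a b). \<forall>i\<in>{..<n}. x (t i) \<in> A i} = cyl n t A"
      by (auto simp: cyl_def)
    finally show ?thesis .
  qed
  have gen: "sets (C_borel a b) = sigma_sets ?C E"
  proof
    show "sigma_sets ?C E \<subseteq> sets (C_borel a b)"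
    proof -
      have "E \<subseteq> sets (C_borel a b)" unfolding E_def using cyl_m by blast
      from sets.sigma_sets_subset[OF this] show ?thesis by simp
    qed
    have m: "(\<lambda>x. x) \<in> measurable (sigma ?C E) (C_borel a b)"
    proof (rule measurable_C_borel[OF assms(1)])
      fix t assume t: "t \<in> {a..b}"
      show "(\<lambda>x. x t) \<in> borel_measurable (sigma ?C E)"
      proof (rule measurableI)
        fix A :: "real set" assume "A \<in> sets borel"
        then have "cyl 1 (\<lambda>_. t) (\<lambda>_. A) \<in> E" using t unfolding E_def by blast
        moreover have "(\<lambda>x. x t) -` A \<inter> ?C = cyl 1 (\<lambda>_. t) (\<lambda>_. A)" by (auto simp: cyl_def)
        ultimately show "(\<lambda>x. x t) -` A \<inter> space (sigma ?C E) \<in> sets (sigma ?C E)"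
          using EP by (auto simp: space_measure_of sets_measure_of)
      qed simp
    qed (use EP in \<open>simp add: space_measure_of\<close>)
    show "sets (C_borel a b) \<subseteq> sigma_sets ?C E"
    proof
      fix A assume A: "A \<in> sets (C_borel a b)"
      have "(\<lambda>x. x) -` A \<inter> space (sigma ?C E) \<in> sets (sigma ?C E)" using m A by (rule measurable_sets)
      moreover have "A \<subseteq> ?C" using sets.sets_into_space[OF A] by simp
      ultimately show "A \<in> sigma_sets ?C E"
        using EP by (simp add: space_measure_of sets_measure_of Int_absorb2)
    qed
  qed
  show ?thesis
  proof (rule measure_eqI_generator_eq[where E = E and \<Omega> = ?C and A = "\<lambda>_. ?C"])
    show "Int_stable E"
    proof (rule Int_stableI)
      fix U V assume "U \<in> E" "V \<in> E"
      then obtain n t A m s B where U: "U = cyl n t A" "\<forall>i<n. t i \<in> {a..b} \<and> A i \<in> sets borel"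
        and V: "V = cyl m s B" "\<forall>i<m. s i \<in> {a..b} \<and> B i \<in> sets borel" unfolding E_def by blast
      let ?t = "\<lambda>i. if i < n then t i else s (i - n)" and ?A = "\<lambda>i. if i < n then A i else B (i - n)"
      have "U \<inter> V = cyl (n + m) ?t ?A"
      proof (intro antisym subsetI)
        fix x assume x: "x \<in> cyl (n + m) ?t ?A"
        have "x (s i) \<in> B i" if "i < m" for i
          using x that unfolding cyl_def by (auto dest!: spec[of _ "n + i"])
        moreover have "x (t i) \<in> A i" if "i < n" for i
          using x that unfolding cyl_def by (auto dest!: spec[of _ "i"])
        ultimately show "x \<in> U \<inter> V" using x by (auto simp: U V cyl_def)
      qed (auto simp: U V cyl_def)
      moreover have "\<forall>i<n + m. ?t i \<in> {a..b} \<and> ?A i \<in> sets borel"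
        using U(2) V(2) by auto
      ultimately show "U \<inter> V \<in> E" unfolding E_def by blast
    qed
    show "emeasure \<mu> U = emeasure \<nu> U" if "U \<in> E" for U
    proof -
      obtain n t A where U: "U = cyl n t A" "\<forall>i<n. t i \<in> {a..b} \<and> A i \<in> sets borel"
        using \<open>U \<in> E\<close> unfolding E_def by blast
      have "measure \<mu> {x \<in> space \<mu>. \<forall>i<n. x (t i) \<in> A i} = measure \<nu> {x \<in> space \<nu>. \<forall>i<n. x (t i) \<in> A i}"
      proof (rule char_unique_boxes)
        show "(CLINT x|\<mu>. iexp (\<Sum>i<n. c i * x (t i))) = (CLINT x|\<nu>. iexp (\<Sum>i<n. c i * x (t i)))" for c
          using cf U(2) by blast
        fix i assume "i < n"
        then have "(\<lambda>x. x (t i)) \<in> borel_measurable (C_borel a b)" using U(2) by (intro measurable_evaluation) auto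
        then show "(\<lambda>x. x (t i)) \<in> borel_measurable \<mu>" "(\<lambda>x. x (t i)) \<in> borel_measurable \<nu>"
          by (simp_all cong: measurable_cong_sets add: sets)
      qed (use U assms in auto)
      then show ?thesis by (simp add: U cyl_def mu.emeasure_eq_measure nu.emeasure_eq_measure sp)
    qed
    have "cyl 0 (\<lambda>_. 0) (\<lambda>_. {}) \<in> E" unfolding E_def by blast
    then show "range (\<lambda>_. ?C) \<subseteq> E" by (auto simp: cyl_def)
  qed (use EP gen sets in auto)
qed

section \<open>The Cameron-Martin theorem for Gaussian measures on C[a,b]\<close>

lemma square_integrable_nn_integral:
  assumes "f \<in> borel_measurable M" "(\<integral>\<^sup>+x. ennreal ((f x)\<^sup>2) \<partial>M) < ennreal e"
  shows "square_integrable M f" "(LINT x|M. (f x)\<^sup>2) < e"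
proof -
  show si: "square_integrable M f"
    unfolding square_integrable_def
    using assms by (auto intro!: integrableI_bounded elim: order_less_trans simp: less_top[symmetric])
  have "(\<integral>\<^sup>+x. ennreal ((f x)\<^sup>2) \<partial>M) = ennreal (LINT x|M. (f x)\<^sup>2)"
    using si by (intro nn_integral_eq_integral) (auto simp: square_integrable_def)
  then show "(LINT x|M. (f x)\<^sup>2) < e"
    using assms(2) by (simp add: ennreal_less_iff)
qed

lemma nn_integral_square_less:
  assumes "square_integrable M f" "(LINT x|M. (f x)\<^sup>2) < e"
  shows "(\<integral>\<^sup>+x. ennreal ((f x)\<^sup>2) \<partial>M) < ennreal e"
proof -
  have "(\<integral>\<^sup>+x. ennreal ((f x)\<^sup>2) \<partial>M) = ennreal (LINT x|M. (f x)\<^sup>2)"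
    using assms by (intro nn_integral_eq_integral) (auto simp: square_integrable_def)
  then show ?thesis using assms(2) by (simp add: ennreal_less_iff)
qed

lemma (in prob_space) integral_abs_le_sqrt:
  assumes "square_integrable M f"
  shows "(LINT x|M. \<bar>f x\<bar>) \<le> sqrt (LINT x|M. (f x)\<^sup>2)"
proof -
  have "square_integrable M (\<lambda>x. \<bar>f x\<bar>)" "square_integrable M (\<lambda>x. 1)"
    using assms by (auto simp: square_integrable_def)
  from integral_Cauchy_Schwarz[OF this] show ?thesis
    by (intro real_le_rsqrt) (simp add: prob_space)
qed

lemma cmod_iexp_diff_le: "cmod (iexp x - iexp y) \<le> \<bar>x - y\<bar>"
proof -
  have "cmod (iexp x - iexp y) = cmod (iexp y * (iexp (x - y) - 1))"
    by (simp add: right_diff_distrib exp_add[symmetric])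
  also have "\<dots> = cmod (iexp (x - y) - 1)" by (simp add: norm_mult)
  also have "\<dots> \<le> \<bar>x - y\<bar>" using iexp_approx1[of "x - y" 0] by simp
  finally show ?thesis .
qed

lemma (in prob_space) char_L2_tendsto:
  assumes "L2_tendsto M f g"
  shows "(\<lambda>n. CLINT x|M. iexp (f n x)) \<longlonglongrightarrow> (CLINT x|M. iexp (g x))"
proof -
  note a = L2_tendstoD[OF assms]
  have [measurable]: "f n \<in> borel_measurable M" "g \<in> borel_measurable M" for n
    using a by (auto simp: square_integrable_def)
  have int: "integrable M (\<lambda>x. iexp (f n x))" "integrable M (\<lambda>x. iexp (g x))" for n
    by (auto intro!: integrable_const_bound[of _ 1])
  have "(\<lambda>n. (CLINT x|M. iexp (f n x)) - (CLINT x|M. iexp (g x))) \<longlonglongrightarrow> 0"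
  proof (rule Lim_null_comparison)
    show "\<forall>\<^sub>F n in sequentially. norm ((CLINT x|M. iexp (f n x)) - (CLINT x|M. iexp (g x)))
      \<le> sqrt (LINT x|M. (f n x - g x)\<^sup>2)"
    proof (intro always_eventually allI)
      fix n
      have d: "square_integrable M (\<lambda>x. f n x - g x)" using a by auto
      have "norm ((CLINT x|M. iexp (f n x)) - (CLINT x|M. iexp (g x)))
          = norm (CLINT x|M. iexp (f n x) - iexp (g x))"
        using int by simp
      also have "\<dots> \<le> (LINT x|M. norm (iexp (f n x) - iexp (g x)))" by (rule integral_norm_bound)
      also have "\<dots> \<le> (LINT x|M. \<bar>f n x - g x\<bar>)"
      proof (rule integral_mono)
        show "integrable M (\<lambda>x. \<bar>f n x - g x\<bar>)"
          using square_integrable_integrable[OF finite_measure_axioms d] by simp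
      qed (use int cmod_iexp_diff_le in auto)
      also have "\<dots> \<le> sqrt (LINT x|M. (f n x - g x)\<^sup>2)" by (rule integral_abs_le_sqrt[OF d])
      finally show "norm ((CLINT x|M. iexp (f n x)) - (CLINT x|M. iexp (g x)))
        \<le> sqrt (LINT x|M. (f n x - g x)\<^sup>2)" .
    qed
    show "(\<lambda>n. sqrt (LINT x|M. (f n x - g x)\<^sup>2)) \<longlonglongrightarrow> 0"
      using tendsto_real_sqrt[OF a(3)] by simp
  qed
  then show ?thesis by (simp add: LIM_zero_iff)
qed

definition shift_path :: "real \<Rightarrow> real \<Rightarrow> (real \<Rightarrow> real) \<Rightarrow> (real \<Rightarrow> real) \<Rightarrow> (real \<Rightarrow> real)" where
  "shift_path a b h x = (\<lambda>t\<in>{a..b}. x t + h t)"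

lemma shift_path_in_C_space:
  assumes "x \<in> mspace (C_space a b)" "h \<in> mspace (C_space a b)"
  shows "shift_path a b h x \<in> mspace (C_space a b)"
proof -
  have "continuous_on {a..b} (shift_path a b h x) \<longleftrightarrow> continuous_on {a..b} (\<lambda>t. x t + h t)"
    by (rule continuous_on_cong) (auto simp: shift_path_def)
  then show ?thesis using assms
    by (auto simp: mspace_C_space shift_path_def intro!: continuous_intros)
qed

lemma measurable_shift_path:
  assumes "a \<le> b" "h \<in> mspace (C_space a b)"
  shows "shift_path a b h \<in> measurable (C_borel a b) (C_borel a b)"
proof (rule measurable_C_borel[OF assms(1)])
  fix t assume t: "t \<in> {a..b}"
  have "(\<lambda>x. x t + h t) \<in> borel_measurable (C_borel a b)"
    using measurable_evaluation[OF t] by simp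
  then show "(\<lambda>x. shift_path a b h x t) \<in> borel_measurable (C_borel a b)"
    using t by (simp add: shift_path_def)
qed (use assms shift_path_in_C_space in auto)

definition evaluation_span :: "real \<Rightarrow> real \<Rightarrow> ((real \<Rightarrow> real) \<Rightarrow> real) set" where
  "evaluation_span a b = {(\<lambda>x. \<Sum>i<n. c i * x (t i)) | (n::nat) c t. \<forall>i<n. t i \<in> {a..b}}"

lemma evaluation_spanI:
  "(\<And>i. i < n \<Longrightarrow> t i \<in> {a..b}) \<Longrightarrow> (\<lambda>x. \<Sum>i<(n::nat). c i * x (t i)) \<in> evaluation_span a b"
  unfolding evaluation_span_def by blast

lemma evaluation_in_span: "t \<in> {a..b} \<Longrightarrow> (\<lambda>x. x t) \<in> evaluation_span a b"
  using evaluation_spanI[of 1 "\<lambda>_. t" a b "\<lambda>_. 1"] by simp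

lemma evaluation_span_zero: "(\<lambda>x. 0) \<in> evaluation_span a b"
  using evaluation_spanI[of 0] by simp

lemma evaluation_span_linear:
  assumes "A \<in> evaluation_span a b" "B \<in> evaluation_span a b"
  shows "(\<lambda>x. \<alpha> * A x + \<beta> * B x) \<in> evaluation_span a b"
proof -
  obtain n :: nat and c t where A: "A = (\<lambda>x. \<Sum>i<n. c i * x (t i))" "\<forall>i<n. t i \<in> {a..b}"
    using assms(1) unfolding evaluation_span_def by blast
  obtain m :: nat and d s where B: "B = (\<lambda>x. \<Sum>i<m. d i * x (s i))" "\<forall>i<m. s i \<in> {a..b}"
    using assms(2) unfolding evaluation_span_def by blast
  let ?t = "\<lambda>i. if i < n then t i else s (i - n)"
  let ?c = "\<lambda>i. if i < n then \<alpha> * c i else \<beta> * d (i - n)"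
  have "(\<Sum>i<n+m. ?c i * x (?t i)) = \<alpha> * A x + \<beta> * B x" for x
  proof -
    define F where "F i = ?c i * x (?t i)" for i
    have "sum F {..<n+m} = sum F {..<n} + sum F {n..<n+m}"
      by (simp add: atLeast0LessThan[symmetric] sum.atLeastLessThan_concat)
    also have "sum F {n..<n+m} = (\<Sum>i<m. F (i + n))"
      using sum.shift_bounds_nat_ivl[of F 0 n m] by (simp add: add.commute atLeast0LessThan)
    finally show ?thesis by (simp add: F_def A B sum_distrib_left mult.assoc)
  qed
  moreover have "(\<lambda>x. \<Sum>i<n+m. ?c i * x (?t i)) \<in> evaluation_span a b"
    using A B by (intro evaluation_spanI) auto
  ultimately show ?thesis by simp
qed

lemma evaluation_span_shift:
  assumes "A \<in> evaluation_span a b"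
  shows "A (shift_path a b h x) = A x + A h"
proof -
  obtain n :: nat and c t where A: "A = (\<lambda>x. \<Sum>i<n. c i * x (t i))" "\<forall>i<n. t i \<in> {a..b}"
    using assms(1) unfolding evaluation_span_def by blast
  have "A (shift_path a b h x) = (\<Sum>i<n. c i * x (t i) + c i * h (t i))"
    unfolding A(1) using A(2) by (intro sum.cong) (auto simp: shift_path_def distrib_left)
  then show ?thesis by (simp add: A(1) sum.distrib)
qed

text \<open>A centred Gaussian measure on \<open>C[a,b]\<close>. The condition on characteristic functions says that
  every combination of evaluations is centred normal; it includes the degenerate law \<open>\<delta>\<^sub>0\<close>, which
  a condition on densities would exclude.\<close>

locale gaussian_path_measure = prob_space \<mu> for \<mu> :: "(real \<Rightarrow> real) measure" +
  fixes a b :: real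
  assumes le: "a \<le> b"
    and sets_mu [measurable_cong]: "sets \<mu> = sets (C_borel a b)"
    and square_integrable_evaluation: "t \<in> {a..b} \<Longrightarrow> square_integrable \<mu> (\<lambda>x. x t)"
    and gaussian: "A \<in> evaluation_span a b \<Longrightarrow>
      (CLINT x|\<mu>. iexp (A x)) = exp (of_real (- (LINT x|\<mu>. (A x)\<^sup>2) / 2))"
begin

lemma square_integrable_span: "A \<in> evaluation_span a b \<Longrightarrow> square_integrable \<mu> A"
  unfolding evaluation_span_def
  by (auto intro!: square_integrable_sum square_integrable_cmult square_integrable_evaluation)

lemma closure_iff_L2_tendsto:
  "Z \<in> L2_evaluation_closure a b \<mu> \<longleftrightarrow> (\<exists>W. (\<forall>n. W n \<in> evaluation_span a b) \<and> L2_tendsto \<mu> W Z)"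
proof
  assume Z: "Z \<in> L2_evaluation_closure a b \<mu>"
  then have [measurable]: "Z \<in> borel_measurable \<mu>" by (simp add: L2_evaluation_closure_def)
  have "\<exists>A\<in>evaluation_span a b. (\<integral>\<^sup>+x. ennreal ((Z x - A x)\<^sup>2) \<partial>\<mu>) < ennreal e" if e: "e > 0" for e
  proof -
    obtain n :: nat and c t where t: "\<forall>i<n. t i \<in> {a..b}"
      "(\<integral>\<^sup>+x. ennreal ((Z x - (\<Sum>i<n. c i * x (t i)))\<^sup>2) \<partial>\<mu>) < ennreal e"
      using Z e unfolding L2_evaluation_closure_def by blast
    show ?thesis by (rule bexI[of _ "\<lambda>x. \<Sum>i<n. c i * x (t i)"], rule t(2), rule evaluation_spanI) (use t in auto)
  qed
  then have "\<exists>A. A \<in> evaluation_span a b \<and> (\<integral>\<^sup>+x. ennreal ((Z x - A x)\<^sup>2) \<partial>\<mu>) < ennreal (1 / (real n + 1))" for n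
    by (meson add_nonneg_pos of_nat_0_le_iff zero_less_divide_1_iff zero_less_one)
  then obtain W where W: "\<And>n. W n \<in> evaluation_span a b"
    "\<And>n. (\<integral>\<^sup>+x. ennreal ((Z x - W n x)\<^sup>2) \<partial>\<mu>) < ennreal (1 / (real n + 1))" by metis
  have siW: "square_integrable \<mu> (W n)" for n by (rule square_integrable_span[OF W(1)])
  have d: "square_integrable \<mu> (\<lambda>x. Z x - W n x)" "(LINT x|\<mu>. (Z x - W n x)\<^sup>2) < 1 / (real n + 1)" for n
    using square_integrable_nn_integral[OF _ W(2)[of n]] square_integrable_measurable[OF siW[of n]] by auto
  have siZ: "square_integrable \<mu> Z" using square_integrable_add[OF d(1) siW, of 0 0] by simp
  have "(\<lambda>n. LINT x|\<mu>. (W n x - Z x)\<^sup>2) \<longlonglongrightarrow> 0"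
  proof (rule tendsto_sandwich[OF _ _ tendsto_const])
    show "\<forall>\<^sub>F n in sequentially. (LINT x|\<mu>. (W n x - Z x)\<^sup>2) \<le> 1 / (real n + 1)"
      using d(2) by (auto simp: power2_commute intro!: always_eventually less_imp_le)
    show "(\<lambda>n. 1 / (real n + 1)) \<longlonglongrightarrow> 0" by (rule inverse_Suc_tendsto_zero)
  qed simp
  then have "L2_tendsto \<mu> W Z" using siW siZ by (simp add: L2_tendsto_def)
  then show "\<exists>W. (\<forall>n. W n \<in> evaluation_span a b) \<and> L2_tendsto \<mu> W Z" using W(1) by blast
next
  assume "\<exists>W. (\<forall>n. W n \<in> evaluation_span a b) \<and> L2_tendsto \<mu> W Z"
  then obtain W where W: "\<And>n. W n \<in> evaluation_span a b" "L2_tendsto \<mu> W Z" by blast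
  note l = L2_tendstoD[OF W(2)]
  have "\<exists>(n::nat) c t. (\<forall>i<n. t i \<in> {a..b}) \<and>
        (\<integral>\<^sup>+x. ennreal ((Z x - (\<Sum>i<n. c i * x (t i)))\<^sup>2) \<partial>\<mu>) < ennreal e" if e: "e > 0" for e
  proof -
    obtain k where "(LINT x|\<mu>. (W k x - Z x)\<^sup>2) < e"
      using eventually_happens[OF order_tendstoD(2)[OF l(3) e]] by auto
    then have "(\<integral>\<^sup>+x. ennreal ((Z x - W k x)\<^sup>2) \<partial>\<mu>) < ennreal e"
      using l by (intro nn_integral_square_less) (auto simp: power2_commute)
    moreover obtain n :: nat and c t where "W k = (\<lambda>x. \<Sum>i<n. c i * x (t i))" "\<forall>i<n. t i \<in> {a..b}"
      using W(1)[of k] unfolding evaluation_span_def by blast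
    ultimately show ?thesis by (intro exI[of _ n] exI[of _ c] exI[of _ t]) simp
  qed
  then show "Z \<in> L2_evaluation_closure a b \<mu>"
    using square_integrable_measurable[OF l(2)] by (simp add: L2_evaluation_closure_def)
qed

lemma square_integrable_closure:
  "Z \<in> L2_evaluation_closure a b \<mu> \<Longrightarrow> square_integrable \<mu> Z"
  using closure_iff_L2_tendsto L2_tendstoD(2) by blast

text \<open>Normality passes to \<open>L\<^sup>2\<close>-limits because characteristic functions and variances do.\<close>

lemma closure_gaussian:
  assumes Z: "Z \<in> L2_evaluation_closure a b \<mu>" and A: "A \<in> evaluation_span a b"
  shows "(CLINT x|\<mu>. iexp (\<alpha> * A x + \<beta> * Z x)) = exp (of_real (- (LINT x|\<mu>. (\<alpha> * A x + \<beta> * Z x)\<^sup>2) / 2))"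
proof -
  obtain W where W: "\<And>n. W n \<in> evaluation_span a b" "L2_tendsto \<mu> W Z"
    using Z closure_iff_L2_tendsto by blast
  have l: "L2_tendsto \<mu> (\<lambda>n x. \<alpha> * A x + \<beta> * W n x) (\<lambda>x. \<alpha> * A x + \<beta> * Z x)"
    by (intro L2_tendsto_add L2_tendsto_cmult L2_tendsto_const square_integrable_cmult
        square_integrable_span A W)
  have "(\<lambda>n. exp (complex_of_real (- (LINT x|\<mu>. (\<alpha> * A x + \<beta> * W n x)\<^sup>2) / 2)))
     \<longlonglongrightarrow> exp (of_real (- (LINT x|\<mu>. (\<alpha> * A x + \<beta> * Z x)\<^sup>2) / 2))"
    by (intro tendsto_intros L2_tendsto_square[OF l]) auto
  moreover have "(CLINT x|\<mu>. iexp (\<alpha> * A x + \<beta> * W n x)) =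
      exp (complex_of_real (- (LINT x|\<mu>. (\<alpha> * A x + \<beta> * W n x)\<^sup>2) / 2))" for n
    by (rule gaussian[OF evaluation_span_linear[OF A W(1)]])
  ultimately have "(\<lambda>n. CLINT x|\<mu>. iexp (\<alpha> * A x + \<beta> * W n x))
     \<longlonglongrightarrow> exp (of_real (- (LINT x|\<mu>. (\<alpha> * A x + \<beta> * Z x)\<^sup>2) / 2))" by simp
  with char_L2_tendsto[OF l] show ?thesis by (rule LIMSEQ_unique)
qed

text \<open>Both sides have the same characteristic functions: a shift by \<open>h\<close> multiplies that of a
  combination \<open>A\<close> of evaluations by \<open>iexp (A h)\<close>, and \<open>A h\<close> is the covariance of \<open>A\<close> and \<open>Z\<close>,
  which is what the weight \<open>exp (Z - E Z\<^sup>2 / 2)\<close> produces.\<close>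

theorem Cameron_Martin_density:
  assumes Z: "Z \<in> L2_evaluation_closure a b \<mu>" and h: "h \<in> mspace (C_space a b)"
    and hZ: "\<And>t. t \<in> {a..b} \<Longrightarrow> h t = (LINT x|\<mu>. Z x * x t)"
  shows "distr \<mu> (C_borel a b) (shift_path a b h)
    = density \<mu> (\<lambda>x. ennreal (exp (Z x - (LINT x|\<mu>. (Z x)\<^sup>2) / 2)))"
proof -
  define v where "v = (LINT x|\<mu>. (Z x)\<^sup>2)"
  have siZ: "square_integrable \<mu> Z" by (rule square_integrable_closure[OF Z])
  note [measurable] = square_integrable_measurable[OF siZ]
  have sh [measurable]: "shift_path a b h \<in> measurable \<mu> (C_borel a b)"
    using measurable_shift_path[OF le h] by (simp cong: measurable_cong_sets add: sets_mu)
  have int: "integrable \<mu> (\<lambda>x. exp (Z x))"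
    and exp_int: "(CLINT x|\<mu>. iexp (A x) * exp (of_real (Z x)))
      = exp (of_real (((LINT x|\<mu>. (Z x)\<^sup>2) - (LINT x|\<mu>. (A x)\<^sup>2)) / 2) + \<i> * of_real (LINT x|\<mu>. A x * Z x))"
    if A: "A \<in> evaluation_span a b" for A
    using jointly_Gaussian_exp[OF prob_space_axioms square_integrable_span[OF A] siZ closure_gaussian[OF Z A]]
    by auto
  show ?thesis
    unfolding v_def[symmetric]
  proof (rule C_borel_measure_eqI[OF le])
    show "finite_measure (distr \<mu> (C_borel a b) (shift_path a b h))"
      by (intro finite_measure_distr) simp
    have "integrable \<mu> (\<lambda>x. exp (- v / 2) * exp (Z x))" using int[OF evaluation_span_zero] by simp
    then have i: "integrable \<mu> (\<lambda>x. exp (Z x - v / 2))" by (simp add: exp_add[symmetric] algebra_simps)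
    show "finite_measure (density \<mu> (\<lambda>x. ennreal (exp (Z x - v / 2))))"
      using nn_integral_eq_integral[OF i]
      by (intro finite_measureI) (simp add: emeasure_density cong: nn_integral_cong)
    fix n :: nat and c t assume t: "\<And>i. i < n \<Longrightarrow> t i \<in> {a..b}"
    define A where "A x = (\<Sum>i<n. c i * x (t i))" for x :: "real \<Rightarrow> real"
    have A: "A \<in> evaluation_span a b" unfolding A_def using evaluation_spanI[of n t a b c] t by blast
    have Am [measurable]: "A \<in> borel_measurable \<mu>"
      by (rule square_integrable_measurable[OF square_integrable_span[OF A]])
    then have Am' [measurable]: "A \<in> borel_measurable (C_borel a b)"
      by (simp cong: measurable_cong_sets add: sets_mu)
    have AZ: "(LINT x|\<mu>. A x * Z x) = A h"
    proof -
      have "(LINT x|\<mu>. A x * Z x) = (LINT x|\<mu>. (\<Sum>i<n. c i * (Z x * x (t i))))"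
        by (intro Bochner_Integration.integral_cong)
          (simp_all add: A_def sum_distrib_left sum_distrib_right mult_ac)
      also have "\<dots> = (\<Sum>i<n. c i * (LINT x|\<mu>. Z x * x (t i)))"
        using t by (subst Bochner_Integration.integral_sum)
          (auto intro!: square_integrable_mult[OF siZ] square_integrable_evaluation)
      also have "\<dots> = A h" unfolding A_def using t hZ by (intro sum.cong) auto
      finally show ?thesis .
    qed
    have "(CLINT x|distr \<mu> (C_borel a b) (shift_path a b h). iexp (A x)) = (CLINT x|\<mu>. iexp (A (shift_path a b h x)))"
      by (subst integral_distr) auto
    also have "\<dots> = (CLINT x|\<mu>. iexp (A h) * iexp (A x))"
      by (simp add: evaluation_span_shift[OF A] distrib_left exp_add mult.commute)
    also have "\<dots> = iexp (A h) * exp (of_real (- (LINT x|\<mu>. (A x)\<^sup>2) / 2))"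
      using gaussian[OF A] by simp
    also have "\<dots> = exp (of_real (- v / 2)) * (CLINT x|\<mu>. iexp (A x) * exp (of_real (Z x)))"
      unfolding exp_int[OF A] AZ v_def[symmetric]
      by (simp add: exp_add[symmetric] diff_divide_distrib algebra_simps)
    also have "\<dots> = (CLINT x|\<mu>. exp (of_real (- v / 2)) * (iexp (A x) * exp (of_real (Z x))))"
      by simp
    also have "\<dots> = (CLINT x|\<mu>. exp (Z x - v / 2) *\<^sub>R iexp (A x))"
      by (intro Bochner_Integration.integral_cong)
        (simp_all add: scaleR_conv_of_real exp_of_real[symmetric] exp_add[symmetric] algebra_simps)
    also have "\<dots> = (CLINT x|density \<mu> (\<lambda>x. ennreal (exp (Z x - v / 2))). iexp (A x))"
      by (subst integral_density) auto
    finally show "(CLINT x|distr \<mu> (C_borel a b) (shift_path a b h). iexp (\<Sum>i<n. c i * x (t i)))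
      = (CLINT x|density \<mu> (\<lambda>x. ennreal (exp (Z x - v / 2))). iexp (\<Sum>i<n. c i * x (t i)))"
      by (simp only: A_def)
  qed (simp_all add: sets_mu)
qed

text \<open>A closed graph argument. If \<open>A \<mapsto> A h\<close> were unbounded in \<open>L\<^sup>2\<close>, there would be combinations
  \<open>B n\<close> with \<open>B n h = 1\<close> that tend to \<open>0\<close> almost everywhere along a subsequence. By absolute
  continuity they would also tend to \<open>0\<close> at the shifted path, where their values are larger by
  one. A bounded functional has a Riesz representer.\<close>

lemma absolutely_continuous_imp_representer:
  assumes h: "h \<in> mspace (C_space a b)"
    and ac: "absolutely_continuous \<mu> (distr \<mu> (C_borel a b) (shift_path a b h))"
  obtains Z where "Z \<in> L2_evaluation_closure a b \<mu>" "\<And>t. t \<in> {a..b} \<Longrightarrow> h t = (LINT x|\<mu>. Z x * x t)"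
proof -
  have sh [measurable]: "shift_path a b h \<in> measurable \<mu> (C_borel a b)"
    using measurable_shift_path[OF le h] by (simp cong: measurable_cong_sets add: sets_mu)
  have "\<exists>C\<ge>0. \<forall>A\<in>evaluation_span a b. (A h)\<^sup>2 \<le> C * (LINT x|\<mu>. (A x)\<^sup>2)"
  proof (rule ccontr)
    assume "\<not> ?thesis"
    then have "\<exists>A\<in>evaluation_span a b. (A h)\<^sup>2 > (real n + 1) * (LINT x|\<mu>. (A x)\<^sup>2)" for n
      by (metis add_nonneg_nonneg not_le of_nat_0_le_iff zero_le_one)
    then obtain A where A: "\<And>n. A n \<in> evaluation_span a b"
      "\<And>n. (A n h)\<^sup>2 > (real n + 1) * (LINT x|\<mu>. (A n x)\<^sup>2)" by metis
    have nz: "A n h \<noteq> 0" for n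
    proof
      assume "A n h = 0"
      with A(2)[of n] have "(real n + 1) * (LINT x|\<mu>. (A n x)\<^sup>2) < 0" by simp
      moreover have "0 \<le> (real n + 1) * (LINT x|\<mu>. (A n x)\<^sup>2)" by (intro mult_nonneg_nonneg) auto
      ultimately show False by linarith
    qed
    define B where "B n x = (1 / A n h) * A n x" for n x
    have B: "B n \<in> evaluation_span a b" for n
      using evaluation_span_linear[OF A(1) evaluation_span_zero, of "1 / A n h" n 0] by (simp add: B_def[abs_def])
    have siB: "square_integrable \<mu> (B n)" for n by (rule square_integrable_span[OF B])
    have [measurable]: "B n \<in> borel_measurable \<mu>" for n by (rule square_integrable_measurable[OF siB])
    have small: "(LINT x|\<mu>. \<bar>B n x\<bar>) \<le> sqrt (1 / (real n + 1))" for n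
    proof -
      have "(LINT x|\<mu>. (B n x)\<^sup>2) = (LINT x|\<mu>. (A n x)\<^sup>2) / (A n h)\<^sup>2"
        unfolding B_def integral_square_cmult by (simp add: power_divide)
      also have "\<dots> \<le> 1 / (real n + 1)"
        using A(2)[of n] nz[of n] by (simp add: field_simps)
      finally have "sqrt (LINT x|\<mu>. (B n x)\<^sup>2) \<le> sqrt (1 / (real n + 1))" by simp
      then show ?thesis using integral_abs_le_sqrt[OF siB, of n] by linarith
    qed
    have "(\<lambda>n. LINT x|\<mu>. norm (B n x)) \<longlonglongrightarrow> 0"
    proof (rule tendsto_sandwich[OF _ _ tendsto_const])
      show "\<forall>\<^sub>F n in sequentially. (LINT x|\<mu>. norm (B n x)) \<le> sqrt (1 / (real n + 1))" using small by simp
      from tendsto_real_sqrt[OF inverse_Suc_tendsto_zero] show "(\<lambda>n. sqrt (1 / (real n + 1))) \<longlonglongrightarrow> 0" by simp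
    qed simp
    then obtain r where r: "AE x in \<mu>. (\<lambda>n. B (r n) x) \<longlonglongrightarrow> 0"
      using tendsto_L1_AE_subseq[of \<mu> B] square_integrable_integrable[OF finite_measure_axioms siB] by blast
    have "AE x in distr \<mu> (C_borel a b) (shift_path a b h). (\<lambda>n. B (r n) x) \<longlonglongrightarrow> 0"
      by (rule absolutely_continuous_AE[OF _ ac r]) (simp add: sets_mu)
    then have "AE x in \<mu>. (\<lambda>n. B (r n) (shift_path a b h x)) \<longlonglongrightarrow> 0"
      by (rule AE_distrD[OF sh])
    with r have "AE x in \<mu>. False"
    proof eventually_elim
      fix x assume x: "(\<lambda>n. B (r n) x) \<longlonglongrightarrow> 0" "(\<lambda>n. B (r n) (shift_path a b h x)) \<longlonglongrightarrow> 0"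
      have "B (r n) (shift_path a b h x) = B (r n) x + 1" for n
        unfolding evaluation_span_shift[OF B] using nz by (simp add: B_def)
      with x(2) have "(\<lambda>n. B (r n) x + 1) \<longlonglongrightarrow> 0" by simp
      moreover have "(\<lambda>n. B (r n) x + 1) \<longlonglongrightarrow> 0 + 1" by (intro tendsto_intros x)
      ultimately show False using LIMSEQ_unique by fastforce
    qed
    then show False by (simp add: AE_False)
  qed
  then obtain C where C: "C \<ge> 0" "\<And>A. A \<in> evaluation_span a b \<Longrightarrow> (A h)\<^sup>2 \<le> C * (LINT x|\<mu>. (A x)\<^sup>2)" by blast
  obtain Z W where ZW: "L2_tendsto \<mu> W Z" "\<And>n. W n \<in> evaluation_span a b"
    "\<And>A. A \<in> evaluation_span a b \<Longrightarrow> A h = (LINT x|\<mu>. Z x * A x)"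
  proof (rule L2_Riesz[where V = "evaluation_span a b" and l = "\<lambda>A. A h" and C = C])
    show "finite_measure \<mu>" by (rule finite_measure_axioms)
  qed (simp_all add: square_integrable_span evaluation_span_zero evaluation_span_linear C)
  show ?thesis
  proof (rule that)
    show "Z \<in> L2_evaluation_closure a b \<mu>" using ZW closure_iff_L2_tendsto by blast
    show "h t = (LINT x|\<mu>. Z x * x t)" if "t \<in> {a..b}" for t
      using ZW(3)[OF evaluation_in_span[OF that]] .
  qed
qed

theorem Cameron_Martin_iff:
  assumes h: "h \<in> mspace (C_space a b)"
  shows "absolutely_continuous \<mu> (distr \<mu> (C_borel a b) (shift_path a b h)) \<longleftrightarrow> h \<in> gaussian_kernel a b \<mu>"
proof
  assume "absolutely_continuous \<mu> (distr \<mu> (C_borel a b) (shift_path a b h))"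
  from absolutely_continuous_imp_representer[OF h this] obtain Z where
    Z: "Z \<in> L2_evaluation_closure a b \<mu>" "\<And>t. t \<in> {a..b} \<Longrightarrow> h t = (LINT x|\<mu>. Z x * x t)" by blast
  have "h = (\<lambda>t\<in>{a..b}. LINT x|\<mu>. Z x * x t)"
    using Z(2) C_spaceD(2)[OF h] by (intro ext) (auto simp: restrict_def extensional_def)
  then show "h \<in> gaussian_kernel a b \<mu>" using Z(1) unfolding gaussian_kernel_def by blast
next
  assume "h \<in> gaussian_kernel a b \<mu>"
  then obtain Z where Z: "Z \<in> L2_evaluation_closure a b \<mu>" "h = (\<lambda>t\<in>{a..b}. LINT x|\<mu>. Z x * x t)"
    unfolding gaussian_kernel_def by blast
  note [measurable] = square_integrable_measurable[OF square_integrable_closure[OF Z(1)]]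
  show "absolutely_continuous \<mu> (distr \<mu> (C_borel a b) (shift_path a b h))"
    by (subst Cameron_Martin_density[OF Z(1) h]) (auto simp: Z(2) intro!: absolutely_continuousI_density)
qed

end

section \<open>Wiener integrals\<close>

text \<open>The data of a step function and of its elementary integral: the number of steps, their
  heights, and their left and right end points.\<close>

type_synonym steps = "nat \<times> (nat \<Rightarrow> real) \<times> (nat \<Rightarrow> real) \<times> (nat \<Rightarrow> real)"

definition steps_on :: "real \<Rightarrow> real \<Rightarrow> steps set" where
  "steps_on a b = {(n, c, u, v). \<forall>i<n. a \<le> u i \<and> u i \<le> v i \<and> v i \<le> b}"

definition steps_fun :: "steps \<Rightarrow> real \<Rightarrow> real" where
  "steps_fun \<sigma> = (case \<sigma> of (n, c, u, v) \<Rightarrow> step_fun n c u v)"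

definition steps_integral :: "(real \<Rightarrow> 'a \<Rightarrow> real) \<Rightarrow> steps \<Rightarrow> 'a \<Rightarrow> real" where
  "steps_integral Y \<sigma> = (case \<sigma> of (n, c, u, v) \<Rightarrow> step_integral Y n c u v)"

lemma steps_linear:
  assumes "\<sigma> \<in> steps_on a b" "\<tau> \<in> steps_on a b"
  obtains \<rho> where "\<rho> \<in> steps_on a b"
    "\<And>s. steps_fun \<rho> s = \<alpha> * steps_fun \<sigma> s + \<beta> * steps_fun \<tau> s"
    "\<And>(Y :: real \<Rightarrow> 'a \<Rightarrow> real) \<omega>. steps_integral Y \<rho> \<omega> = \<alpha> * steps_integral Y \<sigma> \<omega> + \<beta> * steps_integral Y \<tau> \<omega>"
proof -
  obtain n c u v where s: "\<sigma> = (n, c, u, v)" by (metis prod_cases4)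
  obtain m d w z where t: "\<tau> = (m, d, w, z)" by (metis prod_cases4)
  define C where "C i = (if i < n then \<alpha> * c i else \<beta> * d (i - n))" for i
  define U where "U i = (if i < n then u i else w (i - n))" for i
  define V where "V i = (if i < n then v i else z (i - n))" for i
  have split: "sum F {..<n+m} = sum F {..<n} + (\<Sum>i<m. F (i + n))" for F :: "nat \<Rightarrow> real"
  proof -
    have "sum F {..<n+m} = sum F {..<n} + sum F {n..<n+m}"
      by (simp add: atLeast0LessThan[symmetric] sum.atLeastLessThan_concat)
    also have "sum F {n..<n+m} = (\<Sum>i<m. F (i + n))"
      using sum.shift_bounds_nat_ivl[of F 0 n m] by (simp add: add.commute atLeast0LessThan)
    finally show ?thesis .
  qed
  have comb: "(\<Sum>i<n+m. C i * G (U i) (V i)) =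
      \<alpha> * (\<Sum>i<n. c i * G (u i) (v i)) + \<beta> * (\<Sum>i<m. d i * G (w i) (z i))" for G :: "real \<Rightarrow> real \<Rightarrow> real"
    by (simp add: split sum_distrib_left C_def U_def V_def mult.assoc)
  show ?thesis
  proof (rule that[of "(n + m, C, U, V)"])
    show "(n + m, C, U, V) \<in> steps_on a b"
      using assms by (auto simp: steps_on_def s t U_def V_def)
    show "steps_fun (n + m, C, U, V) x = \<alpha> * steps_fun \<sigma> x + \<beta> * steps_fun \<tau> x" for x
      by (simp only: steps_fun_def step_fun_def s t prod.case comb[of "\<lambda>u v. indicator {u<..v} x"])
    show "steps_integral Y (n + m, C, U, V) \<omega> = \<alpha> * steps_integral Y \<sigma> \<omega> + \<beta> * steps_integral Y \<tau> \<omega>"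
      for Y :: "real \<Rightarrow> 'a \<Rightarrow> real" and \<omega>
      by (simp only: steps_integral_def step_integral_def s t prod.case comb[of "\<lambda>u v. Y v \<omega> - Y u \<omega>"])
  qed
qed

text \<open>This is the only property of a process on which the construction of its Wiener integral
  rests. It also holds, with \<open>C = 1\<close>, for the indicators of \<open>{a<..t}\<close> under Lebesgue measure,
  whose elementary integrals are the step functions themselves.\<close>

definition isometric_increments :: "'a measure \<Rightarrow> (real \<Rightarrow> 'a \<Rightarrow> real) \<Rightarrow> real \<Rightarrow> real \<Rightarrow> real \<Rightarrow> bool" where
  "isometric_increments N Y a b C \<longleftrightarrow> (\<forall>s\<in>{a..b}. \<forall>t\<in>{a..b}.
     square_integrable N (\<lambda>\<omega>. Y t \<omega> - Y s \<omega>) \<and> (LINT \<omega>|N. (Y t \<omega> - Y s \<omega>)\<^sup>2) = C * \<bar>t - s\<bar>)"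

text \<open>By polarisation: \<open>(p - q) (r - s)\<close> is half of
  \<open>(p - s)\<^sup>2 + (q - r)\<^sup>2 - (p - r)\<^sup>2 - (q - s)\<^sup>2\<close>.\<close>

lemma isometric_increments_inner:
  assumes Y: "isometric_increments N Y a b C" and "u \<in> {a..b}" "v \<in> {a..b}" "u' \<in> {a..b}" "v' \<in> {a..b}"
  shows "(LINT \<omega>|N. (Y v \<omega> - Y u \<omega>) * (Y v' \<omega> - Y u' \<omega>))
    = C * (\<bar>v - u'\<bar> + \<bar>u - v'\<bar> - \<bar>v - v'\<bar> - \<bar>u - u'\<bar>) / 2"
proof -
  have pol: "(p - q) * (r - s) = (1/2) * (p - s)\<^sup>2 + (1/2) * (q - r)\<^sup>2 - (1/2) * (p - r)\<^sup>2 - (1/2) * (q - s)\<^sup>2"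
    for p q r s :: real by (simp add: power2_eq_square algebra_simps)
  have i: "integrable N (\<lambda>\<omega>. (Y t \<omega> - Y s \<omega>)\<^sup>2)" "(LINT \<omega>|N. (Y t \<omega> - Y s \<omega>)\<^sup>2) = C * \<bar>t - s\<bar>"
    if "s \<in> {a..b}" "t \<in> {a..b}" for s t
    using Y that unfolding isometric_increments_def square_integrable_def by blast+
  show ?thesis
    unfolding pol using assms i
    by (simp add: algebra_simps)
qed

lemma square_integrable_steps_integral:
  assumes "isometric_increments N Y a b C" "\<sigma> \<in> steps_on a b"
  shows "square_integrable N (steps_integral Y \<sigma>)"
proof -
  obtain n c u v where s: "\<sigma> = (n, c, u, v)" by (metis prod_cases4)
  have "square_integrable N (\<lambda>\<omega>. Y (v i) \<omega> - Y (u i) \<omega>)" if "i < n" for i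
    using assms that unfolding isometric_increments_def s steps_on_def by (auto dest!: spec[of _ i])
  then show ?thesis
    unfolding s steps_integral_def step_integral_def by (auto intro!: square_integrable_sum)
qed

lemma steps_integral_square:
  assumes Y: "isometric_increments N Y a b C" and \<sigma>: "(n, c, u, v) \<in> steps_on a b"
  shows "(LINT \<omega>|N. (steps_integral Y (n, c, u, v) \<omega>)\<^sup>2) = C * (\<Sum>i<n. \<Sum>j<n. c i * c j *
     ((\<bar>v i - u j\<bar> + \<bar>u i - v j\<bar> - \<bar>v i - v j\<bar> - \<bar>u i - u j\<bar>) / 2))"
proof -
  have uv: "u i \<in> {a..b}" "v i \<in> {a..b}" if "i < n" for i
    using \<sigma> that by (auto simp: steps_on_def dest!: spec[of _ i])
  have si: "square_integrable N (\<lambda>\<omega>. Y (v i) \<omega> - Y (u i) \<omega>)" if "i < n" for i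
    using Y uv[OF that] unfolding isometric_increments_def by blast
  let ?D = "\<lambda>i \<omega>. Y (v i) \<omega> - Y (u i) \<omega>"
  have int: "integrable N (\<lambda>\<omega>. c i * c j * (?D i \<omega> * ?D j \<omega>))" if "i < n" "j < n" for i j
    using square_integrable_mult[OF si[OF that(1)] si[OF that(2)]] by simp
  have "(LINT \<omega>|N. (steps_integral Y (n, c, u, v) \<omega>)\<^sup>2) =
      (LINT \<omega>|N. (\<Sum>i<n. \<Sum>j<n. c i * c j * (?D i \<omega> * ?D j \<omega>)))"
    by (simp add: steps_integral_def step_integral_def power2_eq_square sum_product mult_ac)
  also have "\<dots> = (\<Sum>i<n. \<Sum>j<n. c i * c j * (LINT \<omega>|N. ?D i \<omega> * ?D j \<omega>))"
  proof -
    have "(LINT \<omega>|N. (\<Sum>i<n. \<Sum>j<n. c i * c j * (?D i \<omega> * ?D j \<omega>)))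
      = (\<Sum>i<n. LINT \<omega>|N. (\<Sum>j<n. c i * c j * (?D i \<omega> * ?D j \<omega>)))"
      by (rule Bochner_Integration.integral_sum) (auto intro!: Bochner_Integration.integrable_sum int simp del: integrable_mult_right_iff)
    also have "\<dots> = (\<Sum>i<n. \<Sum>j<n. LINT \<omega>|N. c i * c j * (?D i \<omega> * ?D j \<omega>))"
      by (intro sum.cong refl Bochner_Integration.integral_sum int) auto
    finally show ?thesis by simp
  qed
  also have "\<dots> = (\<Sum>i<n. \<Sum>j<n. c i * c j *
      (C * (\<bar>v i - u j\<bar> + \<bar>u i - v j\<bar> - \<bar>v i - v j\<bar> - \<bar>u i - u j\<bar>) / 2))"
    by (intro sum.cong refl arg_cong2[of _ _ _ _ "(*)"] isometric_increments_inner[OF Y] uv) auto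
  finally show ?thesis by (simp add: sum_distrib_left mult_ac)
qed

lemma finite_measure_lebesgue_on_Icc: "finite_measure (lebesgue_on {a..b::real})"
  by (rule finite_measure_lebesgue_on) simp

lemma isometric_increments_indicator:
  "isometric_increments (lebesgue_on {a..b}) (\<lambda>t s. indicator {a<..t} s) a b 1"
  unfolding isometric_increments_def
proof (intro ballI)
  fix s t :: real assume st: "s \<in> {a..b}" "t \<in> {a..b}"
  let ?A = "{min s t<..max s t}"
  have [measurable]: "?A \<in> sets (lebesgue_on {a..b})"
    using st by (auto simp: sets_restrict_space_iff)
  have sq: "(indicator {a<..t} x - indicator {a<..s} x)\<^sup>2 = (indicator ?A x :: real)" if "x \<in> {a..b}" for x
    using st that by (auto simp: indicator_def)
  have meas: "(\<lambda>x. indicator {a<..t} x - indicator {a<..s} x :: real) \<in> borel_measurable (lebesgue_on {a..b})"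
    by (intro borel_measurable_diff borel_measurable_indicator) (use st in \<open>auto simp: sets_restrict_space_iff\<close>)
  have "integrable (lebesgue_on {a..b}) (\<lambda>x. (indicator {a<..t} x - indicator {a<..s} x :: real)\<^sup>2)
     \<longleftrightarrow> integrable (lebesgue_on {a..b}) (indicator ?A :: real \<Rightarrow> real)"
    by (rule Bochner_Integration.integrable_cong) (auto simp: sq)
  moreover have "integrable (lebesgue_on {a..b}) (indicator ?A :: real \<Rightarrow> real)"
    using finite_measure.emeasure_finite[OF finite_measure_lebesgue_on_Icc]
    by (intro integrable_real_indicator) (auto simp: less_top[symmetric])
  moreover have "(LINT x|lebesgue_on {a..b}. (indicator {a<..t} x - indicator {a<..s} x :: real)\<^sup>2)
     = (LINT x|lebesgue_on {a..b}. indicator ?A x)"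
    by (rule Bochner_Integration.integral_cong) (auto simp: sq)
  moreover have "\<dots> = measure (lebesgue_on {a..b}) (?A \<inter> {a..b})" by (simp add: space_restrict_space)
  moreover have "?A \<inter> {a..b} = ?A" using st by auto
  moreover have "measure (lebesgue_on {a..b}) ?A = \<bar>t - s\<bar>"
    using st by (subst measure_restrict_space) auto
  ultimately show "square_integrable (lebesgue_on {a..b}) (\<lambda>x. indicator {a<..t} x - indicator {a<..s} x) \<and>
      (LINT x|lebesgue_on {a..b}. (indicator {a<..t} x - indicator {a<..s} x)\<^sup>2) = 1 * \<bar>t - s\<bar>"
    using meas by (simp add: square_integrable_def)
qed

lemma steps_integral_indicator:
  assumes "\<sigma> \<in> steps_on a b"
  shows "steps_integral (\<lambda>t s. indicator {a<..t} s) \<sigma> = steps_fun \<sigma>"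
proof -
  obtain n c u v where s: "\<sigma> = (n, c, u, v)" by (metis prod_cases4)
  have "indicator {a<..v i} x - indicator {a<..u i} x = (indicator {u i<..v i} x :: real)" if "i < n" for i x
    using assms that unfolding s steps_on_def by (auto simp: indicator_def dest!: spec[of _ i])
  then show ?thesis
    by (intro ext) (simp add: s steps_integral_def step_integral_def steps_fun_def step_fun_def)
qed

lemma square_integrable_steps_fun:
  "\<sigma> \<in> steps_on a b \<Longrightarrow> square_integrable (lebesgue_on {a..b}) (steps_fun \<sigma>)"
  using square_integrable_steps_integral[OF isometric_increments_indicator, of \<sigma> a b]
  by (simp add: steps_integral_indicator)

text \<open>The isometry is obtained by comparison: both sides are the same quadratic form in the
  heights, because both processes have the same second moments of increments up to \<open>C\<close>.\<close>

lemma steps_isometry: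
  assumes "isometric_increments N Y a b C" "\<sigma> \<in> steps_on a b"
  shows "(LINT \<omega>|N. (steps_integral Y \<sigma> \<omega>)\<^sup>2) = C * (LINT s|lebesgue_on {a..b}. (steps_fun \<sigma> s)\<^sup>2)"
proof -
  obtain n c u v where s: "\<sigma> = (n, c, u, v)" by (metis prod_cases4)
  show ?thesis
    using steps_integral_square[OF assms(1), of n c u v]
      steps_integral_square[OF isometric_increments_indicator, of n c u v a b]
      steps_integral_indicator[OF assms(2)] assms(2)
    by (simp add: s)
qed

lemma steps_isometry_diff:
  fixes Y :: "real \<Rightarrow> 'a \<Rightarrow> real"
  assumes Y: "isometric_increments N Y a b C" and "\<sigma> \<in> steps_on a b" "\<tau> \<in> steps_on a b"
  shows "(LINT \<omega>|N. (steps_integral Y \<sigma> \<omega> - steps_integral Y \<tau> \<omega>)\<^sup>2)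
    = C * (LINT s|lebesgue_on {a..b}. (steps_fun \<sigma> s - steps_fun \<tau> s)\<^sup>2)"
proof -
  obtain \<rho> where \<rho>: "\<rho> \<in> steps_on a b" "\<And>s. steps_fun \<rho> s = 1 * steps_fun \<sigma> s + (-1) * steps_fun \<tau> s"
    "\<And>(Y :: real \<Rightarrow> 'a \<Rightarrow> real) \<omega>. steps_integral Y \<rho> \<omega> = 1 * steps_integral Y \<sigma> \<omega> + (-1) * steps_integral Y \<tau> \<omega>"
    using steps_linear[OF assms(2,3), of 1 "-1" thesis] by blast
  show ?thesis using steps_isometry[OF Y \<rho>(1)] by (simp add: \<rho>(2,3))
qed

text \<open>The positive and the negative part of \<open>D\<close> are densities of finite measures with the same
  distribution function, hence of the same measure on Borel sets. Such a measure is carried by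
  both \<open>{D > 0}\<close> and \<open>{D \<le> 0}\<close>; these sets are made Borel by passing to a Borel version of \<open>D\<close>.\<close>

lemma AE_zero_if_integral_Ioc_zero:
  fixes D :: "real \<Rightarrow> real"
  assumes D: "integrable (lebesgue_on {a..b}) D"
    and zero: "\<And>t. t \<in> {a..b} \<Longrightarrow> (LINT s|lebesgue_on {a..b}. D s * indicator {a<..t} s) = 0"
  shows "AE s in lebesgue_on {a..b}. D s = 0"
proof -
  let ?L = "lebesgue_on {a..b}"
  have [measurable]: "D \<in> borel_measurable ?L" using D by simp
  have id [measurable]: "(\<lambda>x. x) \<in> measurable ?L borel"
    by (intro measurable_restrict_space1 measurable_completion) simp
  define P where "P x = max 0 (D x)" for x
  define Q where "Q x = max 0 (- D x)" for x
  have [measurable]: "P \<in> borel_measurable ?L" "Q \<in> borel_measurable ?L" unfolding P_def Q_def by measurable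
  have iP: "integrable ?L P" "integrable ?L Q" unfolding P_def Q_def using D by (auto intro!: integrable_max)
  have DPQ: "D x = P x - Q x" for x by (simp add: P_def Q_def)
  have nn: "0 \<le> P x" "0 \<le> Q x" for x by (auto simp: P_def Q_def)
  define MP where "MP = distr (density ?L (\<lambda>x. ennreal (P x))) borel (\<lambda>x. x)"
  define MQ where "MQ = distr (density ?L (\<lambda>x. ennreal (Q x))) borel (\<lambda>x. x)"
  have fin: "finite_borel_measure (distr (density ?L (\<lambda>x. ennreal (R x))) borel (\<lambda>x. x))"
    and meas: "A \<in> sets borel \<Longrightarrow> measure (distr (density ?L (\<lambda>x. ennreal (R x))) borel (\<lambda>x. x)) A = (LINT x|?L. R x * indicator A x)"
    if iR: "integrable ?L R" and R0: "\<And>x. 0 \<le> R x" for R A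
  proof -
    have [measurable]: "R \<in> borel_measurable ?L" using iR by simp
    have "finite_measure (density ?L (\<lambda>x. ennreal (R x)))"
    proof (rule finite_measureI)
      have "(\<integral>\<^sup>+x. ennreal (R x) * indicator {a..b} x \<partial>?L) = (\<integral>\<^sup>+x. ennreal (R x) \<partial>?L)"
        by (rule nn_integral_cong) (auto simp: indicator_def)
      then show "emeasure (density ?L (\<lambda>x. ennreal (R x))) (space (density ?L (\<lambda>x. ennreal (R x)))) \<noteq> \<infinity>"
        using nn_integral_eq_integral[OF iR] R0 by (simp add: emeasure_density)
    qed
    then have "finite_measure (distr (density ?L (\<lambda>x. ennreal (R x))) borel (\<lambda>x. x))"
      by (rule finite_measure.finite_measure_distr) simp
    then show "finite_borel_measure (distr (density ?L (\<lambda>x. ennreal (R x))) borel (\<lambda>x. x))"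
      by (simp add: finite_borel_measure_def finite_borel_measure_axioms_def)
    assume [measurable]: "A \<in> sets borel"
    have "measure (distr (density ?L (\<lambda>x. ennreal (R x))) borel (\<lambda>x. x)) A
       = (LINT x|distr (density ?L (\<lambda>x. ennreal (R x))) borel (\<lambda>x. x). indicator A x)" by simp
    also have "\<dots> = (LINT x|density ?L (\<lambda>x. ennreal (R x)). indicator A x)"
      by (rule integral_distr) auto
    also have "\<dots> = (LINT x|?L. R x * indicator A x)"
      using R0 by (subst integral_density) auto
    finally show "measure (distr (density ?L (\<lambda>x. ennreal (R x))) borel (\<lambda>x. x)) A = (LINT x|?L. R x * indicator A x)" .
  qed
  have iPA: "integrable ?L (\<lambda>x. P x * indicator A x)" "integrable ?L (\<lambda>x. Q x * indicator A x)"
    if [measurable]: "A \<in> sets borel" for A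
    by (rule Bochner_Integration.integrable_bound[OF iP(1)]; auto simp: indicator_def)
      (rule Bochner_Integration.integrable_bound[OF iP(2)]; auto simp: indicator_def)
  have PQ: "(LINT x|?L. P x * indicator A x) - (LINT x|?L. Q x * indicator A x) = (LINT x|?L. D x * indicator A x)"
    if "A \<in> sets borel" for A
    using iPA[OF that] by (simp add: DPQ left_diff_distrib)
  have "MP = MQ"
  proof (rule cdf_unique')
    show "finite_borel_measure MP" "finite_borel_measure MQ" using fin iP nn by (auto simp: MP_def MQ_def)
    show "cdf MP = cdf MQ"
    proof
      fix x
      have "(LINT s|?L. D s * indicator {..x} s) = 0"
      proof (cases "x < a")
        case True
        have "(LINT s|?L. D s * indicator {..x} s) = (LINT s|?L. 0)"
          by (rule Bochner_Integration.integral_cong) (use True in \<open>auto simp: indicator_def space_restrict_space\<close>)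
        then show ?thesis by simp
      next
        case False
        show ?thesis
        proof (cases "a \<le> b")
          case True
          have "AE s in ?L. s \<noteq> a"
          proof (rule AE_I')
            show "{a} \<in> null_sets ?L" using True by (auto simp: null_sets_restrict_space)
          qed auto
          then have "(LINT s|?L. D s * indicator {..x} s) = (LINT s|?L. D s * indicator {a<..min x b} s)"
          proof (intro integral_cong_AE)
            show "AE s in ?L. D s * indicator {..x} s = D s * indicator {a<..min x b} s" if "AE s in ?L. s \<noteq> a"
              using that AE_space by eventually_elim (auto simp: indicator_def space_restrict_space)
          qed auto
          also have "\<dots> = 0" using zero[of "min x b"] False True by auto
          finally show ?thesis .
        next
          case F: False
          have "(LINT s|?L. D s * indicator {..x} s) = (LINT s|?L. 0)"
            by (rule Bochner_Integration.integral_cong) (use F in \<open>auto simp: space_restrict_space\<close>)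
          then show ?thesis by simp
        qed
      qed
      then show "cdf MP x = cdf MQ x"
        using meas[OF iP(1) nn(1), of "{..x}"] meas[OF iP(2) nn(2), of "{..x}"] PQ[of "{..x}"]
        by (simp add: cdf_def MP_def MQ_def)
    qed
  qed
  then have null: "(LINT x|?L. D x * indicator A x) = 0" if "A \<in> sets borel" for A
    using meas[OF iP(1) nn(1) that] meas[OF iP(2) nn(2) that] PQ[OF that] by (simp add: MP_def MQ_def)
  have "(\<lambda>x. indicator {a..b} x *\<^sub>R D x) \<in> borel_measurable lebesgue"
    by (subst borel_measurable_restrict_space_iff[symmetric]) auto
  then obtain E where E [measurable]: "E \<in> borel_measurable lborel" and
    DE: "AE x in lborel. indicator {a..b} x *\<^sub>R D x = E x"
    using completion_ex_borel_measurable_real by blast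
  have "AE x in lebesgue. indicator {a..b} x *\<^sub>R D x = E x" using DE by (rule AE_completion)
  then have DE': "AE x in ?L. D x = E x"
    by (subst AE_restrict_space_iff) (auto elim!: eventually_mono simp: indicator_def)
  let ?A = "{x. E x > 0}"
  have [measurable]: "?A \<in> sets borel" using E by simp
  have "(LINT x|?L. P x) = (LINT x|?L. D x * indicator ?A x)"
    using DE' by (intro integral_cong_AE) (auto simp: P_def indicator_def elim!: eventually_mono)
  then have P0: "(LINT x|?L. P x) = 0" using null by simp
  have "(LINT x|?L. Q x) = 0"
    using PQ[of UNIV] null[of UNIV] P0 by simp
  then have "AE x in ?L. P x = 0" "AE x in ?L. Q x = 0"
    using P0 integral_nonneg_eq_0_iff_AE[OF iP(1)] integral_nonneg_eq_0_iff_AE[OF iP(2)] nn by auto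
  then show ?thesis by eventually_elim (simp add: DPQ)
qed


text \<open>Step functions are dense in \<open>L\<^sup>2[a,b]\<close>: the projection of \<open>g\<close> to their closure differs
  from \<open>g\<close> by a function that is orthogonal to all intervals.\<close>

lemma steps_dense:
  assumes g: "L2_on a b g"
  obtains \<sigma> where "\<And>k. \<sigma> k \<in> steps_on a b" "L2_tendsto (lebesgue_on {a..b}) (\<lambda>k. steps_fun (\<sigma> k)) g"
proof -
  let ?L = "lebesgue_on {a..b}"
  have si_g: "square_integrable ?L g" using g by (simp add: L2_on_def square_integrable_def)
  let ?V = "steps_fun ` steps_on a b"
  have zero: "(\<lambda>_. 0) \<in> ?V"
    by (rule image_eqI[of _ _ "(0, \<lambda>_. 0, \<lambda>_. 0, \<lambda>_. 0)"]) (auto simp: steps_fun_def step_fun_def steps_on_def)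
  have lin: "(\<lambda>x. \<alpha> * A x + \<beta> * B x) \<in> ?V" if AB: "A \<in> ?V" "B \<in> ?V" for A B \<alpha> \<beta>
  proof -
    obtain \<sigma> \<tau> where st: "\<sigma> \<in> steps_on a b" "\<tau> \<in> steps_on a b" "A = steps_fun \<sigma>" "B = steps_fun \<tau>"
      using AB by auto
    obtain \<rho> where "\<rho> \<in> steps_on a b" "\<And>s. steps_fun \<rho> s = \<alpha> * steps_fun \<sigma> s + \<beta> * steps_fun \<tau> s"
      using steps_linear[OF st(1,2), of \<alpha> \<beta> thesis] by blast
    then show ?thesis by (auto simp: st intro!: image_eqI[of _ _ \<rho>])
  qed
  have siV: "square_integrable ?L A" if "A \<in> ?V" for A using that square_integrable_steps_fun by auto
  obtain Z W where ZW: "L2_tendsto ?L W Z" "\<And>n. W n \<in> ?V"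
    "\<And>A. A \<in> ?V \<Longrightarrow> (LINT s|?L. g s * A s) = (LINT s|?L. Z s * A s)"
  proof (rule L2_Riesz[where V = ?V and l = "\<lambda>A. LINT s|?L. g s * A s" and C = "LINT s|?L. (g s)\<^sup>2" and M = ?L])
    show "finite_measure ?L" by (rule finite_measure_lebesgue_on_Icc)
    show "(LINT s|?L. g s * (\<alpha> * A s + \<beta> * B s)) = \<alpha> * (LINT s|?L. g s * A s) + \<beta> * (LINT s|?L. g s * B s)"
      if AB: "A \<in> ?V" "B \<in> ?V" for A B \<alpha> \<beta>
      using square_integrable_mult[OF si_g siV[OF AB(1)]] square_integrable_mult[OF si_g siV[OF AB(2)]]
      by (simp add: distrib_left mult.left_commute[of _ \<alpha>] mult.left_commute[of _ \<beta>])
    show "(LINT s|?L. g s * A s)\<^sup>2 \<le> (LINT s|?L. (g s)\<^sup>2) * (LINT s|?L. (A s)\<^sup>2)" if "A \<in> ?V" for A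
      by (rule integral_Cauchy_Schwarz[OF si_g siV[OF that]])
  qed (use zero lin siV in auto)
  have siZ: "square_integrable ?L Z" using ZW(1) L2_tendstoD(2) by blast
  have "AE s in ?L. g s - Z s = 0"
  proof (rule AE_zero_if_integral_Ioc_zero)
    show "integrable ?L (\<lambda>s. g s - Z s)"
      by (rule square_integrable_integrable[OF finite_measure_lebesgue_on_Icc square_integrable_diff[OF si_g siZ]])
    fix t assume t: "t \<in> {a..b}"
    have A: "(\<lambda>s. indicator {a<..t} s) \<in> ?V"
      by (rule image_eqI[of _ _ "(1, \<lambda>_. 1, \<lambda>_. a, \<lambda>_. t)"])
        (use t in \<open>auto simp: steps_fun_def step_fun_def steps_on_def\<close>)
    show "(LINT s|?L. (g s - Z s) * indicator {a<..t} s) = 0"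
      using ZW(3)[OF A] square_integrable_mult[OF si_g siV[OF A]] square_integrable_mult[OF siZ siV[OF A]]
      by (simp add: left_diff_distrib)
  qed
  then have eq: "(LINT s|?L. (W k s - g s)\<^sup>2) = (LINT s|?L. (W k s - Z s)\<^sup>2)" for k
    using siV[OF ZW(2)[of k]] si_g siZ
    by (intro integral_cong_AE) (auto elim!: eventually_mono simp: square_integrable_def)
  have "L2_tendsto ?L W g"
    using ZW(1) si_g unfolding L2_tendsto_def eq by blast
  moreover have "\<forall>k. \<exists>\<sigma>. \<sigma> \<in> steps_on a b \<and> W k = steps_fun \<sigma>" using ZW(2) by blast
  from choice[OF this] obtain \<sigma> where \<sigma>: "\<And>k. \<sigma> k \<in> steps_on a b" "\<And>k. W k = steps_fun (\<sigma> k)" by blast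
  moreover have "W = (\<lambda>k. steps_fun (\<sigma> k))" using \<sigma>(2) by blast
  ultimately show ?thesis using that[of \<sigma>] by blast
qed

lemma steps_integral_convergent:
  assumes "finite_measure N" and Y: "isometric_increments N Y a b C"
    and \<sigma>: "\<And>k. \<sigma> k \<in> steps_on a b" and g: "L2_tendsto (lebesgue_on {a..b}) (\<lambda>k. steps_fun (\<sigma> k)) g"
  obtains I where "L2_tendsto N (\<lambda>k. steps_integral Y (\<sigma> k)) I"
proof (rule L2_complete[OF assms(1) square_integrable_steps_integral[OF Y \<sigma>]])
  let ?L = "lebesgue_on {a..b}"
  note l = L2_tendstoD[OF g]
  fix e :: real assume e: "e > 0"
  define c where "c = 4 * \<bar>C\<bar> + 1"
  have c: "c > 0" by (simp add: c_def)
  obtain K where K: "\<And>k. k \<ge> K \<Longrightarrow> (LINT s|?L. (steps_fun (\<sigma> k) s - g s)\<^sup>2) < e / c"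
    using order_tendstoD(2)[OF l(3), of "e / c"] e c by (auto simp: eventually_sequentially)
  have "(LINT x|N. (steps_integral Y (\<sigma> i) x - steps_integral Y (\<sigma> j) x)\<^sup>2) \<le> e" if "i \<ge> K" "j \<ge> K" for i j
  proof -
    have "(LINT s|?L. (steps_fun (\<sigma> i) s - steps_fun (\<sigma> j) s)\<^sup>2) \<le>
      2 * (LINT s|?L. (steps_fun (\<sigma> i) s - g s)\<^sup>2) + 2 * (LINT s|?L. (g s - steps_fun (\<sigma> j) s)\<^sup>2)"
      by (rule integral_square_diff_le) (use l in auto)
    also have "(LINT s|?L. (g s - steps_fun (\<sigma> j) s)\<^sup>2) = (LINT s|?L. (steps_fun (\<sigma> j) s - g s)\<^sup>2)"
      by (simp add: power2_commute)
    finally have d: "(LINT s|?L. (steps_fun (\<sigma> i) s - steps_fun (\<sigma> j) s)\<^sup>2) \<le> 4 * (e / c)"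
      using K[OF that(1)] K[OF that(2)] by linarith
    have "(LINT x|N. (steps_integral Y (\<sigma> i) x - steps_integral Y (\<sigma> j) x)\<^sup>2)
        = C * (LINT s|?L. (steps_fun (\<sigma> i) s - steps_fun (\<sigma> j) s)\<^sup>2)"
      by (rule steps_isometry_diff[OF Y \<sigma> \<sigma>])
    also have "\<dots> \<le> \<bar>C\<bar> * (LINT s|?L. (steps_fun (\<sigma> i) s - steps_fun (\<sigma> j) s)\<^sup>2)"
      by (intro mult_right_mono) auto
    also have "\<dots> \<le> \<bar>C\<bar> * (4 * (e / c))" by (intro mult_left_mono d) auto
    also have "\<dots> = e * ((4 * \<bar>C\<bar>) / c)" by simp
    also have "\<dots> \<le> e * 1" using e c by (intro mult_left_mono) (auto simp: c_def)
    finally show ?thesis by simp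
  qed
  then show "\<exists>K. \<forall>i\<ge>K. \<forall>j\<ge>K. (LINT x|N. (steps_integral Y (\<sigma> i) x - steps_integral Y (\<sigma> j) x)\<^sup>2) \<le> e" by blast
qed (use that in blast)

text \<open>Versions of the Wiener integral are defined by a closure. Sequences carry limits of moments
  and of sums, and the same sequence of step functions must serve for \<open>g\<close> and for \<open>I\<close>.\<close>

lemma is_wiener_integral_imp_steps:
  assumes Y: "isometric_increments N Y a b C" and I: "is_wiener_integral N Y a b g I"
    and g: "L2_on a b g"
  obtains \<sigma> where "\<And>k. \<sigma> k \<in> steps_on a b"
    "L2_tendsto (lebesgue_on {a..b}) (\<lambda>k. steps_fun (\<sigma> k)) g"
    "L2_tendsto N (\<lambda>k. steps_integral Y (\<sigma> k)) I"
proof -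
  let ?L = "lebesgue_on {a..b}"
  have si_g: "square_integrable ?L g" using g by (simp add: L2_on_def square_integrable_def)
  have Im: "I \<in> borel_measurable N" using I by (simp add: is_wiener_integral_def)
  have "\<exists>\<sigma>\<in>steps_on a b. (LINT s|?L. (steps_fun \<sigma> s - g s)\<^sup>2) < e \<and>
      square_integrable N (\<lambda>\<omega>. I \<omega> - steps_integral Y \<sigma> \<omega>) \<and> (LINT \<omega>|N. (I \<omega> - steps_integral Y \<sigma> \<omega>)\<^sup>2) < e"
    if e: "e > 0" for e
  proof -
    obtain n c u v where *: "\<forall>i<n. a \<le> u i \<and> u i \<le> v i \<and> v i \<le> b"
      "(\<integral>\<^sup>+s. ennreal ((g s - step_fun n c u v s)\<^sup>2) \<partial>?L) < ennreal e"
      "(\<integral>\<^sup>+\<omega>. ennreal ((I \<omega> - step_integral Y n c u v \<omega>)\<^sup>2) \<partial>N) < ennreal e"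
      using I e unfolding is_wiener_integral_def by blast
    define \<sigma> where "\<sigma> = (n, c, u, v)"
    have \<sigma>: "\<sigma> \<in> steps_on a b" using * by (auto simp: \<sigma>_def steps_on_def)
    have f: "step_fun n c u v = steps_fun \<sigma>" "step_integral Y n c u v = steps_integral Y \<sigma>"
      by (auto simp: \<sigma>_def steps_fun_def steps_integral_def)
    note m = square_integrable_measurable[OF square_integrable_steps_fun[OF \<sigma>]]
      square_integrable_measurable[OF square_integrable_steps_integral[OF Y \<sigma>]]
    have "(LINT s|?L. (g s - steps_fun \<sigma> s)\<^sup>2) < e"
      by (rule square_integrable_nn_integral) (use * m square_integrable_measurable[OF si_g] in \<open>auto simp: f\<close>)
    moreover have "square_integrable N (\<lambda>\<omega>. I \<omega> - steps_integral Y \<sigma> \<omega>) \<and> (LINT \<omega>|N. (I \<omega> - steps_integral Y \<sigma> \<omega>)\<^sup>2) < e"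
      using square_integrable_nn_integral[of "\<lambda>\<omega>. I \<omega> - steps_integral Y \<sigma> \<omega>" N e] * m Im by (auto simp: f)
    ultimately show ?thesis using \<sigma> by (auto simp: power2_commute intro!: bexI[of _ \<sigma>])
  qed
  then have "\<forall>k. \<exists>\<sigma>. \<sigma> \<in> steps_on a b \<and> (LINT s|?L. (steps_fun \<sigma> s - g s)\<^sup>2) < 1 / (real k + 1) \<and>
      square_integrable N (\<lambda>\<omega>. I \<omega> - steps_integral Y \<sigma> \<omega>) \<and> (LINT \<omega>|N. (I \<omega> - steps_integral Y \<sigma> \<omega>)\<^sup>2) < 1 / (real k + 1)"
    by (meson add_nonneg_pos of_nat_0_le_iff zero_less_divide_1_iff zero_less_one)
  from choice[OF this] obtain \<sigma> where \<sigma>: "\<And>k. \<sigma> k \<in> steps_on a b"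
    "\<And>k. (LINT s|?L. (steps_fun (\<sigma> k) s - g s)\<^sup>2) < 1 / (real k + 1)"
    "\<And>k. square_integrable N (\<lambda>\<omega>. I \<omega> - steps_integral Y (\<sigma> k) \<omega>)"
    "\<And>k. (LINT \<omega>|N. (I \<omega> - steps_integral Y (\<sigma> k) \<omega>)\<^sup>2) < 1 / (real k + 1)" by blast
  note lim = inverse_Suc_tendsto_zero
  have siS: "square_integrable N (steps_integral Y (\<sigma> k))" for k
    by (rule square_integrable_steps_integral[OF Y \<sigma>(1)])
  have siI: "square_integrable N I" using square_integrable_add[OF \<sigma>(3) siS, of 0 0] by simp
  have "(\<lambda>k. LINT s|?L. (steps_fun (\<sigma> k) s - g s)\<^sup>2) \<longlonglongrightarrow> 0"
    by (rule tendsto_sandwich[OF _ _ tendsto_const lim]) (use \<sigma>(2) in \<open>auto intro!: always_eventually less_imp_le\<close>)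
  moreover have "(\<lambda>k. LINT \<omega>|N. (steps_integral Y (\<sigma> k) \<omega> - I \<omega>)\<^sup>2) \<longlonglongrightarrow> 0"
    by (rule tendsto_sandwich[OF _ _ tendsto_const lim])
      (use \<sigma>(4) in \<open>auto intro!: always_eventually less_imp_le simp: power2_commute[of _ "I _"]\<close>)
  ultimately show ?thesis
    using \<sigma>(1) siS siI si_g square_integrable_steps_fun[OF \<sigma>(1)] that[of \<sigma>] by (simp add: L2_tendsto_def)
qed

lemma is_wiener_integralI:
  assumes \<sigma>: "\<And>k. \<sigma> k \<in> steps_on a b"
    and g: "L2_tendsto (lebesgue_on {a..b}) (\<lambda>k. steps_fun (\<sigma> k)) g"
    and I: "L2_tendsto N (\<lambda>k. steps_integral Y (\<sigma> k)) I"
  shows "is_wiener_integral N Y a b g I"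
  unfolding is_wiener_integral_def
proof (intro conjI allI impI)
  note lg = L2_tendstoD[OF g] and lI = L2_tendstoD[OF I]
  show "I \<in> borel_measurable N" by (rule square_integrable_measurable[OF lI(2)])
  fix e :: real assume e: "e > 0"
  have "\<forall>\<^sub>F k in sequentially. (LINT s|lebesgue_on {a..b}. (steps_fun (\<sigma> k) s - g s)\<^sup>2) < e \<and>
      (LINT \<omega>|N. (steps_integral Y (\<sigma> k) \<omega> - I \<omega>)\<^sup>2) < e"
    using order_tendstoD(2)[OF lg(3) e] order_tendstoD(2)[OF lI(3) e] by (rule eventually_conj)
  then obtain k where k: "(LINT s|lebesgue_on {a..b}. (steps_fun (\<sigma> k) s - g s)\<^sup>2) < e"
      "(LINT \<omega>|N. (steps_integral Y (\<sigma> k) \<omega> - I \<omega>)\<^sup>2) < e"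
    using eventually_happens by force
  obtain n c u v where s: "\<sigma> k = (n, c, u, v)" by (metis prod_cases4)
  have f: "steps_fun (\<sigma> k) = step_fun n c u v" "steps_integral Y (\<sigma> k) = step_integral Y n c u v"
    by (auto simp: s steps_fun_def steps_integral_def)
  have "(\<integral>\<^sup>+s. ennreal ((g s - step_fun n c u v s)\<^sup>2) \<partial>lebesgue_on {a..b}) < ennreal e"
    using lg(1)[of k] lg(2) k(1) unfolding f
    by (intro nn_integral_square_less) (auto simp: power2_commute)
  moreover have "(\<integral>\<^sup>+\<omega>. ennreal ((I \<omega> - step_integral Y n c u v \<omega>)\<^sup>2) \<partial>N) < ennreal e"
    using lI(1)[of k] lI(2) k(2) unfolding f
    by (intro nn_integral_square_less) (auto simp: power2_commute)
  moreover have "\<forall>i<n. a \<le> u i \<and> u i \<le> v i \<and> v i \<le> b"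
    using \<sigma>[of k] by (simp add: s steps_on_def)
  ultimately show "\<exists>n c u v. (\<forall>i<n. a \<le> u i \<and> u i \<le> v i \<and> v i \<le> b) \<and>
        (\<integral>\<^sup>+s. ennreal ((g s - step_fun n c u v s)\<^sup>2) \<partial>lebesgue_on {a..b}) < ennreal e \<and>
        (\<integral>\<^sup>+\<omega>. ennreal ((I \<omega> - step_integral Y n c u v \<omega>)\<^sup>2) \<partial>N) < ennreal e" by blast
qed

section \<open>Brownian motion and the Slepian process\<close>

lemma (in prob_space) centred_normal_moments:
  assumes "distributed M lborel X (normal_density 0 \<sigma>)" "\<sigma> > 0"
  shows "square_integrable M X" "(LINT x|M. (X x)\<^sup>2) = \<sigma>\<^sup>2"
    "(CLINT x|M. iexp (u * X x)) = exp (of_real (- (u\<^sup>2 * \<sigma>\<^sup>2) / 2))"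
proof -
  have [measurable]: "X \<in> borel_measurable M" using distributed_measurable[OF assms(1)] by simp
  have "integrable lborel (\<lambda>x. normal_density 0 \<sigma> x * x\<^sup>2)"
    using integrable_normal_moment[OF assms(2), of 0 2] by simp
  then have "integrable M (\<lambda>x. (X x)\<^sup>2)"
    using distributed_integrable[OF assms(1), of "\<lambda>x. x\<^sup>2"] by simp
  then show "square_integrable M X" by (simp add: square_integrable_def)
  have "(LINT x|M. (X x)\<^sup>2) = (LINT x|lborel. normal_density 0 \<sigma> x * x\<^sup>2)"
    using distributed_integral[OF assms(1), of "\<lambda>x. x\<^sup>2"] by simp
  also have "\<dots> = \<sigma>\<^sup>2"
    using integral_normal_moment_even[OF assms(2), of 0 1] assms(2) by simp
  finally show "(LINT x|M. (X x)\<^sup>2) = \<sigma>\<^sup>2" .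
  have "distributed M lborel (\<lambda>x. (X x - 0) / \<sigma>) std_normal_density"
    using assms by (subst normal_standard_normal_convert[symmetric]) auto
  then have d: "distr M lborel (\<lambda>x. X x / \<sigma>) = std_normal_distribution"
    by (simp add: distributed_def)
  have "(CLINT x|M. iexp (u * X x)) = (CLINT x|distr M lborel (\<lambda>x. X x / \<sigma>). iexp ((u * \<sigma>) * x))"
    using assms(2) by (subst integral_distr) auto
  also have "\<dots> = char std_normal_distribution (u * \<sigma>)"
    unfolding d char_def ..
  also have "\<dots> = exp (of_real (- (u\<^sup>2 * \<sigma>\<^sup>2) / 2))"
    by (simp add: char_std_normal_distribution exp_of_real[symmetric] power_mult_distrib)
  finally show "(CLINT x|M. iexp (u * X x)) = exp (of_real (- (u\<^sup>2 * \<sigma>\<^sup>2) / 2))" .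
qed

locale brownian_motion = prob_space M for M :: "'a measure" +
  fixes B :: "real \<Rightarrow> 'a \<Rightarrow> real"
  assumes BM: "brownian_motion_01 M B"
begin

lemma B_measurable: "t \<in> {0..1} \<Longrightarrow> B t \<in> borel_measurable M"
  using BM unfolding brownian_motion_01_def by blast

lemma B_increment:
  assumes "0 \<le> s" "s < t" "t \<le> 1"
  shows "distributed M lborel (\<lambda>\<omega>. B t \<omega> - B s \<omega>) (normal_density 0 (sqrt (t - s)))"
  using BM assms unfolding brownian_motion_01_def by blast

lemma B_indep:
  assumes "\<And>i. i \<le> n \<Longrightarrow> t i \<in> {0..1}" "\<And>i. i < n \<Longrightarrow> t i < t (Suc i)"
  shows "indep_vars (\<lambda>_. borel) (\<lambda>i \<omega>. B (t (Suc i)) \<omega> - B (t i) \<omega>) {..<(n::nat)}"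
  using BM assms unfolding brownian_motion_01_def by blast

lemma B_continuous: "\<omega> \<in> space M \<Longrightarrow> continuous_on {0..1} (\<lambda>t. B t \<omega>)"
  using BM unfolding brownian_motion_01_def by blast

lemma B_isometric: "isometric_increments M B 0 1 1"
proof -
  have lt: "square_integrable M (\<lambda>\<omega>. B t \<omega> - B s \<omega>) \<and> (LINT \<omega>|M. (B t \<omega> - B s \<omega>)\<^sup>2) = t - s"
    if "0 \<le> s" "s < t" "t \<le> 1" for s t
    using centred_normal_moments(1,2)[OF B_increment[OF that]] that by simp
  show ?thesis unfolding isometric_increments_def
  proof (intro ballI)
    fix s t :: real assume st: "s \<in> {0..1}" "t \<in> {0..1}"
    consider "s < t" | "s = t" | "t < s" by linarith
    then show "square_integrable M (\<lambda>\<omega>. B t \<omega> - B s \<omega>) \<and> (LINT \<omega>|M. (B t \<omega> - B s \<omega>)\<^sup>2) = 1 * \<bar>t - s\<bar>"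
    proof cases
      case 3
      have "square_integrable M (\<lambda>\<omega>. (-1) * (B s \<omega> - B t \<omega>))"
        using lt[of t s] 3 st by (intro square_integrable_cmult) auto
      then show ?thesis using lt[of t s] 3 st by (simp add: power2_commute)
    qed (use lt[of s t] st in auto)
  qed
qed

text \<open>The increments over a partition are independent centred normal variables, so that the
  characteristic function of a combination is a product and its variance is a sum.\<close>

lemma partition_gaussian:
  fixes t d :: "nat \<Rightarrow> real"
  assumes t: "\<And>i. i \<le> n \<Longrightarrow> t i \<in> {0..1}" "\<And>i. i < n \<Longrightarrow> t i < t (Suc i)"
  defines "A \<equiv> (\<lambda>\<omega>. \<Sum>i<n. d i * (B (t (Suc i)) \<omega> - B (t i) \<omega>))"
  shows "(CLINT \<omega>|M. iexp (A \<omega>)) = exp (of_real (- (LINT \<omega>|M. (A \<omega>)\<^sup>2) / 2))"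
proof -
  let ?D = "\<lambda>i \<omega>. B (t (Suc i)) \<omega> - B (t i) \<omega>"
  have Dm: "?D i \<in> borel_measurable M" if "i < n" for i
    using that t(1)[of i] t(1)[of "Suc i"] by (intro borel_measurable_diff B_measurable) auto
  have mono: "t i \<le> t j" if "i \<le> j" "j \<le> n" for i j
    using that
  proof (induction j rule: dec_induct)
    case (step k)
    then show ?case using t(2)[of k] by force
  qed simp
  have D: "(CLINT \<omega>|M. iexp (u * ?D i \<omega>)) = exp (of_real (- (u\<^sup>2 * (t (Suc i) - t i)) / 2))" if "i < n" for i u
  proof -
    have "(CLINT \<omega>|M. iexp (u * ?D i \<omega>)) = exp (of_real (- (u\<^sup>2 * (sqrt (t (Suc i) - t i))\<^sup>2) / 2))"
      using t(1)[of i] t(1)[of "Suc i"] t(2)[of i] that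
      by (intro centred_normal_moments(3)[OF B_increment]) auto
    also have "(sqrt (t (Suc i) - t i))\<^sup>2 = t (Suc i) - t i" using t(2)[OF that] by simp
    finally show ?thesis .
  qed
  have ind: "indep_vars (\<lambda>_. borel) (\<lambda>i \<omega>. d i * ?D i \<omega>) {..<n}"
    by (rule indep_vars_compose2[OF B_indep[where t = t and n = n, OF t]]) auto
  have Am: "A \<in> borel_measurable M" unfolding A_def using Dm by measurable
  have "(CLINT \<omega>|M. iexp (A \<omega>)) = char (distr M borel (\<lambda>\<omega>. \<Sum>i<n. d i * ?D i \<omega>)) 1"
    using Am by (simp add: char_def integral_distr A_def)
  also have "\<dots> = (\<Prod>i<n. char (distr M borel (\<lambda>\<omega>. d i * ?D i \<omega>)) 1)"
    by (rule char_distr_sum[OF ind])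
  also have "\<dots> = (\<Prod>i<n. exp (of_real (- ((d i)\<^sup>2 * (t (Suc i) - t i)) / 2)))"
  proof (rule prod.cong)
    fix i assume "i \<in> {..<n}"
    then have i: "i < n" by simp
    show "char (distr M borel (\<lambda>\<omega>. d i * ?D i \<omega>)) 1 = exp (of_real (- ((d i)\<^sup>2 * (t (Suc i) - t i)) / 2))"
      using D[OF i, of "d i"] Dm[OF i] by (simp add: char_def integral_distr)
  qed simp
  also have "\<dots> = exp (of_real (- (\<Sum>i<n. (d i)\<^sup>2 * (t (Suc i) - t i)) / 2))"
    by (simp add: exp_sum[symmetric] sum_negf[symmetric] sum_divide_distrib)
  finally have 1: "(CLINT \<omega>|M. iexp (A \<omega>)) = exp (of_real (- (\<Sum>i<n. (d i)\<^sup>2 * (t (Suc i) - t i)) / 2))" .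
  have "(n, d, t, \<lambda>i. t (Suc i)) \<in> steps_on 0 1"
    unfolding steps_on_def using t by (auto intro: less_imp_le)
  from steps_integral_square[OF B_isometric this]
  have "(LINT \<omega>|M. (A \<omega>)\<^sup>2) = (\<Sum>i<n. \<Sum>j<n. d i * d j * ((\<bar>t (Suc i) - t j\<bar> + \<bar>t i - t (Suc j)\<bar>
      - \<bar>t (Suc i) - t (Suc j)\<bar> - \<bar>t i - t j\<bar>) / 2))"
    by (simp add: A_def steps_integral_def step_integral_def)
  also have "\<dots> = (\<Sum>i<n. \<Sum>j<n. if i = j then (d i)\<^sup>2 * (t (Suc i) - t i) else 0)"
  proof (intro sum.cong refl)
    fix i j assume ij: "i \<in> {..<n}" "j \<in> {..<n}"
    consider "i < j" | "i = j" | "j < i" by linarith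
    then show "d i * d j * ((\<bar>t (Suc i) - t j\<bar> + \<bar>t i - t (Suc j)\<bar> - \<bar>t (Suc i) - t (Suc j)\<bar> - \<bar>t i - t j\<bar>) / 2)
        = (if i = j then (d i)\<^sup>2 * (t (Suc i) - t i) else 0)"
    proof cases
      case 1
      then show ?thesis using mono[of i "Suc i"] mono[of "Suc i" j] mono[of j "Suc j"] ij by simp
    next
      case 2
      then show ?thesis using mono[of i "Suc i"] ij by (simp add: power2_eq_square)
    next
      case 3
      then show ?thesis using mono[of j "Suc j"] mono[of "Suc j" i] mono[of i "Suc i"] ij by simp
    qed
  qed
  also have "\<dots> = (\<Sum>i<n. (d i)\<^sup>2 * (t (Suc i) - t i))" by simp
  finally show ?thesis unfolding 1 by simp
qed

text \<open>A combination of arbitrary increments is a combination of the increments over the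
  sorted list of all the times that occur, which are independent.\<close>

lemma increments_gaussian:
  fixes u v c :: "nat \<Rightarrow> real" and n :: nat
  assumes uv: "\<And>i. i < n \<Longrightarrow> u i \<in> {0..1}" "\<And>i. i < n \<Longrightarrow> v i \<in> {0..1}"
  defines "A \<equiv> (\<lambda>\<omega>. \<Sum>i<n. c i * (B (v i) \<omega> - B (u i) \<omega>))"
  shows "(CLINT \<omega>|M. iexp (A \<omega>)) = exp (of_real (- (LINT \<omega>|M. (A \<omega>)\<^sup>2) / 2))"
proof -
  \<comment> \<open>The point \<open>0\<close> is inserted to make \<open>T\<close> nonempty when \<open>n = 0\<close>.\<close>
  define T where "T = insert 0 (u ` {..<n} \<union> v ` {..<n})"
  have T: "finite T" "T \<subseteq> {0..1}" using uv by (auto simp: T_def)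
  define ts where "ts = sorted_list_of_set T"
  have ts: "set ts = T" "sorted_wrt (<) ts" using T by (auto simp: ts_def)
  define m where "m = length ts - 1"
  have len: "length ts = Suc m" using ts(1) by (cases ts) (auto simp: m_def T_def)
  define t where "t i = ts ! i" for i
  have tin: "t i \<in> {0..1}" if "i \<le> m" for i
    using nth_mem[of i ts] that len ts(1) T(2) by (auto simp: t_def)
  have tlt: "t i < t (Suc i)" if "i < m" for i
    using sorted_wrt_nth_less[OF ts(2), of i "Suc i"] that len by (simp add: t_def)
  have "\<exists>k\<le>m. s = t k" if "s \<in> T" for s
  proof -
    have "s \<in> set ts" using that ts(1) by simp
    then obtain k where k: "k < length ts" "ts ! k = s" unfolding in_set_conv_nth by blast
    have "k \<le> m" using k(1) unfolding len by simp
    moreover have "s = t k" unfolding t_def k(2) ..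
    ultimately show ?thesis by blast
  qed
  then obtain k where k: "\<And>s. s \<in> T \<Longrightarrow> k s \<le> m" "\<And>s. s \<in> T \<Longrightarrow> s = t (k s)" by metis
  let ?D = "\<lambda>j \<omega>. B (t (Suc j)) \<omega> - B (t j) \<omega>"
  have tele: "B s \<omega> - B (t 0) \<omega> = (\<Sum>j<m. of_bool (j < k s) * ?D j \<omega>)" if "s \<in> T" for s \<omega>
  proof -
    have "B s \<omega> - B (t 0) \<omega> = (\<Sum>j<k s. ?D j \<omega>)"
      using sum_lessThan_telescope[of "\<lambda>j. B (t j) \<omega>" "k s"] k(2)[OF that] by simp
    also have "\<dots> = (\<Sum>j<m. of_bool (j < k s) * ?D j \<omega>)"
      by (rule sum.mono_neutral_cong_left) (use k(1)[OF that] in auto)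
    finally show ?thesis .
  qed
  define d where "d j = (\<Sum>i<n. c i * (of_bool (j < k (v i)) - of_bool (j < k (u i))))" for j
  have "A = (\<lambda>\<omega>. \<Sum>j<m. d j * ?D j \<omega>)"
  proof
    fix \<omega>
    have "A \<omega> = (\<Sum>i<n. c i * (\<Sum>j<m. (of_bool (j < k (v i)) - of_bool (j < k (u i))) * ?D j \<omega>))"
      unfolding A_def
    proof (intro sum.cong refl arg_cong2[of _ _ _ _ "(*)"])
      fix i assume i: "i \<in> {..<n}"
      have "B (v i) \<omega> - B (u i) \<omega> = (B (v i) \<omega> - B (t 0) \<omega>) - (B (u i) \<omega> - B (t 0) \<omega>)" by simp
      also have "\<dots> = (\<Sum>j<m. of_bool (j < k (v i)) * ?D j \<omega>) - (\<Sum>j<m. of_bool (j < k (u i)) * ?D j \<omega>)"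
        using i by (intro arg_cong2[of _ _ _ _ "(-)"] tele) (auto simp: T_def)
      also have "\<dots> = (\<Sum>j<m. (of_bool (j < k (v i)) - of_bool (j < k (u i))) * ?D j \<omega>)"
        unfolding sum_subtractf[symmetric] left_diff_distrib ..
      finally show "B (v i) \<omega> - B (u i) \<omega> = (\<Sum>j<m. (of_bool (j < k (v i)) - of_bool (j < k (u i))) * ?D j \<omega>)" .
    qed
    also have "\<dots> = (\<Sum>j<m. d j * ?D j \<omega>)"
      unfolding d_def sum_distrib_left sum_distrib_right by (subst sum.swap) (simp add: mult.assoc)
    finally show "A \<omega> = (\<Sum>j<m. d j * ?D j \<omega>)" .
  qed
  then show ?thesis using partition_gaussian[of m t d] tin tlt by simp
qed

end

locale slepian = brownian_motion M B for M :: "'a measure" and B :: "real \<Rightarrow> 'a \<Rightarrow> real" +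
  fixes p :: real
  assumes p: "1 / 2 \<le> p" "p \<le> 1"
begin

abbreviation "X \<equiv> slepian_path B p (\<lambda>_. 0)"

abbreviation "\<mu> \<equiv> slepian_law M B p (\<lambda>_. 0)"

lemma X_eval: "t \<in> {p..1} \<Longrightarrow> X \<omega> t = (1 / sqrt p) * (B t \<omega> - B (t - p) \<omega>)"
  by (simp add: slepian_path_def nabla_def)

lemma times_in: "t \<in> {p..1} \<Longrightarrow> t \<in> {0..1}" "t \<in> {p..1} \<Longrightarrow> t - p \<in> {0..1}"
  using p by auto

lemma X_in_C_space:
  assumes "\<omega> \<in> space M"
  shows "X \<omega> \<in> mspace (C_space p 1)"
proof -
  have "continuous_on {p..1} (X \<omega>) \<longleftrightarrow> continuous_on {p..1} (\<lambda>t. (1 / sqrt p) * (B t \<omega> - B (t - p) \<omega>))"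
    by (rule continuous_on_cong) (auto simp: X_eval)
  moreover have "continuous_on {p..1} (\<lambda>t. (1 / sqrt p) * (B t \<omega> - B (t - p) \<omega>))"
    by (intro continuous_intros continuous_on_compose2[OF B_continuous[OF assms]])
      (use times_in in auto)
  ultimately show ?thesis by (simp add: mspace_C_space slepian_path_def)
qed

lemma X_measurable [measurable]: "X \<in> measurable M (C_borel p 1)"
proof (rule measurable_C_borel[OF p(2) X_in_C_space])
  fix t assume t: "t \<in> {p..1}"
  have "(\<lambda>\<omega>. (1 / sqrt p) * (B t \<omega> - B (t - p) \<omega>)) \<in> borel_measurable M"
    using B_measurable times_in[OF t] by (intro borel_measurable_times borel_measurable_diff) auto
  then show "(\<lambda>\<omega>. X \<omega> t) \<in> borel_measurable M" using t by (simp add: X_eval)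
qed

lemma law_eq: "\<mu> = distr M (C_borel p 1) X"
  by (simp add: slepian_law_def)

lemma law_shift:
  assumes h: "h \<in> mspace (C_space p 1)"
  shows "slepian_law M B p h = distr \<mu> (C_borel p 1) (shift_path p 1 h)"
proof -
  have "distr \<mu> (C_borel p 1) (shift_path p 1 h) = distr M (C_borel p 1) (shift_path p 1 h \<circ> X)"
    unfolding law_eq by (rule distr_distr[OF measurable_shift_path[OF p(2) h] X_measurable])
  also have "shift_path p 1 h \<circ> X = slepian_path B p h"
    by (auto simp: fun_eq_iff shift_path_def slepian_path_def)
  finally show ?thesis by (simp add: slepian_law_def)
qed

lemma integral_law:
  "f \<in> borel_measurable (C_borel p 1) \<Longrightarrow> (LINT x|\<mu>. f x) = (LINT \<omega>|M. f (X \<omega>) :: real)"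
  unfolding law_eq by (rule integral_distr) auto

lemma square_integrable_law:
  "f \<in> borel_measurable (C_borel p 1) \<Longrightarrow> square_integrable \<mu> f \<longleftrightarrow> square_integrable M (\<lambda>\<omega>. f (X \<omega>))"
  unfolding square_integrable_def law_eq by (subst integrable_distr_eq) auto

text \<open>For \<open>s \<le> t\<close> the increments of \<open>B\<close> over \<open>[s - p, t - p]\<close> and \<open>[s, t]\<close> are uncorrelated,
  since \<open>t - p \<le> 1 - p \<le> p \<le> s\<close>. This is the role of \<open>p \<ge> 1/2\<close>: it makes the variogram of the
  Slepian process linear, like that of Brownian motion.\<close>

lemma X_second_moments:
  assumes s: "s \<in> {p..1}" and t: "t \<in> {p..1}"
  shows "square_integrable M (\<lambda>\<omega>. X \<omega> t)" "(LINT \<omega>|M. (X \<omega> t)\<^sup>2) = 1"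
    "(LINT \<omega>|M. (X \<omega> t - X \<omega> s)\<^sup>2) = 2 * \<bar>t - s\<bar> / p"
proof -
  have si: "square_integrable M (\<lambda>\<omega>. B y \<omega> - B x \<omega>)" if "x \<in> {0..1}" "y \<in> {0..1}" for x y
    using B_isometric that unfolding isometric_increments_def by blast
  have sq: "(LINT \<omega>|M. (B y \<omega> - B x \<omega>)\<^sup>2) = \<bar>y - x\<bar>" if "x \<in> {0..1}" "y \<in> {0..1}" for x y
    using B_isometric that unfolding isometric_increments_def by simp
  have e: "X \<omega> r = (1 / sqrt p) * (B r \<omega> - B (r - p) \<omega>)" if "r \<in> {p..1}" for r \<omega> using X_eval[OF that] .
  show "square_integrable M (\<lambda>\<omega>. X \<omega> t)"
    unfolding e[OF t] using times_in[OF t] by (intro square_integrable_cmult si)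
  show "(LINT \<omega>|M. (X \<omega> t)\<^sup>2) = 1"
    unfolding e[OF t] integral_square_cmult using sq[OF times_in(2,1)[OF t]] p by (simp add: power_divide)
  have d: "X \<omega> t - X \<omega> s = (1 / sqrt p) * ((B t \<omega> - B s \<omega>) - (B (t - p) \<omega> - B (s - p) \<omega>))" for \<omega>
    unfolding e[OF t] e[OF s] by (simp add: algebra_simps)
  have "(LINT \<omega>|M. ((B t \<omega> - B s \<omega>) - (B (t - p) \<omega> - B (s - p) \<omega>))\<^sup>2) =
    \<bar>t - s\<bar> - 2 * (LINT \<omega>|M. (B t \<omega> - B s \<omega>) * (B (t - p) \<omega> - B (s - p) \<omega>)) + \<bar>t - s\<bar>"
    using integral_square_diff[OF si[OF times_in(1)[OF s] times_in(1)[OF t]] si[OF times_in(2)[OF s] times_in(2)[OF t]]]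
      sq[OF times_in(1)[OF s] times_in(1)[OF t]] sq[OF times_in(2)[OF s] times_in(2)[OF t]] by simp
  also have "(LINT \<omega>|M. (B t \<omega> - B s \<omega>) * (B (t - p) \<omega> - B (s - p) \<omega>)) = 0"
    using isometric_increments_inner[OF B_isometric times_in(1)[OF s] times_in(1)[OF t] times_in(2)[OF s] times_in(2)[OF t]]
      s t p by simp
  finally show "(LINT \<omega>|M. (X \<omega> t - X \<omega> s)\<^sup>2) = 2 * \<bar>t - s\<bar> / p"
    unfolding d integral_square_cmult using p by (simp add: power_divide)
qed

lemma gaussian_law: "gaussian_path_measure \<mu> p 1"
proof -
  have "prob_space \<mu>" unfolding law_eq by (rule prob_space_distr) simp
  moreover have "gaussian_path_measure_axioms \<mu> p 1"
  proof
    show "p \<le> 1" by (rule p(2))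
    show "sets \<mu> = sets (C_borel p 1)" by (simp add: law_eq)
    show "square_integrable \<mu> (\<lambda>x. x t)" if "t \<in> {p..1}" for t
      using X_second_moments(1)[OF that that] square_integrable_law[OF measurable_evaluation[OF that]] by simp
    fix A assume "A \<in> evaluation_span p 1"
    then obtain n :: nat and c t where A: "A = (\<lambda>x. \<Sum>i<n. c i * x (t i))" "\<forall>i<n. t i \<in> {p..1}"
      unfolding evaluation_span_def by blast
    have Am [measurable]: "A \<in> borel_measurable (C_borel p 1)"
      unfolding A(1) using A(2) by (intro borel_measurable_sum borel_measurable_times) (auto intro!: measurable_evaluation)
    have AX: "A (X \<omega>) = (\<Sum>i<n. (c i / sqrt p) * (B (t i) \<omega> - B (t i - p) \<omega>))" for \<omega>
      unfolding A(1) using A(2) X_eval by (intro sum.cong) auto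
    have "(CLINT x|\<mu>. iexp (A x)) = (CLINT \<omega>|M. iexp (A (X \<omega>)))"
      unfolding law_eq by (rule integral_distr) measurable
    also have "\<dots> = exp (of_real (- (LINT \<omega>|M. (A (X \<omega>))\<^sup>2) / 2))"
      unfolding AX by (rule increments_gaussian) (use A(2) times_in in auto)
    also have "(LINT \<omega>|M. (A (X \<omega>))\<^sup>2) = (LINT x|\<mu>. (A x)\<^sup>2)"
      by (subst integral_law) auto
    finally show "(CLINT x|\<mu>. iexp (A x)) = exp (of_real (- (LINT x|\<mu>. (A x)\<^sup>2) / 2))" .
  qed
  ultimately show ?thesis by (simp add: gaussian_path_measure_def)
qed

sublocale law: gaussian_path_measure \<mu> p 1
  by (rule gaussian_law)

lemma law_second_moments:
  assumes "s \<in> {p..1}" "t \<in> {p..1}"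
  shows "(LINT x|\<mu>. (x t - x s)\<^sup>2) = 2 * \<bar>t - s\<bar> / p" "(LINT x|\<mu>. x s * x t) = 1 - \<bar>t - s\<bar> / p"
proof -
  note [measurable] = measurable_evaluation[OF assms(1)] measurable_evaluation[OF assms(2)]
  show 1: "(LINT x|\<mu>. (x t - x s)\<^sup>2) = 2 * \<bar>t - s\<bar> / p"
    using X_second_moments(3)[OF assms] by (subst integral_law) auto
  have 2: "(LINT x|\<mu>. (x s)\<^sup>2) = 1" "(LINT x|\<mu>. (x t)\<^sup>2) = 1"
    using X_second_moments(2)[OF assms(1) assms(1)] X_second_moments(2)[OF assms(2) assms(2)]
    by (subst integral_law; simp)+
  show "(LINT x|\<mu>. x s * x t) = 1 - \<bar>t - s\<bar> / p"
    using integral_square_diff[OF law.square_integrable_evaluation[OF assms(2)] law.square_integrable_evaluation[OF assms(1)]] 1 2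
    by (simp add: mult.commute)
qed

lemma law_isometric: "isometric_increments \<mu> (\<lambda>t x. sqrt p * x t) p 1 2"
  unfolding isometric_increments_def
proof (intro ballI)
  fix s t assume st: "s \<in> {p..1}" "t \<in> {p..1}"
  have e: "sqrt p * x t - sqrt p * x s = sqrt p * (x t - x s)" for x :: "real \<Rightarrow> real" by (simp add: right_diff_distrib)
  show "square_integrable \<mu> (\<lambda>x. sqrt p * x t - sqrt p * x s) \<and>
     (LINT x|\<mu>. (sqrt p * x t - sqrt p * x s)\<^sup>2) = 2 * \<bar>t - s\<bar>"
    unfolding e integral_square_cmult
    using law_second_moments(1)[OF st] law.square_integrable_evaluation st p
    by (auto intro!: square_integrable_cmult)
qed

end

section \<open>Integrals over the time axis\<close>

lemma L2_on_square_integrable: "L2_on a b f \<longleftrightarrow> square_integrable (lebesgue_on {a..b}) f"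
  by (simp add: L2_on_def square_integrable_def)

lemma L2_on_iff_indicator:
  "L2_on a b f \<longleftrightarrow> square_integrable lebesgue (\<lambda>x. indicator {a..b} x * f x)"
proof -
  have "(\<lambda>x. (indicator {a..b} x * f x)\<^sup>2) = (\<lambda>x. indicator {a..b} x * (f x)\<^sup>2)"
    by (auto simp: indicator_def)
  then show ?thesis
    by (simp add: L2_on_def square_integrable_def borel_measurable_restrict_space_iff integrable_restrict_space)
qed

lemma s_int_eq_indicator: "s_int a f t = (LINT u|lebesgue. indicator {a..t} u * f u)"
  by (simp add: s_int_def integral_restrict_space)

lemma s_int_self: "s_int a f a = 0"
proof -
  have "AE u in lebesgue. u \<noteq> a" by (rule AE_completion[OF AE_lborel_singleton])
  then have "AE u in lebesgue. indicator {a..a} u * f u = 0" by eventually_elim simp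
  then have "(LINT u|lebesgue. indicator {a..a} u * f u) = 0" by (rule integral_eq_zero_AE)
  then show ?thesis by (simp only: s_int_eq_indicator)
qed

lemma L2_on_subset:
  assumes f: "L2_on a b f" and "a \<le> c" "d \<le> b"
  shows "L2_on c d f"
proof -
  have eq: "(\<lambda>x. indicator {c..d} x * f x) = (\<lambda>x. indicator {c..d} x * (indicator {a..b} x * f x))"
    using assms by (auto simp: indicator_def)
  have m: "(\<lambda>x. indicator {a..b} x * f x) \<in> borel_measurable lebesgue"
    and i: "integrable lebesgue (\<lambda>x. (indicator {a..b} x * f x)\<^sup>2)"
    using f by (auto simp: L2_on_iff_indicator square_integrable_def)
  have m': "(\<lambda>x. indicator {c..d} x * (indicator {a..b} x * f x)) \<in> borel_measurable lebesgue"
    by (intro borel_measurable_times borel_measurable_indicator m) simp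
  have "integrable lebesgue (\<lambda>x. (indicator {c..d} x * (indicator {a..b} x * f x))\<^sup>2)"
    by (rule Bochner_Integration.integrable_bound[OF i])
      (use m' in \<open>auto simp: indicator_def\<close>)
  then show ?thesis unfolding L2_on_iff_indicator eq using m' by (simp add: square_integrable_def)
qed

lemma L2_on_shift:
  assumes f: "L2_on a b f"
  shows "L2_on (a + p) (b + p) (\<lambda>x. f (x - p))"
proof -
  let ?F = "\<lambda>x. indicator {a..b} x * f x"
  have eq: "(\<lambda>x. indicator {a + p..b + p} x * f (x - p)) = (\<lambda>x. ?F (- p + 1 * x))"
    by (intro ext) (auto simp: indicator_def algebra_simps)
  have m: "?F \<in> borel_measurable lebesgue" and i: "integrable lebesgue (\<lambda>x. (?F x)\<^sup>2)"
    using f by (auto simp: L2_on_iff_indicator square_integrable_def)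
  show ?thesis
    unfolding L2_on_iff_indicator eq square_integrable_def
    using borel_measurable_affine[OF m, of 1 "-p"] lebesgue_integrable_real_affine[OF i, of 1 "-p"] by simp
qed

lemma s_int_shift: "s_int (a + p) (\<lambda>u. f (u - p)) (t + p) = s_int a f t"
proof -
  have "s_int a f t = (LINT u|lebesgue. indicator {a..t} (- p + 1 * u) * f (- p + 1 * u))"
    unfolding s_int_eq_indicator by (subst lebesgue_integral_real_affine[of 1 _ "-p"]) auto
  also have "\<dots> = s_int (a + p) (\<lambda>u. f (u - p)) (t + p)"
    unfolding s_int_eq_indicator
    by (intro Bochner_Integration.integral_cong) (auto simp: indicator_def)
  finally show ?thesis by simp
qed

lemma L2_on_integrable: "L2_on a b f \<Longrightarrow> integrable lebesgue (\<lambda>u. indicator {a..b} u * f u)"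
  using square_integrable_integrable[OF finite_measure_lebesgue_on_Icc, of a b f]
  by (simp add: L2_on_square_integrable integrable_restrict_space)

lemma s_int_add:
  assumes f: "L2_on a b f" and c: "a \<le> c" "c \<le> b"
  shows "s_int a f c + s_int c f b = s_int a f b"
proof -
  have i: "integrable lebesgue (\<lambda>u. indicator {a..c} u * f u)" "integrable lebesgue (\<lambda>u. indicator {c..b} u * f u)"
    "integrable lebesgue (\<lambda>u. indicator {a..b} u * f u)"
    using L2_on_subset[OF f, of a c] L2_on_subset[OF f, of c b] c f by (auto intro!: L2_on_integrable)
  have "AE u in lebesgue. u \<noteq> c" by (rule AE_completion[OF AE_lborel_singleton])
  then have "(LINT u|lebesgue. indicator {a..c} u * f u + indicator {c..b} u * f u) = (LINT u|lebesgue. indicator {a..b} u * f u)"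
    using c i by (intro integral_cong_AE) (auto elim!: eventually_mono simp: indicator_def simp del: Bochner_Integration.integral_add)
  then show ?thesis using i by (simp add: s_int_eq_indicator)
qed

lemma L2_tendsto_distr:
  assumes T: "T \<in> measurable M N" and "L2_tendsto M (\<lambda>k \<omega>. f k (T \<omega>)) (\<lambda>\<omega>. g (T \<omega>))"
    and [measurable]: "\<And>k. f k \<in> borel_measurable N" "g \<in> borel_measurable N"
  shows "L2_tendsto (distr M N T) f g"
  using L2_tendstoD[OF assms(2)] T
  by (simp add: L2_tendsto_def square_integrable_def integrable_distr_eq integral_distr)

lemma L2_tendsto_distrD:
  assumes T: "T \<in> measurable M N" and l: "L2_tendsto (distr M N T) f g"
  shows "L2_tendsto M (\<lambda>k \<omega>. f k (T \<omega>)) (\<lambda>\<omega>. g (T \<omega>))"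
proof -
  have m: "f k \<in> borel_measurable N" "g \<in> borel_measurable N" for k
    using L2_tendstoD(1,2)[OF l] by (auto simp: square_integrable_def)
  then show ?thesis
    using L2_tendstoD[OF l] T measurable_compose[OF T m(1)] measurable_compose[OF T m(2)]
    by (simp add: L2_tendsto_def square_integrable_def integrable_distr_eq integral_distr)
qed

section \<open>The functional representing a shift of the Slepian process\<close>

context slepian
begin

abbreviation "SI \<equiv> steps_integral (\<lambda>t x. sqrt p * x t)"

abbreviation "L \<equiv> lebesgue_on {p..1}"

lemma B_isometric_p: "isometric_increments M B p 1 1"
  using B_isometric p unfolding isometric_increments_def by auto

lemma B_shift_isometric: "isometric_increments M (\<lambda>s. B (s - p)) p 1 1"
  using B_isometric times_in(2) unfolding isometric_increments_def by auto

lemma SI_span: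
  assumes "\<sigma> \<in> steps_on p 1"
  shows "SI \<sigma> \<in> evaluation_span p 1"
proof -
  obtain n c u v where s: "\<sigma> = (n, c, u, v)" by (metis prod_cases4)
  have uv: "u i \<in> {p..1}" "v i \<in> {p..1}" if "i < n" for i
    using assms that by (auto simp: s steps_on_def dest!: spec[of _ i])
  have "(\<lambda>x. \<Sum>i<n. (c i * sqrt p) * x (v i)) \<in> evaluation_span p 1"
    "(\<lambda>x. \<Sum>i<n. (c i * sqrt p) * x (u i)) \<in> evaluation_span p 1"
    using uv by (auto intro!: evaluation_spanI)
  from evaluation_span_linear[OF this, of 1 "-1"]
  show ?thesis
    by (simp add: s steps_integral_def step_integral_def[abs_def] sum_subtractf[symmetric] algebra_simps)
qed

lemma SI_measurable: "\<sigma> \<in> steps_on p 1 \<Longrightarrow> SI \<sigma> \<in> borel_measurable (C_borel p 1)"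
  using square_integrable_measurable[OF law.square_integrable_span[OF SI_span]]
  by (simp cong: measurable_cong_sets add: law.sets_mu)

lemma SI_path:
  assumes "\<sigma> \<in> steps_on p 1"
  shows "SI \<sigma> (X \<omega>) = steps_integral B \<sigma> \<omega> - steps_integral (\<lambda>s. B (s - p)) \<sigma> \<omega>"
proof -
  obtain n c u v where s: "\<sigma> = (n, c, u, v)" by (metis prod_cases4)
  have uv: "u i \<in> {p..1}" "v i \<in> {p..1}" if "i < n" for i
    using assms that by (auto simp: s steps_on_def dest!: spec[of _ i])
  have e: "sqrt p * X \<omega> t = B t \<omega> - B (t - p) \<omega>" if "t \<in> {p..1}" for t
    using X_eval[OF that] p by simp
  show ?thesis
    unfolding s steps_integral_def step_integral_def prod.case sum_subtractf[symmetric]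
  proof (rule sum.cong)
    fix i assume "i \<in> {..<n}"
    then have i: "i < n" by simp
    show "c i * (sqrt p * X \<omega> (v i) - sqrt p * X \<omega> (u i)) =
      c i * (B (v i) \<omega> - B (u i) \<omega>) - c i * (B (v i - p) \<omega> - B (u i - p) \<omega>)"
      unfolding e[OF uv(1)[OF i]] e[OF uv(2)[OF i]] by (simp add: algebra_simps)
  qed simp
qed

text \<open>The two Wiener integrals behind \<open>J\<close> may come from different approximations of \<open>g\<close>. The
  isometry allows replacing one of them by the other, after which the elementary integrals
  combine to functionals of the Slepian path.\<close>

lemma nabla_integral_imp_steps:
  assumes g: "L2_on p 1 g" and J: "is_nabla_wiener_integral M B p g J"
  obtains \<sigma> where "\<And>k. \<sigma> k \<in> steps_on p 1" "L2_tendsto L (\<lambda>k. steps_fun (\<sigma> k)) g" "L2_tendsto \<mu> (\<lambda>k. SI (\<sigma> k)) J"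
proof -
  obtain I1 I2 where I: "is_wiener_integral M B p 1 g I1" "is_wiener_integral M (\<lambda>s. B (s - p)) p 1 g I2"
    "AE \<omega> in M. J (X \<omega>) = I1 \<omega> - I2 \<omega>" and Jm: "J \<in> borel_measurable \<mu>"
    using J unfolding is_nabla_wiener_integral_def by blast
  have Jm [measurable]: "J \<in> borel_measurable (C_borel p 1)" using Jm by (simp add: law_eq)
  obtain \<sigma> where \<sigma>: "\<And>k. \<sigma> k \<in> steps_on p 1" "L2_tendsto L (\<lambda>k. steps_fun (\<sigma> k)) g"
    "L2_tendsto M (\<lambda>k. steps_integral B (\<sigma> k)) I1"
    using is_wiener_integral_imp_steps[OF B_isometric_p I(1) g] by blast
  obtain \<tau> where \<tau>: "\<And>k. \<tau> k \<in> steps_on p 1" "L2_tendsto L (\<lambda>k. steps_fun (\<tau> k)) g"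
    "L2_tendsto M (\<lambda>k. steps_integral (\<lambda>s. B (s - p)) (\<tau> k)) I2"
    using is_wiener_integral_imp_steps[OF B_shift_isometric I(2) g] by blast
  have "(\<lambda>k. LINT s|L. (steps_fun (\<sigma> k) s - steps_fun (\<tau> k) s)\<^sup>2) \<longlonglongrightarrow> 0"
    using L2_tendstoD(3)[OF L2_tendsto_diff[OF \<sigma>(2) \<tau>(2)]] by simp
  then have "(\<lambda>k. LINT \<omega>|M. (steps_integral (\<lambda>s. B (s - p)) (\<sigma> k) \<omega> - steps_integral (\<lambda>s. B (s - p)) (\<tau> k) \<omega>)\<^sup>2) \<longlonglongrightarrow> 0"
    by (simp add: steps_isometry_diff[OF B_shift_isometric \<sigma>(1) \<tau>(1)])
  then have "L2_tendsto M (\<lambda>k. steps_integral (\<lambda>s. B (s - p)) (\<sigma> k)) I2"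
    by (rule L2_tendsto_transfer[OF \<tau>(3) square_integrable_steps_integral[OF B_shift_isometric \<sigma>(1)]])
  from L2_tendsto_diff[OF \<sigma>(3) this]
  have lim: "L2_tendsto M (\<lambda>k \<omega>. SI (\<sigma> k) (X \<omega>)) (\<lambda>\<omega>. I1 \<omega> - I2 \<omega>)"
    by (simp add: SI_path[OF \<sigma>(1)])
  note l = L2_tendstoD[OF lim]
  have JX [measurable]: "(\<lambda>\<omega>. J (X \<omega>)) \<in> borel_measurable M" by measurable
  note [measurable] = square_integrable_measurable[OF l(1)] square_integrable_measurable[OF l(2)]
  have "integrable M (\<lambda>\<omega>. (J (X \<omega>))\<^sup>2) \<longleftrightarrow> integrable M (\<lambda>\<omega>. (I1 \<omega> - I2 \<omega>)\<^sup>2)"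
    using I(3) by (intro integrable_cong_AE) (auto elim!: eventually_mono)
  moreover have "(LINT \<omega>|M. (SI (\<sigma> k) (X \<omega>) - J (X \<omega>))\<^sup>2) = (LINT \<omega>|M. (SI (\<sigma> k) (X \<omega>) - (I1 \<omega> - I2 \<omega>))\<^sup>2)" for k
    using I(3) by (intro integral_cong_AE) (auto elim!: eventually_mono)
  ultimately have "L2_tendsto M (\<lambda>k \<omega>. SI (\<sigma> k) (X \<omega>)) (\<lambda>\<omega>. J (X \<omega>))"
    using l by (simp add: L2_tendsto_def square_integrable_def)
  then have "L2_tendsto \<mu> (\<lambda>k. SI (\<sigma> k)) J"
    unfolding law_eq by (rule L2_tendsto_distr[OF X_measurable _ SI_measurable[OF \<sigma>(1)] Jm])
  with \<sigma>(1,2) show ?thesis by (rule that)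
qed

text \<open>The integral is constructed on path space, as a limit under \<open>\<mu>\<close>, because it must be a
  functional of the path. Subtracting it from an integral against \<open>dB(s)\<close> then yields a version
  of the integral against \<open>dB(s - p)\<close>.\<close>

lemma nabla_integral_exists:
  assumes g: "L2_on p 1 g"
  obtains J where "is_nabla_wiener_integral M B p g J"
proof -
  obtain \<sigma> where \<sigma>: "\<And>k. \<sigma> k \<in> steps_on p 1" "L2_tendsto L (\<lambda>k. steps_fun (\<sigma> k)) g"
    using steps_dense[OF g] by blast
  obtain J where J: "L2_tendsto \<mu> (\<lambda>k. SI (\<sigma> k)) J"
    using steps_integral_convergent[OF law.finite_measure_axioms law_isometric \<sigma>] by blast
  obtain I1 where I1: "L2_tendsto M (\<lambda>k. steps_integral B (\<sigma> k)) I1"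
    using steps_integral_convergent[OF finite_measure_axioms B_isometric_p \<sigma>] by blast
  have JX: "L2_tendsto M (\<lambda>k \<omega>. SI (\<sigma> k) (X \<omega>)) (\<lambda>\<omega>. J (X \<omega>))"
    using J unfolding law_eq by (rule L2_tendsto_distrD[OF X_measurable])
  have I2: "L2_tendsto M (\<lambda>k. steps_integral (\<lambda>s. B (s - p)) (\<sigma> k)) (\<lambda>\<omega>. I1 \<omega> - J (X \<omega>))"
    using L2_tendsto_diff[OF I1 JX] by (simp add: SI_path[OF \<sigma>(1)])
  have "is_wiener_integral M B p 1 g I1" by (rule is_wiener_integralI[OF \<sigma> I1])
  moreover have "is_wiener_integral M (\<lambda>s. B (s - p)) p 1 g (\<lambda>\<omega>. I1 \<omega> - J (X \<omega>))"
    by (rule is_wiener_integralI[OF \<sigma> I2])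
  moreover have "J \<in> borel_measurable \<mu>"
    by (rule square_integrable_measurable[OF L2_tendstoD(2)[OF J]])
  ultimately have "is_nabla_wiener_integral M B p g J"
    unfolding is_nabla_wiener_integral_def by (intro conjI exI) auto
  then show ?thesis by (rule that)
qed

text \<open>The weight \<open>2 * indicator {..t} s - 1\<close>, the sign of \<open>t - s\<close>, is \<open>p\<close> times the derivative in
  \<open>s\<close> of the covariance \<open>1 - \<bar>t - s\<bar> / p\<close>.\<close>

lemma time_weight_square_integrable: "square_integrable L (\<lambda>s. 2 * indicator {..t} s - 1)"
proof -
  interpret L: finite_measure L by (rule finite_measure_lebesgue_on_Icc)
  have "(\<lambda>s. 2 * indicator {..t} s - 1 :: real) \<in> borel_measurable borel" by measurable
  then have m: "(\<lambda>s. 2 * indicator {..t} s - 1 :: real) \<in> borel_measurable L"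
    by (intro measurable_restrict_space1 measurable_completion) simp
  then show ?thesis
    unfolding square_integrable_def
    by (intro conjI m L.integrable_const_bound[of _ 1]) (auto simp: indicator_def power2_eq_square)
qed

lemma time_weight_integral:
  assumes g: "L2_on p 1 g" and t: "t \<in> {p..1}"
  shows "(LINT s|L. g s * (2 * indicator {..t} s - 1)) = 2 * s_int p g t - s_int p g 1"
proof -
  have i: "integrable lebesgue (\<lambda>u. indicator {p..t} u * g u)" "integrable lebesgue (\<lambda>u. indicator {p..1} u * g u)"
    using L2_on_subset[OF g, of p t] t g by (auto intro!: L2_on_integrable)
  have "(LINT s|L. g s * (2 * indicator {..t} s - 1)) = (LINT s|lebesgue. 2 * (indicator {p..t} s * g s) - indicator {p..1} s * g s)"
    using t by (subst integral_restrict_space) (auto intro!: Bochner_Integration.integral_cong simp: indicator_def)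
  also have "\<dots> = 2 * s_int p g t - s_int p g 1"
    using i by (simp add: s_int_eq_indicator)
  finally show ?thesis .
qed

lemma SI_covariance:
  assumes \<sigma>: "\<sigma> \<in> steps_on p 1" and t: "t \<in> {p..1}"
  shows "(LINT x|\<mu>. SI \<sigma> x * x t) = (1 / sqrt p) * (LINT s|L. steps_fun \<sigma> s * (2 * indicator {..t} s - 1))"
proof -
  obtain n c u v where s: "\<sigma> = (n, c, u, v)" by (metis prod_cases4)
  have uv: "u i \<in> {p..1}" "v i \<in> {p..1}" "u i \<le> v i" if "i < n" for i
    using \<sigma> that by (auto simp: s steps_on_def dest!: spec[of _ i])
  note sie = law.square_integrable_evaluation
  have ie: "integrable \<mu> (\<lambda>x. x r * x t)" if "r \<in> {p..1}" for r
    by (rule square_integrable_mult[OF sie[OF that] sie[OF t]])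
  have "(LINT x|\<mu>. SI \<sigma> x * x t) = (LINT x|\<mu>. (\<Sum>i<n. c i * sqrt p * (x (v i) * x t - x (u i) * x t)))"
    unfolding s steps_integral_def step_integral_def prod.case sum_distrib_right
    by (intro Bochner_Integration.integral_cong refl sum.cong) (simp add: algebra_simps)
  also have "\<dots> = (\<Sum>i<n. LINT x|\<mu>. c i * sqrt p * (x (v i) * x t - x (u i) * x t))"
    by (rule Bochner_Integration.integral_sum)
      (intro integrable_mult_right Bochner_Integration.integrable_diff ie uv, auto)
  also have "\<dots> = (\<Sum>i<n. c i * ((1 / sqrt p) * (\<bar>u i - t\<bar> - \<bar>v i - t\<bar>)))"
  proof (rule sum.cong)
    fix i assume "i \<in> {..<n}"
    then have i: "i < n" by simp
    have "(LINT x|\<mu>. c i * sqrt p * (x (v i) * x t - x (u i) * x t)) =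
       c i * sqrt p * ((LINT x|\<mu>. x (v i) * x t) - (LINT x|\<mu>. x (u i) * x t))"
      using ie[OF uv(1)[OF i]] ie[OF uv(2)[OF i]] by simp
    also have "\<dots> = c i * (sqrt p / p * (\<bar>u i - t\<bar> - \<bar>v i - t\<bar>))"
      unfolding law_second_moments(2)[OF uv(2)[OF i] t] law_second_moments(2)[OF uv(1)[OF i] t]
      by (simp add: diff_divide_distrib abs_minus_commute algebra_simps)
    also have "sqrt p / p = 1 / sqrt p" using p by (simp add: real_div_sqrt field_simps)
    finally show "(LINT x|\<mu>. c i * sqrt p * (x (v i) * x t - x (u i) * x t)) = c i * ((1 / sqrt p) * (\<bar>u i - t\<bar> - \<bar>v i - t\<bar>))" .
  qed simp
  also have "\<dots> = (1 / sqrt p) * (\<Sum>i<n. c i * (\<bar>u i - t\<bar> - \<bar>v i - t\<bar>))"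
    by (simp add: sum_distrib_left mult_ac)
  finally have 1: "(LINT x|\<mu>. SI \<sigma> x * x t) = (1 / sqrt p) * (\<Sum>i<n. c i * (\<bar>u i - t\<bar> - \<bar>v i - t\<bar>))" .
  have iw: "integrable L (\<lambda>s. indicator {u i<..v i} s * (2 * indicator {..t} s - 1 :: real))"
    and vw: "(LINT s|L. indicator {u i<..v i} s * (2 * indicator {..t} s - 1 :: real)) = \<bar>u i - t\<bar> - \<bar>v i - t\<bar>"
    if i: "i < n" for i
  proof -
    have one: "(1, \<lambda>_. 1, \<lambda>_. u i, \<lambda>_. v i) \<in> steps_on p 1" using uv[OF i] by (auto simp: steps_on_def)
    have f: "steps_fun (1, \<lambda>_. 1, \<lambda>_. u i, \<lambda>_. v i) = indicator {u i<..v i}"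
      by (auto simp: steps_fun_def step_fun_def)
    have si: "square_integrable L (indicator {u i<..v i})"
      using square_integrable_steps_fun[OF one] unfolding f .
    show "integrable L (\<lambda>s. indicator {u i<..v i} s * (2 * indicator {..t} s - 1 :: real))"
      by (rule square_integrable_mult[OF si time_weight_square_integrable])
    have g: "L2_on p 1 (indicator {u i<..v i})" using si by (simp add: L2_on_square_integrable)
    have meas: "s_int p (indicator {u i<..v i}) r = max (u i) (min (v i) r) - u i" if "r \<in> {p..1}" for r
    proof -
      have "s_int p (indicator {u i<..v i}) r = (LINT s|lebesgue. indicator ({u i<..min (v i) r}) s)"
        unfolding s_int_eq_indicator using uv[OF i] that
        by (intro Bochner_Integration.integral_cong) (auto simp: indicator_def)
      also have "\<dots> = max (u i) (min (v i) r) - u i"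
        by (cases "u i \<le> min (v i) r") (auto simp: max_def)
      finally show ?thesis .
    qed
    show "(LINT s|L. indicator {u i<..v i} s * (2 * indicator {..t} s - 1 :: real)) = \<bar>u i - t\<bar> - \<bar>v i - t\<bar>"
      unfolding time_weight_integral[OF g t] using meas[OF t] meas[of 1] uv[OF i] p t by auto
  qed
  have "(LINT s|L. steps_fun \<sigma> s * (2 * indicator {..t} s - 1)) =
    (LINT s|L. (\<Sum>i<n. c i * (indicator {u i<..v i} s * (2 * indicator {..t} s - 1))))"
    by (simp only: s steps_fun_def step_fun_def prod.case sum_distrib_right mult.assoc)
  also have "\<dots> = (\<Sum>i<n. LINT s|L. c i * (indicator {u i<..v i} s * (2 * indicator {..t} s - 1)))"
    by (rule Bochner_Integration.integral_sum) (intro integrable_mult_right iw, auto)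
  also have "\<dots> = (\<Sum>i<n. c i * (\<bar>u i - t\<bar> - \<bar>v i - t\<bar>))"
    by (intro sum.cong refl) (simp add: vw)
  finally show ?thesis unfolding 1 by simp
qed

lemma nabla_integral_moments:
  assumes g: "L2_on p 1 g" and \<sigma>: "\<And>k. \<sigma> k \<in> steps_on p 1" "L2_tendsto L (\<lambda>k. steps_fun (\<sigma> k)) g"
    "L2_tendsto \<mu> (\<lambda>k. SI (\<sigma> k)) J"
  shows "(LINT x|\<mu>. (J x)\<^sup>2) = 2 * (LINT s|L. (g s)\<^sup>2)"
    "t \<in> {p..1} \<Longrightarrow> (LINT x|\<mu>. J x * x t) = (1 / sqrt p) * (2 * s_int p g t - s_int p g 1)"
proof -
  have "(\<lambda>k. LINT x|\<mu>. (SI (\<sigma> k) x)\<^sup>2) \<longlonglongrightarrow> (LINT x|\<mu>. (J x)\<^sup>2)" by (rule L2_tendsto_square[OF \<sigma>(3)])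
  moreover have "(\<lambda>k. 2 * (LINT s|L. (steps_fun (\<sigma> k) s)\<^sup>2)) \<longlonglongrightarrow> 2 * (LINT s|L. (g s)\<^sup>2)"
    by (intro tendsto_intros L2_tendsto_square[OF \<sigma>(2)])
  ultimately show "(LINT x|\<mu>. (J x)\<^sup>2) = 2 * (LINT s|L. (g s)\<^sup>2)"
    unfolding steps_isometry[OF law_isometric \<sigma>(1)] by (rule LIMSEQ_unique)
  assume t: "t \<in> {p..1}"
  have "(\<lambda>k. LINT x|\<mu>. SI (\<sigma> k) x * x t) \<longlonglongrightarrow> (LINT x|\<mu>. J x * x t)"
    by (rule L2_tendsto_inner[OF \<sigma>(3) law.square_integrable_evaluation[OF t]])
  moreover have "(\<lambda>k. (1 / sqrt p) * (LINT s|L. steps_fun (\<sigma> k) s * (2 * indicator {..t} s - 1)))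
     \<longlonglongrightarrow> (1 / sqrt p) * (LINT s|L. g s * (2 * indicator {..t} s - 1))"
    by (intro tendsto_intros L2_tendsto_inner[OF \<sigma>(2) time_weight_square_integrable])
  ultimately show "(LINT x|\<mu>. J x * x t) = (1 / sqrt p) * (2 * s_int p g t - s_int p g 1)"
    unfolding SI_covariance[OF \<sigma>(1) t] time_weight_integral[OF g t, symmetric] by (rule LIMSEQ_unique)
qed

text \<open>The covariance \<open>1 - \<bar>t - s\<bar> / p\<close> makes \<open>S = x(p) + x(1)\<close> uncorrelated with all increments,
  so that the functional \<open>Z\<close> representing \<open>(c + s\<^sub>g) / \<surd>p\<close> is an orthogonal sum of a multiple of
  \<open>S\<close> and half the Wiener integral of \<open>g\<close>. The covariance of \<open>Z\<close> with \<open>x(t)\<close> receives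
  \<open>(c + s\<^sub>g(1) / 2) / \<surd>p\<close> from the first and \<open>(s\<^sub>g(t) - s\<^sub>g(1) / 2) / \<surd>p\<close> from the second term.\<close>

lemma slepian_representer:
  fixes c :: real
  assumes g: "L2_on p 1 g" and J: "is_nabla_wiener_integral M B p g J"
  defines "Z \<equiv> (\<lambda>x. (2 * c + s_int p g 1) / (2 * (3 * p - 1)) * (sqrt p * x p + sqrt p * x 1) + 1 / 2 * J x)"
  shows "Z \<in> L2_evaluation_closure p 1 \<mu>"
    and "\<And>t. t \<in> {p..1} \<Longrightarrow> (LINT x|\<mu>. Z x * x t) = (1 / sqrt p) * (c + s_int p g t)"
    and "(LINT x|\<mu>. (Z x)\<^sup>2) = (1 / 2) * ((2 * c + s_int p g 1)\<^sup>2 / (3 * p - 1) + (LINT s|L. (g s)\<^sup>2))"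
proof -
  obtain \<sigma> where \<sigma>: "\<And>k. \<sigma> k \<in> steps_on p 1" "L2_tendsto L (\<lambda>k. steps_fun (\<sigma> k)) g" "L2_tendsto \<mu> (\<lambda>k. SI (\<sigma> k)) J"
    using nabla_integral_imp_steps[OF g J] by blast
  note mom = nabla_integral_moments[OF g \<sigma>]
  have p1: "p \<in> {p..1}" "1 \<in> {p..1}" using p by auto
  define q where "q = 3 * p - 1"
  have q: "q > 0" using p by (simp add: q_def)
  define a where "a = 2 * c + s_int p g 1"
  define k where "k = sqrt p * a / (2 * q)"
  define S where "S x = x p + x 1" for x :: "real \<Rightarrow> real"
  have Zeq: "Z = (\<lambda>x. k * S x + (1 / 2) * J x)"
    by (auto simp: Z_def k_def S_def a_def q_def field_simps)
  have S: "S \<in> evaluation_span p 1"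
    using evaluation_span_linear[OF evaluation_in_span[OF p1(1)] evaluation_in_span[OF p1(2)], of 1 1]
    by (simp add: S_def[abs_def])
  have siS: "square_integrable \<mu> S" by (rule law.square_integrable_span[OF S])
  have siJ: "square_integrable \<mu> J" by (rule L2_tendstoD(2)[OF \<sigma>(3)])
  note sie = law.square_integrable_evaluation
  have "L2_tendsto \<mu> (\<lambda>i x. k * S x + (1 / 2) * SI (\<sigma> i) x) Z"
    unfolding Zeq by (intro L2_tendsto_add L2_tendsto_cmult L2_tendsto_const siS \<sigma>(3))
  moreover have "(\<lambda>x. k * S x + (1 / 2) * SI (\<sigma> i) x) \<in> evaluation_span p 1" for i
    by (rule evaluation_span_linear[OF S SI_span[OF \<sigma>(1)]])
  ultimately show "Z \<in> L2_evaluation_closure p 1 \<mu>"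
    unfolding law.closure_iff_L2_tendsto
    by (intro exI[of _ "\<lambda>i x. k * S x + (1 / 2) * SI (\<sigma> i) x"]) simp
  have St: "(LINT x|\<mu>. S x * x t) = q / p" if t: "t \<in> {p..1}" for t
  proof -
    have "(LINT x|\<mu>. S x * x t) = (LINT x|\<mu>. x p * x t) + (LINT x|\<mu>. x 1 * x t)"
      unfolding S_def distrib_right
      by (intro Bochner_Integration.integral_add square_integrable_mult sie p1 t)
    also have "\<dots> = (1 - \<bar>t - p\<bar> / p) + (1 - \<bar>t - 1\<bar> / p)"
      using law_second_moments(2)[OF p1(1) t] law_second_moments(2)[OF p1(2) t] by simp
    also have "\<dots> = q / p" using t p by (simp add: q_def field_simps)
    finally show ?thesis .
  qed
  have SS: "(LINT x|\<mu>. (S x)\<^sup>2) = 2 * q / p"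
  proof -
    have "(LINT x|\<mu>. (S x)\<^sup>2) = (LINT x|\<mu>. S x * x p + S x * x 1)"
      by (intro Bochner_Integration.integral_cong) (auto simp: S_def power2_eq_square distrib_left)
    also have "\<dots> = (LINT x|\<mu>. S x * x p) + (LINT x|\<mu>. S x * x 1)"
      by (intro Bochner_Integration.integral_add square_integrable_mult sie siS p1)
    finally show ?thesis using St p1 by simp
  qed
  have JS: "(LINT x|\<mu>. S x * J x) = 0"
  proof -
    have "(LINT x|\<mu>. S x * J x) = (LINT x|\<mu>. J x * x p + J x * x 1)"
      by (intro Bochner_Integration.integral_cong) (auto simp: S_def algebra_simps)
    also have "\<dots> = (LINT x|\<mu>. J x * x p) + (LINT x|\<mu>. J x * x 1)"
      by (intro Bochner_Integration.integral_add square_integrable_mult sie siJ p1)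
    also have "\<dots> = 0" unfolding mom(2)[OF p1(1)] mom(2)[OF p1(2)] s_int_self by (simp add: algebra_simps)
    finally show ?thesis .
  qed
  have sp: "sqrt p * sqrt p = p" "sqrt p > 0" using p by auto
  have kq: "k * (q / p) = (1 / sqrt p) * (a / 2)"
  proof -
    have "k * (q / p) = (sqrt p / p) * (a / 2)" using q by (simp add: k_def)
    also have "sqrt p / p = 1 / sqrt p" using sp p by (simp add: field_simps)
    finally show ?thesis .
  qed
  show "(LINT x|\<mu>. Z x * x t) = (1 / sqrt p) * (c + s_int p g t)" if t: "t \<in> {p..1}" for t
  proof -
    have "(LINT x|\<mu>. Z x * x t) = (LINT x|\<mu>. k * (S x * x t) + (1 / 2) * (J x * x t))"
      by (simp add: Zeq distrib_right mult.assoc)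
    also have "\<dots> = (LINT x|\<mu>. k * (S x * x t)) + (LINT x|\<mu>. (1 / 2) * (J x * x t))"
      by (intro Bochner_Integration.integral_add integrable_mult_right square_integrable_mult sie siJ siS t)
    also have "\<dots> = k * (q / p) + (1 / 2) * ((1 / sqrt p) * (2 * s_int p g t - s_int p g 1))"
      using St[OF t] mom(2)[OF t] by simp
    also have "\<dots> = (1 / sqrt p) * (c + s_int p g t)"
      unfolding kq using sp by (simp add: a_def field_simps)
    finally show ?thesis .
  qed
  have "(LINT x|\<mu>. (Z x)\<^sup>2) = k\<^sup>2 * (2 * q / p) + (1 / 4) * (2 * (LINT s|L. (g s)\<^sup>2))"
    using integral_square_add[OF square_integrable_cmult[OF siS, of k] square_integrable_cmult[OF siJ, of "1/2"]] JS
    unfolding Zeq integral_square_cmult SS mom(1)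
    by (simp add: power2_eq_square mult.left_commute[of _ "J _"] mult.assoc)
  also have "k\<^sup>2 * (2 * q / p) = a\<^sup>2 / (2 * q)"
    using q p sp by (simp add: k_def power2_eq_square field_simps)
  finally show "(LINT x|\<mu>. (Z x)\<^sup>2) = (1 / 2) * ((2 * c + s_int p g 1)\<^sup>2 / (3 * p - 1) + (LINT s|L. (g s)\<^sup>2))"
    unfolding a_def[symmetric] q_def[symmetric] by simp
qed

text \<open>By the Cauchy-Schwarz inequality the shift inherits the continuity of the process in the
  quadratic mean.\<close>

lemma representer_continuous:
  assumes Z: "Z \<in> L2_evaluation_closure p 1 \<mu>" and h: "\<And>t. t \<in> {p..1} \<Longrightarrow> h t = (LINT x|\<mu>. Z x * x t)"
    and ext: "h \<in> extensional {p..1}"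
  shows "h \<in> mspace (C_space p 1)"
proof -
  have siZ: "square_integrable \<mu> Z" by (rule law.square_integrable_closure[OF Z])
  note sie = law.square_integrable_evaluation
  have bound: "\<bar>h t - h s\<bar> \<le> sqrt ((LINT x|\<mu>. (Z x)\<^sup>2) * (2 * \<bar>t - s\<bar> / p))" if "s \<in> {p..1}" "t \<in> {p..1}" for s t
  proof -
    have "h t - h s = (LINT x|\<mu>. Z x * (x t - x s))"
      using square_integrable_mult[OF siZ sie[OF that(1)]] square_integrable_mult[OF siZ sie[OF that(2)]] h that
      by (simp add: right_diff_distrib)
    then have "(h t - h s)\<^sup>2 \<le> (LINT x|\<mu>. (Z x)\<^sup>2) * (2 * \<bar>t - s\<bar> / p)"
      using integral_Cauchy_Schwarz[OF siZ square_integrable_diff[OF sie[OF that(2)] sie[OF that(1)]]]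
        law_second_moments(1)[OF that] by simp
    then show ?thesis by (intro real_le_rsqrt) simp
  qed
  have "continuous_on {p..1} h"
    unfolding continuous_on_def
  proof
    fix s assume s: "s \<in> {p..1}"
    have "((\<lambda>t. h t - h s) \<longlongrightarrow> 0) (at s within {p..1})"
    proof (rule Lim_null_comparison)
      show "\<forall>\<^sub>F t in at s within {p..1}. norm (h t - h s) \<le> sqrt ((LINT x|\<mu>. (Z x)\<^sup>2) * (2 * \<bar>t - s\<bar> / p))"
        unfolding eventually_at_filter using bound[OF s] by (auto intro!: always_eventually)
      have "((\<lambda>t. sqrt ((LINT x|\<mu>. (Z x)\<^sup>2) * (2 * \<bar>t - s\<bar> / p))) \<longlongrightarrow>
          sqrt ((LINT x|\<mu>. (Z x)\<^sup>2) * (2 * \<bar>s - s\<bar> / p))) (at s within {p..1})"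
        using p by (intro tendsto_intros) auto
      then show "((\<lambda>t. sqrt ((LINT x|\<mu>. (Z x)\<^sup>2) * (2 * \<bar>t - s\<bar> / p))) \<longlongrightarrow> 0) (at s within {p..1})" by simp
    qed
    then show "(h \<longlongrightarrow> h s) (at s within {p..1})" by (simp add: LIM_zero_iff)
  qed
  then show ?thesis using ext by (simp add: mspace_C_space)
qed

lemma L2_on_nabla:
  assumes f: "L2_on 0 1 f"
  shows "L2_on p 1 (nabla p f)"
    and "s_int p (nabla p f) 1 = s_int 0 f 1 - s_int 0 f p - s_int 0 f (1 - p)"
proof -
  have f1: "L2_on p 1 f" using L2_on_subset[OF f, of p 1] p by simp
  have f2: "L2_on p 1 (\<lambda>x. f (x - p))"
    using L2_on_shift[OF L2_on_subset[OF f, of 0 "1 - p"], of p] p by simp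
  have n: "nabla p f = (\<lambda>x. f x - f (x - p))" by (auto simp: nabla_def)
  show "L2_on p 1 (nabla p f)"
    unfolding n using f1 f2 unfolding L2_on_square_integrable by (rule square_integrable_diff)
  have "s_int p (nabla p f) 1 = s_int p f 1 - s_int p (\<lambda>x. f (x - p)) 1"
    using L2_on_integrable[OF f1] L2_on_integrable[OF f2]
    by (simp add: n s_int_eq_indicator right_diff_distrib)
  moreover have "s_int p (\<lambda>x. f (x - p)) 1 = s_int 0 f (1 - p)"
    using s_int_shift[of 0 p f "1 - p"] by simp
  moreover have "s_int 0 f p + s_int p f 1 = s_int 0 f 1"
    using s_int_add[OF f, of p] p by simp
  ultimately show "s_int p (nabla p f) 1 = s_int 0 f 1 - s_int 0 f p - s_int 0 f (1 - p)" by simp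
qed

text \<open>For \<open>p = 1\<close> the quotient has the value \<open>0\<close>, which agrees with the right-hand side because
  the range of integration is a point.\<close>

lemma delta_eq:
  assumes f: "L2_on 0 1 f"
  shows "1 / (1 - p) * (s_int 0 f 1 - s_int 0 f p - s_int 0 f (1 - p)) * (1 - p) = s_int p (nabla p f) 1"
proof (cases "p = 1")
  case True
  then show ?thesis using L2_on_nabla(2)[OF f] s_int_self[of 0 f] by simp
next
  case False
  then show ?thesis using L2_on_nabla(2)[OF f] p by simp
qed

lemma slepian_density:
  assumes f: "L2_on 0 1 f" and J: "is_nabla_wiener_integral M B p (nabla p f) J"
    and h: "h = (\<lambda>t\<in>{p..1}. 1 / sqrt p * s_int 0 f p + s_int p (\<lambda>u. 1 / sqrt p * nabla p f u) t)"
  shows "h \<in> H_Slepian M B p"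
    and "AE x in \<mu>. RN_deriv \<mu> (slepian_law M B p h) x = ennreal (exp (slepian_exponent p f x (J x)))"
proof -
  let ?g = "nabla p f"
  have g: "L2_on p 1 ?g" by (rule L2_on_nabla(1)[OF f])
  define Z where "Z = (\<lambda>x. (2 * s_int 0 f p + s_int p ?g 1) / (2 * (3 * p - 1)) * (sqrt p * x p + sqrt p * x 1) + 1 / 2 * J x)"
  have Z: "Z \<in> L2_evaluation_closure p 1 \<mu>"
    "\<And>t. t \<in> {p..1} \<Longrightarrow> (LINT x|\<mu>. Z x * x t) = (1 / sqrt p) * (s_int 0 f p + s_int p ?g t)"
    "(LINT x|\<mu>. (Z x)\<^sup>2) = (1 / 2) * ((2 * s_int 0 f p + s_int p ?g 1)\<^sup>2 / (3 * p - 1) + (LINT s|L. (?g s)\<^sup>2))"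
    unfolding Z_def by (rule slepian_representer[OF g J], assumption?)+
  have h_eq: "h = (\<lambda>t\<in>{p..1}. LINT x|\<mu>. Z x * x t)"
  proof
    fix t
    have "s_int p (\<lambda>u. 1 / sqrt p * ?g u) t = 1 / sqrt p * s_int p ?g t"
      unfolding s_int_def by simp
    then show "h t = (\<lambda>t\<in>{p..1}. LINT x|\<mu>. Z x * x t) t"
      unfolding h using Z(2)[of t] by (auto simp: restrict_def add_divide_distrib)
  qed
  show "h \<in> H_Slepian M B p"
    unfolding H_Slepian_def gaussian_kernel_def h_eq using Z(1) by blast
  have hC: "h \<in> mspace (C_space p 1)"
    by (rule representer_continuous[OF Z(1)]) (auto simp: h_eq)
  have ex: "slepian_exponent p f x (J x) = Z x - (LINT x|\<mu>. (Z x)\<^sup>2) / 2" for x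
  proof -
    have sq: "(L2_norm_on p 1 (\<lambda>t. f t - f (t - p)))\<^sup>2 = (LINT s|L. (?g s)\<^sup>2)"
      by (simp add: L2_norm_on_def nabla_def)
    show ?thesis
      unfolding slepian_exponent_def Let_def sq delta_eq[OF f] Z(3) unfolding Z_def by simp
  qed
  have "density \<mu> (\<lambda>x. ennreal (exp (Z x - (LINT x|\<mu>. (Z x)\<^sup>2) / 2))) = slepian_law M B p h"
    unfolding law_shift[OF hC] by (rule law.Cameron_Martin_density[OF Z(1) hC, symmetric]) (simp add: h_eq)
  moreover have "Z \<in> borel_measurable \<mu>"
    by (rule square_integrable_measurable[OF law.square_integrable_closure[OF Z(1)]])
  ultimately have "AE x in \<mu>. ennreal (exp (Z x - (LINT x|\<mu>. (Z x)\<^sup>2) / 2)) = RN_deriv \<mu> (slepian_law M B p h) x"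
    by (intro law.RN_deriv_unique) auto
  then show "AE x in \<mu>. RN_deriv \<mu> (slepian_law M B p h) x = ennreal (exp (slepian_exponent p f x (J x)))"
    unfolding ex by eventually_elim simp
qed

lemma slepian_absolutely_continuous_iff:
  assumes h: "h \<in> mspace (C_space p 1)"
  shows "absolutely_continuous \<mu> (slepian_law M B p h) \<longleftrightarrow> h \<in> H_Slepian M B p"
  unfolding law_shift[OF h] H_Slepian_def by (rule law.Cameron_Martin_iff[OF h])

end

theorem theorem3p3:
  fixes M :: "'a measure" and B :: "real \<Rightarrow> 'a \<Rightarrow> real" and p :: real
  assumes "brownian_motion_01 M B" and "1 / 2 \<le> p" and "p \<le> 1"
  shows "(\<forall>h \<in> mspace (C_space p 1).
            absolutely_continuous (slepian_law M B p (\<lambda>_. 0)) (slepian_law M B p h)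
              \<longleftrightarrow> h \<in> H_Slepian M B p)
       \<and> (\<forall>f h. L2_on 0 1 f \<longrightarrow>
            h = (\<lambda>t\<in>{p..1}. 1 / sqrt p * s_int 0 f p
                              + s_int p (\<lambda>u. 1 / sqrt p * nabla p f u) t) \<longrightarrow>
            h \<in> H_Slepian M B p
            \<and> (\<exists>J. is_nabla_wiener_integral M B p (nabla p f) J)
            \<and> (\<forall>J. is_nabla_wiener_integral M B p (nabla p f) J \<longrightarrow>
                 (AE x in slepian_law M B p (\<lambda>_. 0).
                    RN_deriv (slepian_law M B p (\<lambda>_. 0)) (slepian_law M B p h) x
                      = ennreal (exp (slepian_exponent p f x (J x))))))"
proof -
  have "prob_space M" using assms(1) by (simp add: brownian_motion_01_def)
  then interpret slepian M B p
    using assms by (simp add: slepian_def brownian_motion_def brownian_motion_axioms_def slepian_axioms_def)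
  show ?thesis
  proof (intro conjI ballI allI impI)
    fix f h assume f: "L2_on 0 1 f" and h: "h = (\<lambda>t\<in>{p..1}. 1 / sqrt p * s_int 0 f p
                              + s_int p (\<lambda>u. 1 / sqrt p * nabla p f u) t)"
    obtain J where J: "is_nabla_wiener_integral M B p (nabla p f) J"
      by (rule nabla_integral_exists[OF L2_on_nabla(1)[OF f]])
    then show "\<exists>J. is_nabla_wiener_integral M B p (nabla p f) J" by blast
    show "h \<in> H_Slepian M B p" by (rule slepian_density(1)[OF f J h])
    show "AE x in \<mu>. RN_deriv \<mu> (slepian_law M B p h) x = ennreal (exp (slepian_exponent p f x (J x)))"
      if "is_nabla_wiener_integral M B p (nabla p f) J" for J
      by (rule slepian_density(2)[OF f that h])
  qed (rule slepian_absolutely_continuous_iff)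
qed

end
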